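(* Consider the depth-$m$ AA-Picard iteration for the steady Navier–Stokes equations with the $H^1_0$ norm used for the AA optimization, as described in the context. Suppose there is $\sigma>0$ with $\sigma\|\nabla e_j\|\le \|\nabla(w_{j+1}-w_j)\|$ for all $j$, suppose $0<|\alpha^k_j|<\bar\alpha$ for all $k,j$ for some fixed $\bar\alpha$, and suppose the residual differences $\{w_j-w_{j-1}\}_{j=1,\dots,k}$ are not linearly dependent in the $H^1_0$ inner product. Let $K$ be a constant with $\|\nabla e_j\|\le K\|\nabla w_j\|$ for all $j$. Then \[ \|\nabla w_{k+1}\|\le \kappa\,(\theta^{H^1_0}_{k,m})^{1/2}(\theta^{L^2}_{k,m})^{1/2}\left(\frac{\|\sum_{j=k-m}^k\alpha^k_jw_j\|}{\|\sum_{j=k-m}^k\hat\alpha^k_jw_j\|}\,\frac{\|w_k\|}{C_P\|\nabla w_k\|}\right)^{1/2}\|\nabla w_k\| + K^2M\nu^{-1}\kappa\,\frac{m(m+3)\bar\alpha}{2}\sum_{j=k-m+1}^{k}\sum_{i=k-m}^{j-1}\|\nabla w_j\|\,\|\nabla w_i\|. \]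
   Context: Let $\Omega\subset\mathbb{R}^d$, $d\in\{2,3\}$, be a bounded open connected domain; $(\cdot,\cdot)$ and $\|\cdot\|$ denote the $L^2(\Omega)$ inner product and norm, $\|\cdot\|_{-1}$ the $H^{-1}(\Omega)$ norm and $\langle\cdot,\cdot\rangle$ the $H^{-1}$–$H^1_0$ duality pairing. $X=H^1_0(\Omega)^d$, $Q=\{q\in L^2(\Omega):\int_\Omega q=0\}$. $C_P$ is the Poincaré constant: $\|\phi\|\le C_P\|\nabla\phi\|$ for $\phi\in X$. $b^*(v,w,z)=(v\cdot\nabla w,z)+\tfrac12((\nabla\cdot v)w,z)$. $M:=C_P^{1/2}C_3C_6$, where $\|\phi\|_{L^6}\le C_6\|\nabla\phi\|$ and $\|\phi\|_{L^3}\le C_3\|\phi\|^{1/2}\|\nabla\phi\|^{1/2}$ for $\phi\in X$. Let $X_h\subset X$, $Q_h\subset Q$ be conforming finite element spaces satisfying the inf-sup condition $\sup_{0\ne v\in X_h}(\nabla\cdot v,q)/\|\nabla v\|\ge\beta\|q\|$ for all $q\in Q_h$ with $\beta>0$, and $V_h=\{v\in X_h:(\nabla\cdot v,q)=0\ \forall q\in Q_h\}$. Let $\nu>0$, $f\in H^{-1}(\Omega)$, and $\kappa:=M\nu^{-2}\|f\|_{-1}$ (no smallness assumed). The Picard operator $g:V_h\to V_h$ maps $u$ to the unique $g(u)\in V_h$ with $\nu(\nabla g(u),\nabla v)+b^*(u,g(u),v)=\langle f,v\rangle$ for all $v\in V_h$. AA-Picard of depth $m$ (no damping): set $\tilde u_j:=g(u_{j-1})$,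 $w_j:=\tilde u_j-u_{j-1}$, $e_j:=u_j-u_{j-1}$; at step $k$ the coefficients $(\alpha^k_j)_{j=k-m}^k$ minimize $\|\nabla\sum_{j=k-m}^k\alpha_jw_j\|$ subject to $\sum_j\alpha_j=1$, and $u_k=\sum_{j=k-m}^k\alpha^k_j\tilde u_j$. $(\hat\alpha^k_j)_{j=k-m}^k$ denote the minimizers of $\|\sum_{j=k-m}^k\alpha_jw_j\|$ ($L^2$ norm) subject to $\sum_j\alpha_j=1$, for the same residuals. Gains: $\theta^{H^1_0}_{k,m}=\|\nabla\sum_{j=k-m}^k\alpha^k_jw_j\|/\|\nabla w_k\|$ and $\theta^{L^2}_{k,m}=\|\sum_{j=k-m}^k\hat\alpha^k_jw_j\|/\|w_k\|$. The paper notes that under the $\sigma$-assumption a constant $K$ as in the claim exists (depending on $\sigma$, the gain and the degree of linear independence of the residual differences). *)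

theory Defs
  imports "HOL-Analysis.Analysis"
begin

section \<open>Function spaces on a domain \<Omega> \<subseteq> R^d (functions defined on all of R^d, only their values on \<Omega> matter)\<close>

definition L2fun :: "('n::euclidean_space) set \<Rightarrow> ('n \<Rightarrow> 'b::real_normed_vector) \<Rightarrow> bool" where
  "L2fun \<Omega> u \<longleftrightarrow> u \<in> borel_measurable (lebesgue_on \<Omega>)
      \<and> integrable (lebesgue_on \<Omega>) (\<lambda>x. (norm (u x))\<^sup>2)"

definition l2norm :: "('n::euclidean_space) set \<Rightarrow> ('n \<Rightarrow> 'b::real_normed_vector) \<Rightarrow> real" where
  "l2norm \<Omega> u = sqrt (integral\<^sup>L (lebesgue_on \<Omega>) (\<lambda>x. (norm (u x))\<^sup>2))"

definition l2inner :: "('n::euclidean_space) set \<Rightarrow> ('n \<Rightarrow> 'b::real_inner) \<Rightarrow> ('n \<Rightarrow> 'b) \<Rightarrow> real" where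
  "l2inner \<Omega> u v = integral\<^sup>L (lebesgue_on \<Omega>) (\<lambda>x. inner (u x) (v x))"

definition Lpnorm :: "('n::euclidean_space) set \<Rightarrow> real \<Rightarrow> ('n \<Rightarrow> 'b::real_normed_vector) \<Rightarrow> real" where
  "Lpnorm \<Omega> p u = (integral\<^sup>L (lebesgue_on \<Omega>) (\<lambda>x. norm (u x) powr p)) powr (1 / p)"

definition scalar_test :: "(real^'d) set \<Rightarrow> (real^'d \<Rightarrow> real) \<Rightarrow> (real^'d \<Rightarrow> real^'d) \<Rightarrow> bool" where
  "scalar_test \<Omega> \<psi> D\<psi> \<longleftrightarrow> (\<forall>x. (\<psi> has_derivative (\<lambda>h. D\<psi> x \<bullet> h)) (at x))
      \<and> continuous_on UNIV D\<psi>
      \<and> compact (closure {x. \<psi> x \<noteq> 0}) \<and> closure {x. \<psi> x \<noteq> 0} \<subseteq> \<Omega>"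

definition vector_test :: "(real^'d) set \<Rightarrow> (real^'d \<Rightarrow> real^'d) \<Rightarrow> (real^'d \<Rightarrow> real^'d^'d) \<Rightarrow> bool" where
  "vector_test \<Omega> \<phi> D\<phi> \<longleftrightarrow> (\<forall>x. (\<phi> has_derivative (\<lambda>h. D\<phi> x *v h)) (at x))
      \<and> continuous_on UNIV D\<phi>
      \<and> compact (closure {x. \<phi> x \<noteq> 0}) \<and> closure {x. \<phi> x \<noteq> 0} \<subseteq> \<Omega>"

definition weak_grad :: "(real^'d) set \<Rightarrow> (real^'d \<Rightarrow> real^'d) \<Rightarrow> (real^'d \<Rightarrow> real^'d^'d) \<Rightarrow> bool" where
  "weak_grad \<Omega> u G \<longleftrightarrow> (\<forall>\<psi> D\<psi>. scalar_test \<Omega> \<psi> D\<psi> \<longrightarrow>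
      (\<forall>i j. integral\<^sup>L (lebesgue_on \<Omega>) (\<lambda>x. u x $ i * D\<psi> x $ j)
           = - integral\<^sup>L (lebesgue_on \<Omega>) (\<lambda>x. G x $ i $ j * \<psi> x)))"

definition H10 :: "(real^'d) set \<Rightarrow> (real^'d \<Rightarrow> real^'d) \<Rightarrow> bool" where
  "H10 \<Omega> u \<longleftrightarrow> L2fun \<Omega> u \<and> (\<exists>G. L2fun \<Omega> G \<and> weak_grad \<Omega> u G \<and>
      (\<exists>\<phi> D\<phi>. (\<forall>n. vector_test \<Omega> (\<phi> n) (D\<phi> n))
         \<and> (\<lambda>n. l2norm \<Omega> (\<lambda>x. u x - \<phi> n x)) \<longlonglongrightarrow> 0
         \<and> (\<lambda>n. l2norm \<Omega> (\<lambda>x. G x - D\<phi> n x)) \<longlonglongrightarrow> 0))"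

text \<open>The (weak) gradient, determined up to null sets\<close>
definition grad :: "(real^'d) set \<Rightarrow> (real^'d \<Rightarrow> real^'d) \<Rightarrow> (real^'d \<Rightarrow> real^'d^'d)" where
  "grad \<Omega> u = (SOME G. L2fun \<Omega> G \<and> weak_grad \<Omega> u G)"

definition h1norm :: "(real^'d) set \<Rightarrow> (real^'d \<Rightarrow> real^'d) \<Rightarrow> real" where
  "h1norm \<Omega> u = l2norm \<Omega> (grad \<Omega> u)"

definition divg :: "(real^'d) set \<Rightarrow> (real^'d \<Rightarrow> real^'d) \<Rightarrow> real^'d \<Rightarrow> real" where
  "divg \<Omega> u x = (\<Sum>i\<in>UNIV. grad \<Omega> u x $ i $ i)"

definition bstar :: "(real^'d) set \<Rightarrow> (real^'d \<Rightarrow> real^'d) \<Rightarrow> (real^'d \<Rightarrow> real^'d) \<Rightarrow> (real^'d \<Rightarrow> real^'d) \<Rightarrow> real" where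
  "bstar \<Omega> v w z = l2inner \<Omega> (\<lambda>x. grad \<Omega> w x *v v x) z
      + 1/2 * integral\<^sup>L (lebesgue_on \<Omega>) (\<lambda>x. divg \<Omega> v x * inner (w x) (z x))"

definition meanzero :: "(real^'d) set \<Rightarrow> (real^'d \<Rightarrow> real) \<Rightarrow> bool" where
  "meanzero \<Omega> q \<longleftrightarrow> L2fun \<Omega> q \<and> integral\<^sup>L (lebesgue_on \<Omega>) q = 0"

definition Hminus1 :: "(real^'d) set \<Rightarrow> ((real^'d \<Rightarrow> real^'d) \<Rightarrow> real) \<Rightarrow> bool" where
  "Hminus1 \<Omega> f \<longleftrightarrow>
     (\<forall>\<phi> \<psi> a b. H10 \<Omega> \<phi> \<and> H10 \<Omega> \<psi> \<longrightarrow> f (\<lambda>x. a *\<^sub>R \<phi> x + b *\<^sub>R \<psi> x) = a * f \<phi> + b * f \<psi>)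
     \<and> (\<exists>C. \<forall>\<phi>. H10 \<Omega> \<phi> \<longrightarrow> \<bar>f \<phi>\<bar> \<le> C * h1norm \<Omega> \<phi>)"

definition dual_norm :: "(real^'d) set \<Rightarrow> ((real^'d \<Rightarrow> real^'d) \<Rightarrow> real) \<Rightarrow> real" where
  "dual_norm \<Omega> f = Sup {\<bar>f \<phi>\<bar> / h1norm \<Omega> \<phi> | \<phi>. H10 \<Omega> \<phi> \<and> h1norm \<Omega> \<phi> \<noteq> 0}"

definition finite_span :: "('a \<Rightarrow> 'b::real_vector) set \<Rightarrow> bool" where
  "finite_span S \<longleftrightarrow> (\<exists>B :: ('a \<Rightarrow> 'b) list.
      S = {(\<lambda>x. \<Sum>i<length B. c i *\<^sub>R (B ! i) x) | c. True})"

definition inf_sup :: "(real^'d) set \<Rightarrow> (real^'d \<Rightarrow> real^'d) set \<Rightarrow> (real^'d \<Rightarrow> real) set \<Rightarrow> real \<Rightarrow> bool" where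
  "inf_sup \<Omega> Xh Qh \<beta> \<longleftrightarrow> (\<forall>q\<in>Qh.
      (SUP v\<in>{v\<in>Xh. v \<noteq> (\<lambda>x. 0)}. l2inner \<Omega> (divg \<Omega> v) q / h1norm \<Omega> v) \<ge> \<beta> * l2norm \<Omega> q)"

definition Vh :: "(real^'d) set \<Rightarrow> (real^'d \<Rightarrow> real^'d) set \<Rightarrow> (real^'d \<Rightarrow> real) set \<Rightarrow> (real^'d \<Rightarrow> real^'d) set" where
  "Vh \<Omega> Xh Qh = {v\<in>Xh. \<forall>q\<in>Qh. l2inner \<Omega> (divg \<Omega> v) q = 0}"

definition picard :: "(real^'d) set \<Rightarrow> real \<Rightarrow> ((real^'d \<Rightarrow> real^'d) \<Rightarrow> real) \<Rightarrow> (real^'d \<Rightarrow> real^'d) set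
     \<Rightarrow> (real^'d \<Rightarrow> real^'d) \<Rightarrow> (real^'d \<Rightarrow> real^'d) \<Rightarrow> bool" where
  "picard \<Omega> \<nu> f V u gu \<longleftrightarrow> gu \<in> V \<and>
     (\<forall>v\<in>V. \<nu> * l2inner \<Omega> (grad \<Omega> gu) (grad \<Omega> v) + bstar \<Omega> u gu v = f v)"

definition win :: "nat \<Rightarrow> nat \<Rightarrow> nat set" where
  "win m n = {n - min m (n - 1) .. n}"

definition resid :: "(nat \<Rightarrow> 'a \<Rightarrow> 'b::real_vector) \<Rightarrow> (nat \<Rightarrow> 'a \<Rightarrow> 'b) \<Rightarrow> nat \<Rightarrow> 'a \<Rightarrow> 'b" where
  "resid u ut j = (\<lambda>x. ut j x - u (j - 1) x)"

definition incr :: "(nat \<Rightarrow> 'a \<Rightarrow> 'b::real_vector) \<Rightarrow> nat \<Rightarrow> 'a \<Rightarrow> 'b" where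
  "incr u j = (\<lambda>x. u j x - u (j - 1) x)"

definition comb :: "(nat \<Rightarrow> real) \<Rightarrow> nat set \<Rightarrow> (nat \<Rightarrow> 'a \<Rightarrow> 'b::real_vector) \<Rightarrow> 'a \<Rightarrow> 'b" where
  "comb c W F = (\<lambda>x. \<Sum>j\<in>W. c j *\<^sub>R F j x)"

definition AA_picard :: "(real^'d) set \<Rightarrow> real \<Rightarrow> ((real^'d \<Rightarrow> real^'d) \<Rightarrow> real) \<Rightarrow> (real^'d \<Rightarrow> real^'d) set
     \<Rightarrow> nat \<Rightarrow> (nat \<Rightarrow> real^'d \<Rightarrow> real^'d) \<Rightarrow> (nat \<Rightarrow> real^'d \<Rightarrow> real^'d) \<Rightarrow> (nat \<Rightarrow> nat \<Rightarrow> real) \<Rightarrow> bool" where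
  "AA_picard \<Omega> \<nu> f V m u ut \<alpha> \<longleftrightarrow> u 0 \<in> V \<and>
     (\<forall>n\<ge>1. picard \<Omega> \<nu> f V (u (n - 1)) (ut n)
        \<and> sum (\<alpha> n) (win m n) = 1
        \<and> (\<forall>\<gamma>. sum \<gamma> (win m n) = 1 \<longrightarrow>
              h1norm \<Omega> (comb (\<alpha> n) (win m n) (resid u ut))
                \<le> h1norm \<Omega> (comb \<gamma> (win m n) (resid u ut)))
        \<and> u n = comb (\<alpha> n) (win m n) ut)"

text \<open>The family F_j (j \<in> J) is linearly independent w.r.t. the H^1_0 inner product
  (its Gram matrix is nonsingular): only the trivial combination has zero H^1_0 norm.\<close>
definition h1_indep :: "(real^'d) set \<Rightarrow> (nat \<Rightarrow> real^'d \<Rightarrow> real^'d) \<Rightarrow> nat set \<Rightarrow> bool" where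
  "h1_indep \<Omega> F J \<longleftrightarrow> (\<forall>c. h1norm \<Omega> (comb c J F) = 0 \<longrightarrow> (\<forall>j\<in>J. c j = 0))"

end

theory Submission
  imports Defs "HOL-Library.Function_Algebras"
begin

text \<open>Subtract the extrapolated Picard equations of the last \<open>m + 1\<close> steps from the one for \<open>g(u\<^sub>k)\<close> and
  test with \<open>v = w\<^sub>k\<^sub>+\<^sub>1\<close>. By skew-symmetry of \<open>b\<^sup>*\<close> in its last two arguments what is left is
  \<open>- b\<^sup>*(w\<^sup>\<alpha>, g(u\<^sub>k), v)\<close>, where \<open>w\<^sup>\<alpha> = \<Sum>\<^sub>j \<alpha>\<^sub>j w\<^sub>j\<close>, and \<open>\<Sum>\<^sub>l b\<^sup>*(e\<^sub>l, S\<^sub>l, v)\<close> over \<open>l < k\<close>, where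
  \<open>S\<^sub>l = \<Sum>\<^sub>j\<^sub>\<le>\<^sub>l \<alpha>\<^sub>j (g(u\<^sub>k) - u~\<^sub>j)\<close>. The first term, estimated by Hoelder's inequality with exponents 3, 2, 6, is the
  gain term. In the second, the Lipschitz bound for \<open>g\<close> produces products of the norms of increments,
  among them squares \<open>|\<gamma>\<^sub>l| \<parallel>\<nabla>e\<^sub>l\<parallel>\<^sup>2\<close> with \<open>\<gamma>\<^sub>l = \<Sum>\<^sub>j\<^sub>\<le>\<^sub>l \<alpha>\<^sub>j\<close>, which the claim does not allow. They are turned into mixed
  products by \<open>w\<^sup>\<alpha> = \<Sum>\<^sub>l \<gamma>\<^sub>l e\<^sub>l\<close> and the minimality \<open>\<parallel>\<nabla>w\<^sup>\<alpha>\<parallel> \<le> \<parallel>\<nabla>w\<^sub>k\<parallel>\<close>. The constants fit because the first step,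
  where \<open>\<alpha>\<^sub>1 = 1\<close> and \<open>e\<^sub>1 = w\<^sub>1\<close>, forces \<open>K \<ge> 1\<close> and \<open>abar > 1\<close>. Skew-symmetry itself is the weak
  divergence theorem for \<open>v\<close> tested with \<open>\<phi> \<bullet> \<psi>\<close>, extended from test functions by density.\<close>

section \<open>Square-integrable functions\<close>

text \<open>Vectors here are functions, not classes, and \<open>grad\<close> is a choice up to null
  sets. The error analysis therefore treats the gradient norm as a mere seminorm, in an abstract
  locale. The error sum stops at \<open>l < k\<close> because of a free choice of base point. Since
  the weights sum to one, the differences between g(u_k) and the earlier Picard images combine to v
  itself, and \<open>bstar\<close> vanishes when v fills both last slots. So every velocity u_(j-1)
  in the first slot may be measured from u_(k-1), and e_k never stands in front. The constant m (m +
  3) / 2 has to pay for the trade of squares. A partial sum \<gamma>_l has l - p + 1 terms, each at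
  most \<open>abar\<close>; the trade adds one such sum to each mixed product. This fits for m at
  least 2; m = 0 gives empty sums, and m = 1 needs an argument of its own. Optimality of the weights
  enters only through the competitor concentrated at k. The resulting bound has no factor K, while
  every increment is measured by K times a residual, so K at least 1 is what puts both on one scale.
  The gain term is no further estimate: the quotients in it cancel to the interpolated Hoelder bound
  for w^\<alpha>.\<close>

lemma L2funD:
  assumes "L2fun \<Omega> u"
  shows "u \<in> borel_measurable (lebesgue_on \<Omega>)" "integrable (lebesgue_on \<Omega>) (\<lambda>x. (norm (u x))\<^sup>2)"
  using assms by (auto simp: L2fun_def)

lemma l2norm_nonneg [simp]: "0 \<le> l2norm \<Omega> u"
  by (simp add: l2norm_def)

lemma l2norm_sq: "(l2norm \<Omega> u)\<^sup>2 = integral\<^sup>L (lebesgue_on \<Omega>) (\<lambda>x. (norm (u x))\<^sup>2)"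
  by (simp add: l2norm_def)

lemma l2norm_sq_inner:
  fixes u :: "'n::euclidean_space \<Rightarrow> 'b::real_inner"
  shows "(l2norm \<Omega> u)\<^sup>2 = l2inner \<Omega> u u"
  by (simp add: l2norm_sq l2inner_def power2_norm_eq_inner)

lemma l2norm_cong_AE:
  fixes u v :: "'n::euclidean_space \<Rightarrow> 'b::euclidean_space"
  assumes "AE x in lebesgue_on \<Omega>. u x = v x"
    and "u \<in> borel_measurable (lebesgue_on \<Omega>)" "v \<in> borel_measurable (lebesgue_on \<Omega>)"
  shows "l2norm \<Omega> u = l2norm \<Omega> v"
  unfolding l2norm_def using assms by (intro arg_cong[where f=sqrt] integral_cong_AE) auto

lemma l2inner_cong_AE:
  fixes u v :: "'n::euclidean_space \<Rightarrow> 'b::euclidean_space"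
  assumes "AE x in lebesgue_on \<Omega>. u x = u' x" "AE x in lebesgue_on \<Omega>. v x = v' x"
    and "u \<in> borel_measurable (lebesgue_on \<Omega>)" "v \<in> borel_measurable (lebesgue_on \<Omega>)"
    and "u' \<in> borel_measurable (lebesgue_on \<Omega>)" "v' \<in> borel_measurable (lebesgue_on \<Omega>)"
  shows "l2inner \<Omega> u v = l2inner \<Omega> u' v'"
  unfolding l2inner_def using assms by (intro integral_cong_AE) auto

lemma L2fun_lin:
  fixes u v :: "'n::euclidean_space \<Rightarrow> 'b::euclidean_space"
  assumes "L2fun \<Omega> u" "L2fun \<Omega> v"
  shows "L2fun \<Omega> (\<lambda>x. a *\<^sub>R u x + b *\<^sub>R v x)"
  unfolding L2fun_def
proof
  note m = L2funD(1)[OF assms(1)] L2funD(1)[OF assms(2)]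
  show "(\<lambda>x. a *\<^sub>R u x + b *\<^sub>R v x) \<in> borel_measurable (lebesgue_on \<Omega>)"
    using m by measurable
  show "integrable (lebesgue_on \<Omega>) (\<lambda>x. (norm (a *\<^sub>R u x + b *\<^sub>R v x))\<^sup>2)"
  proof (rule Bochner_Integration.integrable_bound)
    show "integrable (lebesgue_on \<Omega>) (\<lambda>x. 2 * a\<^sup>2 * (norm (u x))\<^sup>2 + 2 * b\<^sup>2 * (norm (v x))\<^sup>2)"
      using L2funD(2)[OF assms(1)] L2funD(2)[OF assms(2)] by simp
    show "(\<lambda>x. (norm (a *\<^sub>R u x + b *\<^sub>R v x))\<^sup>2) \<in> borel_measurable (lebesgue_on \<Omega>)"
      using m by measurable
    have "(norm (a *\<^sub>R u x + b *\<^sub>R v x))\<^sup>2 \<le> 2 * a\<^sup>2 * (norm (u x))\<^sup>2 + 2 * b\<^sup>2 * (norm (v x))\<^sup>2" for x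
    proof -
      have "(norm (a *\<^sub>R u x + b *\<^sub>R v x))\<^sup>2 \<le> (norm (a *\<^sub>R u x) + norm (b *\<^sub>R v x))\<^sup>2"
        by (intro power_mono norm_triangle_ineq) auto
      also have "\<dots> \<le> 2 * (norm (a *\<^sub>R u x))\<^sup>2 + 2 * (norm (b *\<^sub>R v x))\<^sup>2"
        using sum_squares_bound[of "norm (a *\<^sub>R u x)" "norm (b *\<^sub>R v x)"] by (simp add: power2_sum)
      finally show ?thesis by (simp add: power_mult_distrib)
    qed
    then show "AE x in lebesgue_on \<Omega>. norm ((norm (a *\<^sub>R u x + b *\<^sub>R v x))\<^sup>2)
        \<le> norm (2 * a\<^sup>2 * (norm (u x))\<^sup>2 + 2 * b\<^sup>2 * (norm (v x))\<^sup>2)"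
      by (intro AE_I2) (smt (verit) real_norm_def zero_le_power2)
  qed
qed

lemma L2fun_diff:
  fixes u v :: "'n::euclidean_space \<Rightarrow> 'b::euclidean_space"
  assumes "L2fun \<Omega> u" "L2fun \<Omega> v"
  shows "L2fun \<Omega> (\<lambda>x. u x - v x)"
  using L2fun_lin[OF assms, of 1 "-1"] by simp

lemma L2fun_mono:
  assumes "L2fun \<Omega> u" "v \<in> borel_measurable (lebesgue_on \<Omega>)" "\<And>x. norm (v x) \<le> c * norm (u x)"
  shows "L2fun \<Omega> v" "l2norm \<Omega> v \<le> \<bar>c\<bar> * l2norm \<Omega> u"
proof -
  have le: "(norm (v x))\<^sup>2 \<le> c\<^sup>2 * (norm (u x))\<^sup>2" for x
    using power_mono[OF assms(3), of x 2] by (simp add: power_mult_distrib)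
  have i: "integrable (lebesgue_on \<Omega>) (\<lambda>x. c\<^sup>2 * (norm (u x))\<^sup>2)"
    using L2funD(2)[OF assms(1)] by simp
  show L2: "L2fun \<Omega> v"
    unfolding L2fun_def using assms(2) le by (auto intro!: Bochner_Integration.integrable_bound[OF i])
  have "(l2norm \<Omega> v)\<^sup>2 \<le> integral\<^sup>L (lebesgue_on \<Omega>) (\<lambda>x. c\<^sup>2 * (norm (u x))\<^sup>2)"
    unfolding l2norm_sq using le by (intro integral_mono L2funD(2)[OF L2] i)
  also have "\<dots> = (\<bar>c\<bar> * l2norm \<Omega> u)\<^sup>2" by (simp add: power_mult_distrib l2norm_sq)
  finally show "l2norm \<Omega> v \<le> \<bar>c\<bar> * l2norm \<Omega> u" by (rule power2_le_imp_le) simp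
qed

lemma integrable_inner_L2:
  fixes u v :: "'n::euclidean_space \<Rightarrow> 'b::euclidean_space"
  assumes "L2fun \<Omega> u" "L2fun \<Omega> v"
  shows "integrable (lebesgue_on \<Omega>) (\<lambda>x. inner (u x) (v x))"
proof (rule Bochner_Integration.integrable_bound)
  show "integrable (lebesgue_on \<Omega>) (\<lambda>x. (norm (u x))\<^sup>2 + (norm (v x))\<^sup>2)"
    using L2funD(2)[OF assms(1)] L2funD(2)[OF assms(2)] by simp
  show "(\<lambda>x. inner (u x) (v x)) \<in> borel_measurable (lebesgue_on \<Omega>)"
    using L2funD(1)[OF assms(1)] L2funD(1)[OF assms(2)] by measurable
  have "\<bar>inner (u x) (v x)\<bar> \<le> (norm (u x))\<^sup>2 + (norm (v x))\<^sup>2" for x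
  proof -
    have "0 \<le> norm (u x) * norm (v x)" by simp
    then show ?thesis
      using Cauchy_Schwarz_ineq2[of "u x" "v x"] sum_squares_bound[of "norm (u x)" "norm (v x)"]
      unfolding mult.assoc by linarith
  qed
  then show "AE x in lebesgue_on \<Omega>. norm (inner (u x) (v x)) \<le> norm ((norm (u x))\<^sup>2 + (norm (v x))\<^sup>2)"
    by (intro AE_I2) (smt (verit) real_norm_def)
qed

lemma l2inner_commute: "l2inner \<Omega> u v = l2inner \<Omega> v u"
  by (simp add: l2inner_def inner_commute)

lemma l2inner_lin_left:
  fixes u v w :: "'n::euclidean_space \<Rightarrow> 'b::euclidean_space"
  assumes "L2fun \<Omega> u" "L2fun \<Omega> v" "L2fun \<Omega> w"
  shows "l2inner \<Omega> (\<lambda>x. a *\<^sub>R u x + b *\<^sub>R v x) w = a * l2inner \<Omega> u w + b * l2inner \<Omega> v w"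
  unfolding l2inner_def
  by (simp add: inner_add_left integrable_inner_L2 assms)

lemma l2inner_lin_right:
  fixes u v w :: "'n::euclidean_space \<Rightarrow> 'b::euclidean_space"
  assumes "L2fun \<Omega> u" "L2fun \<Omega> v" "L2fun \<Omega> w"
  shows "l2inner \<Omega> w (\<lambda>x. a *\<^sub>R u x + b *\<^sub>R v x) = a * l2inner \<Omega> w u + b * l2inner \<Omega> w v"
  using l2inner_lin_left[OF assms] by (simp add: l2inner_commute)

lemma l2norm_lin_sq:
  fixes u v :: "'n::euclidean_space \<Rightarrow> 'b::euclidean_space"
  assumes "L2fun \<Omega> u" "L2fun \<Omega> v"
  shows "(l2norm \<Omega> (\<lambda>x. a *\<^sub>R u x + b *\<^sub>R v x))\<^sup>2
    = a\<^sup>2 * (l2norm \<Omega> u)\<^sup>2 + 2 * a * b * l2inner \<Omega> u v + b\<^sup>2 * (l2norm \<Omega> v)\<^sup>2"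
  using assms l2inner_commute[of \<Omega> v u] unfolding l2norm_sq_inner
  by (simp add: l2inner_lin_left l2inner_lin_right L2fun_lin power2_eq_square algebra_simps)

text \<open>The quadratic form sending (a, b) to the squared norm of a u + b v is nonnegative, so
  its discriminant has a sign. This suits a seminorm: nothing is identified modulo null
  sets.\<close>

lemma l2_Cauchy_Schwarz:
  fixes u v :: "'n::euclidean_space \<Rightarrow> 'b::euclidean_space"
  assumes "L2fun \<Omega> u" "L2fun \<Omega> v"
  shows "\<bar>l2inner \<Omega> u v\<bar> \<le> l2norm \<Omega> u * l2norm \<Omega> v"
proof -
  define A B C where "A = (l2norm \<Omega> u)\<^sup>2" and "B = l2inner \<Omega> u v" and "C = (l2norm \<Omega> v)\<^sup>2"
  have *: "0 \<le> a\<^sup>2 * A + 2 * a * b * B + b\<^sup>2 * C" for a b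
    using l2norm_lin_sq[OF assms, of a b] unfolding A_def B_def C_def
    by (metis zero_le_power2)
  have AC: "0 \<le> A" "0 \<le> C" by (auto simp: A_def C_def)
  have "B\<^sup>2 \<le> A * C"
  proof (cases "C = 0")
    case True
    have "B = 0"
    proof (rule ccontr)
      assume "B \<noteq> 0"
      \<comment> \<open>With C = 0 and a = 1 the form is affine in b; this b makes it equal to
        -1.\<close>
      have "0 \<le> A + 2 * (- (A + 1) / (2 * B)) * B"
        using *[of 1 "- (A + 1) / (2 * B)"] True by simp
      also have "\<dots> = -1" using \<open>B \<noteq> 0\<close> by (simp add: field_simps)
      finally show False by simp
    qed
    then show ?thesis using AC by simp
  next
    case False
    \<comment> \<open>At (C, -B), the minimising direction, the form equals C (A C - B^2).\<close>
    have "0 \<le> C * (A * C - B\<^sup>2)"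
      using *[of C "- B"] by (simp add: power2_eq_square algebra_simps)
    then show ?thesis using AC False by (simp add: zero_le_mult_iff)
  qed
  also have "A * C = (l2norm \<Omega> u * l2norm \<Omega> v)\<^sup>2" by (simp add: A_def C_def power_mult_distrib)
  finally have "B\<^sup>2 \<le> (l2norm \<Omega> u * l2norm \<Omega> v)\<^sup>2" .
  then show ?thesis unfolding B_def by (rule abs_le_square_iff[THEN iffD2, THEN order_trans]) simp
qed

lemma l2norm_lin_le:
  fixes u v :: "'n::euclidean_space \<Rightarrow> 'b::euclidean_space"
  assumes "L2fun \<Omega> u" "L2fun \<Omega> v"
  shows "l2norm \<Omega> (\<lambda>x. a *\<^sub>R u x + b *\<^sub>R v x) \<le> \<bar>a\<bar> * l2norm \<Omega> u + \<bar>b\<bar> * l2norm \<Omega> v"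
proof (rule power2_le_imp_le)
  have "a * b * l2inner \<Omega> u v \<le> \<bar>a * b\<bar> * (l2norm \<Omega> u * l2norm \<Omega> v)"
    using mult_left_mono[OF l2_Cauchy_Schwarz[OF assms] abs_ge_zero[of "a * b"]]
    unfolding abs_mult[symmetric] by (rule order_trans[OF abs_ge_self])
  then show "(l2norm \<Omega> (\<lambda>x. a *\<^sub>R u x + b *\<^sub>R v x))\<^sup>2 \<le> (\<bar>a\<bar> * l2norm \<Omega> u + \<bar>b\<bar> * l2norm \<Omega> v)\<^sup>2"
    unfolding l2norm_lin_sq[OF assms] by (simp add: power2_sum power_mult_distrib abs_mult algebra_simps)
qed simp

section \<open>Hoelder's inequality with exponents 2, 3, 6\<close>

text \<open>Young twice: exponents 2, 2 for a and b c, then 3/2, 3 for b^2 and c^2. The weights 1/2,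
  1/3, 1/6 add up to one, so the normalised Hoelder inequality has constant 1.\<close>

lemma Young_2_3_6:
  fixes a b c :: real
  assumes "0 \<le> b" "0 \<le> c"
  shows "a * b * c \<le> a\<^sup>2 / 2 + b ^ 3 / 3 + c ^ 6 / 6"
proof -
  have "b\<^sup>2 * c\<^sup>2 \<le> (b\<^sup>2) powr (3/2) / (3/2) + (c\<^sup>2) powr 3 / 3"
    using Youngs_inequality[of "3/2" 3 "b\<^sup>2" "c\<^sup>2"] by simp
  also have "(b\<^sup>2) powr (3/2) = b ^ 3"
    using assms powr_powr[of b 2 "3/2"] by simp
  finally have "b\<^sup>2 * c\<^sup>2 \<le> 2 / 3 * b ^ 3 + c ^ 6 / 3" by simp
  moreover have "2 * a * (b * c) \<le> a\<^sup>2 + (b * c)\<^sup>2" by (rule sum_squares_bound)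
  ultimately show ?thesis by (simp add: power_mult_distrib)
qed

text \<open>Stated for any \<open>F\<close> with a pointwise majorant, so that the convective and
  the divergence integrand are covered alike. Integrability is concluded too, because splitting
  integrals by linearity depends on it.\<close>

lemma Holder_2_3_6:
  fixes F :: "'n::euclidean_space \<Rightarrow> real"
  assumes a: "L2fun \<Omega> a" and F: "F \<in> borel_measurable (lebesgue_on \<Omega>)"
    and g: "integrable (lebesgue_on \<Omega>) (\<lambda>x. norm (g x) powr 3)"
    and h: "integrable (lebesgue_on \<Omega>) (\<lambda>x. norm (h x) powr 6)"
    and le: "\<And>x. \<bar>F x\<bar> \<le> norm (a x) * norm (g x) * norm (h x)"
  shows "integrable (lebesgue_on \<Omega>) F"
    and "\<bar>integral\<^sup>L (lebesgue_on \<Omega>) F\<bar> \<le> l2norm \<Omega> a * Lpnorm \<Omega> 3 g * Lpnorm \<Omega> 6 h"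
proof -
  let ?M = "lebesgue_on \<Omega>"
  have g': "integrable ?M (\<lambda>x. norm (g x) ^ 3)" and h': "integrable ?M (\<lambda>x. norm (h x) ^ 6)"
    using g h by simp_all
  note a' = L2funD(2)[OF a]
  show iF: "integrable ?M F"
  proof (rule Bochner_Integration.integrable_bound[OF _ F])
    show "integrable ?M (\<lambda>x. (norm (a x))\<^sup>2 / 2 + norm (g x) ^ 3 / 3 + norm (h x) ^ 6 / 6)"
      using a' g' h' by simp
    show "AE x in ?M. norm (F x) \<le> norm ((norm (a x))\<^sup>2 / 2 + norm (g x) ^ 3 / 3 + norm (h x) ^ 6 / 6)"
      using order_trans[OF le Young_2_3_6] by (intro AE_I2) (simp add: order_trans[OF _ abs_ge_self])
  qed
  define A G H where "A = l2norm \<Omega> a" and "G = Lpnorm \<Omega> 3 g" and "H = Lpnorm \<Omega> 6 h"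
  have nonneg: "A \<ge> 0" "G \<ge> 0" "H \<ge> 0"
    by (auto simp: A_def G_def H_def Lpnorm_def)
  have A2: "integral\<^sup>L ?M (\<lambda>x. (norm (a x))\<^sup>2) = A\<^sup>2"
    by (simp add: A_def l2norm_sq)
  have G3: "integral\<^sup>L ?M (\<lambda>x. norm (g x) ^ 3) = G ^ 3"
  proof -
    have "G ^ 3 = G powr 3" using nonneg by simp
    also have "\<dots> = integral\<^sup>L ?M (\<lambda>x. norm (g x) ^ 3)"
      by (simp add: G_def Lpnorm_def powr_powr)
    finally show ?thesis by simp
  qed
  have H6: "integral\<^sup>L ?M (\<lambda>x. norm (h x) ^ 6) = H ^ 6"
  proof -
    have "H ^ 6 = H powr 6" using nonneg by simp
    also have "\<dots> = integral\<^sup>L ?M (\<lambda>x. norm (h x) ^ 6)"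
      by (simp add: H_def Lpnorm_def powr_powr)
    finally show ?thesis by simp
  qed
  \<comment> \<open>The normalisation divides by all three norms. If one of them is zero, the
    majorant, and with it \<open>F\<close>, vanishes almost everywhere.\<close>
  have "\<bar>integral\<^sup>L ?M F\<bar> \<le> A * G * H"
  proof (cases "A = 0 \<or> G = 0 \<or> H = 0")
    case True
    have "AE x in ?M. norm (a x) * norm (g x) * norm (h x) = 0"
    proof -
      have "AE x in ?M. (norm (a x))\<^sup>2 = 0" if "A = 0"
        using integral_nonneg_eq_0_iff_AE[OF a'] A2 that by simp
      moreover have "AE x in ?M. norm (g x) ^ 3 = 0" if "G = 0"
        using integral_nonneg_eq_0_iff_AE[OF g'] G3 that by simp
      moreover have "AE x in ?M. norm (h x) ^ 6 = 0" if "H = 0"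
        using integral_nonneg_eq_0_iff_AE[OF h'] H6 that by simp
      ultimately show ?thesis using True by auto
    qed
    then have "AE x in ?M. F x = 0"
    proof (rule AE_mp, intro AE_I2 impI)
      fix x assume "norm (a x) * norm (g x) * norm (h x) = 0"
      then show "F x = 0" using le[of x] by (metis abs_le_zero_iff)
    qed
    then have "integral\<^sup>L ?M F = 0" using F by (simp add: integral_eq_zero_AE)
    then show ?thesis using nonneg by simp
  next
    case False
    then have pos: "A > 0" "G > 0" "H > 0" using nonneg by auto
    have "\<bar>integral\<^sup>L ?M (\<lambda>x. F x / (A * G * H))\<bar>
        \<le> integral\<^sup>L ?M (\<lambda>x. (norm (a x))\<^sup>2 / (2 * A\<^sup>2) + norm (g x) ^ 3 / (3 * G ^ 3) + norm (h x) ^ 6 / (6 * H ^ 6))"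
    proof (rule integral_abs_bound[THEN order_trans], rule integral_mono)
      fix x
      have "\<bar>F x / (A * G * H)\<bar> = \<bar>F x\<bar> / (A * G * H)" using pos by simp
      also have "\<dots> \<le> (norm (a x) * norm (g x) * norm (h x)) / (A * G * H)"
        using pos le by (intro divide_right_mono) auto
      also have "\<dots> = (norm (a x) / A) * (norm (g x) / G) * (norm (h x) / H)" by simp
      also have "\<dots> \<le> (norm (a x) / A)\<^sup>2 / 2 + (norm (g x) / G) ^ 3 / 3 + (norm (h x) / H) ^ 6 / 6"
        using pos by (intro Young_2_3_6) auto
      finally show "\<bar>F x / (A * G * H)\<bar>
          \<le> (norm (a x))\<^sup>2 / (2 * A\<^sup>2) + norm (g x) ^ 3 / (3 * G ^ 3) + norm (h x) ^ 6 / (6 * H ^ 6)"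
        by (simp add: power_divide mult.commute)
    qed (use a' g' h' iF in simp_all)
    also have "\<dots> = A\<^sup>2 / (2 * A\<^sup>2) + G ^ 3 / (3 * G ^ 3) + H ^ 6 / (6 * H ^ 6)"
      using a' g' h' by (simp add: A2 G3 H6)
    also have "\<dots> = 1" using pos by simp
    finally show ?thesis using pos by (simp add: field_simps abs_mult)
  qed
  then show "\<bar>integral\<^sup>L ?M F\<bar> \<le> l2norm \<Omega> a * Lpnorm \<Omega> 3 g * Lpnorm \<Omega> 6 h"
    by (simp add: A_def G_def H_def)
qed

section \<open>Test functions and the fundamental lemma of the calculus of variations\<close>

text \<open>Test functions are only required to be continuously differentiable, so the squared
  positive part is an admissible cut-off profile: squaring removes the kink at 0.\<close>

lemma has_real_derivative_max0_sq:
  "((\<lambda>t::real. (max 0 t)\<^sup>2) has_real_derivative 2 * max 0 t) (at t)"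
proof -
  consider "t > 0" | "t < 0" | "t = 0" by linarith
  then show ?thesis
  proof cases
    case 1
    have "((\<lambda>t::real. t\<^sup>2) has_real_derivative 2 * t) (at t)"
      by (auto intro!: derivative_eq_intros)
    then have "((\<lambda>t::real. (max 0 t)\<^sup>2) has_real_derivative 2 * t) (at t)"
      by (rule has_field_derivative_transform_within_open[where S="{0<..}"]) (use 1 in auto)
    then show ?thesis using 1 by simp
  next
    case 2
    have "((\<lambda>t::real. 0) has_real_derivative 0) (at t)" by simp
    then have "((\<lambda>t::real. (max 0 t)\<^sup>2) has_real_derivative 0) (at t)"
      by (rule has_field_derivative_transform_within_open[where S="{..<0}"]) (use 2 in auto)
    then show ?thesis using 2 by simp
  next
    case 3
    have "((\<lambda>y::real. (max 0 y)\<^sup>2 / y) \<longlongrightarrow> 0) (at 0)"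
    proof (rule Lim_null_comparison)
      show "\<forall>\<^sub>F y::real in at 0. norm ((max 0 y)\<^sup>2 / y) \<le> \<bar>y\<bar>"
        by (intro always_eventually allI) (auto simp: max_def power2_eq_square)
      show "((\<lambda>y::real. \<bar>y\<bar>) \<longlongrightarrow> 0) (at 0)"
        by (intro tendsto_eq_intros) auto
    qed
    then show ?thesis using 3 by (simp add: has_field_derivative_iff)
  qed
qed

lemma scalar_testI:
  assumes "\<And>x. (\<psi> has_derivative (\<lambda>h. D\<psi> x \<bullet> h)) (at x)" "continuous_on UNIV D\<psi>"
    and "compact K" "K \<subseteq> \<Omega>" "\<And>x. x \<notin> K \<Longrightarrow> \<psi> x = 0"
  shows "scalar_test \<Omega> \<psi> D\<psi>"
proof -
  have "closure {x. \<psi> x \<noteq> 0} \<subseteq> K"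
    using assms(3,5) by (intro closure_minimal compact_imp_closed) auto
  moreover have "compact (closure {x. \<psi> x \<noteq> 0})"
    using assms(3,5) unfolding compact_closure
    by (intro bounded_subset[OF compact_imp_bounded[OF assms(3)]]) auto
  ultimately show ?thesis
    unfolding scalar_test_def using assms(1,2,4) by simp
qed

lemma scalar_testD:
  assumes "scalar_test \<Omega> \<psi> D\<psi>"
  shows "(\<psi> has_derivative (\<lambda>h. D\<psi> x \<bullet> h)) (at x)" "continuous_on UNIV D\<psi>" "continuous_on UNIV \<psi>"
    and "compact (closure {x. \<psi> x \<noteq> 0})" "closure {x. \<psi> x \<noteq> 0} \<subseteq> \<Omega>"
proof -
  show d: "(\<psi> has_derivative (\<lambda>h. D\<psi> x \<bullet> h)) (at x)" for x
    using assms unfolding scalar_test_def by blast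
  show "continuous_on UNIV \<psi>"
    using d by (intro has_derivative_continuous_on) (rule has_derivative_at_withinI)
qed (use assms in \<open>simp_all add: scalar_test_def\<close>)

lemma vector_testD:
  assumes "vector_test \<Omega> \<phi> D\<phi>"
  shows "(\<phi> has_derivative (\<lambda>h. D\<phi> x *v h)) (at x)" "continuous_on UNIV D\<phi>" "continuous_on UNIV \<phi>"
    and "compact (closure {x. \<phi> x \<noteq> 0})" "closure {x. \<phi> x \<noteq> 0} \<subseteq> \<Omega>"
proof -
  show d: "(\<phi> has_derivative (\<lambda>h. D\<phi> x *v h)) (at x)" for x
    using assms unfolding vector_test_def by blast
  show "continuous_on UNIV \<phi>"
    using d by (intro has_derivative_continuous_on) (rule has_derivative_at_withinI)
qed (use assms in \<open>simp_all add: vector_test_def\<close>)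

lemma has_derivative_outside_support:
  assumes "(\<phi> has_derivative D) (at x)" "x \<notin> closure {x. \<phi> x \<noteq> 0}"
  shows "D = (\<lambda>h. 0)"
proof -
  have "((\<lambda>x. 0) has_derivative (\<lambda>h. 0)) (at x)" by simp
  then have "(\<phi> has_derivative (\<lambda>h. 0)) (at x)"
    by (rule has_derivative_transform_within_open[where s="- closure {x. \<phi> x \<noteq> 0}"])
      (use assms(2) closure_subset[of "{x. \<phi> x \<noteq> 0}"] in auto)
  then show ?thesis using assms(1) has_derivative_unique by blast
qed

lemma scalar_test_deriv_outside:
  assumes "scalar_test \<Omega> \<psi> D\<psi>" "x \<notin> closure {x. \<psi> x \<noteq> 0}"
  shows "D\<psi> x = 0" "\<psi> x = 0"
proof -
  show "D\<psi> x = 0"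
    using fun_cong[OF has_derivative_outside_support[OF scalar_testD(1)[OF assms(1)] assms(2)], of "D\<psi> x"]
    by simp
  show "\<psi> x = 0" using assms(2) closure_subset[of "{x. \<psi> x \<noteq> 0}"] by auto
qed

lemma vector_test_deriv_outside:
  assumes "vector_test \<Omega> \<phi> D\<phi>" "x \<notin> closure {x. \<phi> x \<noteq> 0}"
  shows "D\<phi> x = 0" "\<phi> x = 0"
proof -
  show "D\<phi> x = 0"
    using fun_cong[OF has_derivative_outside_support[OF vector_testD(1)[OF assms(1)] assms(2)]]
    by (simp add: matrix_eq)
  show "\<phi> x = 0" using assms(2) closure_subset[of "{x. \<phi> x \<noteq> 0}"] by auto
qed

lemma bounded_if_compact_support:
  fixes f :: "'a::topological_space \<Rightarrow> 'b::real_normed_vector"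
  assumes "continuous_on UNIV f" "compact K" "\<And>x. x \<notin> K \<Longrightarrow> f x = 0"
  obtains C where "\<And>x. norm (f x) \<le> C" "C \<ge> 0"
proof -
  have "bounded (f ` K)"
    using assms by (intro compact_imp_bounded compact_continuous_image) (auto intro: continuous_on_subset)
  then obtain C where "\<And>x. x \<in> K \<Longrightarrow> norm (f x) \<le> C"
    by (auto simp: bounded_iff)
  then have "norm (f x) \<le> max C 0" for x
    using assms(3)[of x] by (cases "x \<in> K") (simp_all add: le_max_iff_disj)
  then show ?thesis by (rule that) simp
qed

lemma L2fun_continuous:
  fixes f :: "'n::euclidean_space \<Rightarrow> 'b::euclidean_space"
  assumes "\<Omega> \<in> lmeasurable" "continuous_on UNIV f" "\<And>x. norm (f x) \<le> C"
  shows "L2fun \<Omega> f"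
  unfolding L2fun_def
proof
  interpret finite_measure "lebesgue_on \<Omega>" by (rule finite_measure_lebesgue_on) fact
  show m: "f \<in> borel_measurable (lebesgue_on \<Omega>)"
    using assms by (intro continuous_imp_measurable_on_sets_lebesgue) (auto intro: continuous_on_subset)
  show "integrable (lebesgue_on \<Omega>) (\<lambda>x. (norm (f x))\<^sup>2)"
    using assms(3) m by (intro integrable_const_bound[where B="C\<^sup>2"] AE_I2) (auto intro!: power_mono)
qed

lemma L2fun_scalar_test:
  assumes "\<Omega> \<in> lmeasurable" "scalar_test \<Omega> \<psi> D\<psi>"
  shows "L2fun \<Omega> \<psi>" "L2fun \<Omega> D\<psi>"
  using bounded_if_compact_support[OF scalar_testD(3,4)[OF assms(2)] scalar_test_deriv_outside(2)[OF assms(2)]]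
    bounded_if_compact_support[OF scalar_testD(2,4)[OF assms(2)] scalar_test_deriv_outside(1)[OF assms(2)]]
    L2fun_continuous[OF assms(1)] scalar_testD(2,3)[OF assms(2)] by metis+

lemma L2fun_vector_test:
  assumes "\<Omega> \<in> lmeasurable" "vector_test \<Omega> \<phi> D\<phi>"
  shows "L2fun \<Omega> \<phi>" "L2fun \<Omega> D\<phi>"
  using bounded_if_compact_support[OF vector_testD(3,4)[OF assms(2)] vector_test_deriv_outside(2)[OF assms(2)]]
    bounded_if_compact_support[OF vector_testD(2,4)[OF assms(2)] vector_test_deriv_outside(1)[OF assms(2)]]
    L2fun_continuous[OF assms(1)] vector_testD(2,3)[OF assms(2)] by metis+

lemma L2fun_nth:
  fixes u :: "'n::euclidean_space \<Rightarrow> 'b::euclidean_space^'k"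
  assumes "L2fun \<Omega> u"
  shows "L2fun \<Omega> (\<lambda>x. u x $ i)"
proof (rule L2fun_mono(1)[OF assms, where c=1])
  have "(\<lambda>y::'b^'k. y $ i) \<in> borel_measurable borel"
    by (intro borel_measurable_continuous_onI continuous_intros)
  then show "(\<lambda>x. u x $ i) \<in> borel_measurable (lebesgue_on \<Omega>)"
    using L2funD(1)[OF assms] by measurable
qed (simp add: Finite_Cartesian_Product.norm_nth_le)

text \<open>The profile is applied to r^2 - |x - c|^2, which is positive exactly on the open ball.
  The factor -4 is 2 from the square times -2 from the gradient of -|x - c|^2.\<close>

lemma scalar_test_ball_bump:
  fixes c :: "real^'d"
  assumes "cball c r \<subseteq> \<Omega>" "r \<ge> 0"
  shows "scalar_test \<Omega> (\<lambda>x. (max 0 (r\<^sup>2 - (norm (x - c))\<^sup>2))\<^sup>2)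
      (\<lambda>x. (- 4 * max 0 (r\<^sup>2 - (norm (x - c))\<^sup>2)) *\<^sub>R (x - c))"
proof (rule scalar_testI[OF _ _ compact_cball assms(1)])
  fix x :: "real^'d"
  have 1: "((\<lambda>x. r\<^sup>2 - (norm (x - c))\<^sup>2) has_derivative (\<lambda>h. - 2 * ((x - c) \<bullet> h))) (at x)"
    unfolding power2_norm_eq_inner by (auto intro!: derivative_eq_intros simp: inner_commute)
  from has_derivative_compose[OF 1 has_real_derivative_max0_sq[unfolded has_field_derivative_def]]
  show "((\<lambda>x. (max 0 (r\<^sup>2 - (norm (x - c))\<^sup>2))\<^sup>2) has_derivative
      (\<lambda>h. (- 4 * max 0 (r\<^sup>2 - (norm (x - c))\<^sup>2)) *\<^sub>R (x - c) \<bullet> h)) (at x)"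
    by (rule has_derivative_eq_rhs) (auto simp: fun_eq_iff)
next
  show "continuous_on UNIV (\<lambda>x. (- 4 * max 0 (r\<^sup>2 - (norm (x - c))\<^sup>2)) *\<^sub>R (x - c))"
    by (intro continuous_intros)
next
  fix x assume "x \<notin> cball c r"
  then have "r \<le> norm (x - c)" by (simp add: dist_norm norm_minus_commute)
  then have "r\<^sup>2 \<le> (norm (x - c))\<^sup>2" using assms(2) by (rule power_mono)
  then show "(max 0 (r\<^sup>2 - (norm (x - c))\<^sup>2))\<^sup>2 = 0" by simp
qed

text \<open>For nonnegative test functions \<open>B\<^sub>i\<close>, positive exactly on balls exhausting \<open>U\<close>, put
  \<open>S\<^sub>n = \<Sum>i<n. B\<^sub>i\<close>; then \<open>n S\<^sub>n / (1 + n S\<^sub>n)\<close> converges pointwise to the indicator of \<open>U\<close>.\<close>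

lemma indicator_limit_of_tests:
  fixes U :: "(real^'d) set"
  assumes "open U" "U \<subseteq> \<Omega>"
  obtains \<psi> D\<psi> where "\<And>n::nat. scalar_test \<Omega> (\<psi> n) (D\<psi> n)" "\<And>n x. 0 \<le> \<psi> n x" "\<And>n x. \<psi> n x \<le> 1"
    "\<And>x. (\<lambda>n. \<psi> n x) \<longlonglongrightarrow> indicator U x"
proof -
  obtain c :: "nat \<Rightarrow> real^'d" and r :: "nat \<Rightarrow> real"
    where cr: "\<And>i. r i \<ge> 0" "\<And>i. r i > 0 \<Longrightarrow> cball (c i) (r i) \<subseteq> U" "U = (\<Union>i. ball (c i) (r i))"
  proof (cases "U = {}")
    case True
    show ?thesis by (rule that[of "\<lambda>_. 0" "\<lambda>_. 0"]) (use True in auto)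
  next
    case False
    define F where "F = {ball x e | x e. cball x e \<subseteq> U \<and> e > 0}"
    have "\<Union>F = U"
    proof
      show "U \<subseteq> \<Union>F"
      proof
        fix x assume "x \<in> U"
        then obtain e where "e > 0" "cball x e \<subseteq> U"
          using assms(1) open_contains_cball by blast
        then show "x \<in> \<Union>F" unfolding F_def by (auto intro!: exI[of _ "ball x e"])
      qed
      show "\<Union>F \<subseteq> U" unfolding F_def using ball_subset_cball by blast
    qed
    moreover obtain F' where F': "F' \<subseteq> F" "countable F'" "\<Union>F' = \<Union>F"
    proof (rule Lindelof[of F])
      show "open S" if "S \<in> F" for S using that by (auto simp: F_def)
    qed blast
    ultimately have UF: "\<Union>F' = U" by simp
    then have ne: "F' \<noteq> {}" using False by auto
    define G where "G = from_nat_into F'"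
    have G: "range G = F'" unfolding G_def by (rule range_from_nat_into[OF ne F'(2)])
    have "\<forall>i. \<exists>x e. G i = ball x e \<and> cball x e \<subseteq> U \<and> e > 0"
      using G F'(1) unfolding F_def by blast
    then obtain c r where "\<And>i. G i = ball (c i) (r i) \<and> cball (c i) (r i) \<subseteq> U \<and> r i > 0"
      by metis
    then show ?thesis using UF G by (intro that[of r c]) (auto simp: less_imp_le)
  qed
  define B where "B i x = (max 0 ((r i)\<^sup>2 - (norm (x - c i))\<^sup>2))\<^sup>2" for i x
  define DB where "DB i x = (- 4 * max 0 ((r i)\<^sup>2 - (norm (x - c i))\<^sup>2)) *\<^sub>R (x - c i)" for i x
  \<comment> \<open>A closed ball of radius 0 is the point \<open>c i\<close>, which may lie outside
    \<Omega>. Its bump is identically zero, so the empty set is a valid support.\<close>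
  define K where "K i = (if r i > 0 then cball (c i) (r i) else {})" for i
  have B0: "B i x \<ge> 0" for i x by (simp add: B_def)
  have dB: "(B i has_derivative (\<lambda>h. DB i x \<bullet> h)) (at x)" for i x
    using scalar_testD(1)[OF scalar_test_ball_bump[of "c i" "r i" UNIV, OF subset_UNIV cr(1)], of x]
    unfolding B_def DB_def .
  have cB: "continuous_on UNIV (B i)" "continuous_on UNIV (DB i)" for i
    unfolding B_def DB_def by (intro continuous_intros)+
  have K: "compact (K i)" "K i \<subseteq> \<Omega>" for i
    using cr(2)[of i] assms(2) by (auto simp: K_def)
  have BK: "B i x = 0" if "x \<notin> K i" for i x
  proof -
    have "r i \<le> norm (x - c i)"
      using that cr(1)[of i] norm_ge_zero[of "x - c i"]
      by (auto simp: K_def dist_norm norm_minus_commute not_less split: if_splits)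
    then have "(r i)\<^sup>2 \<le> (norm (x - c i))\<^sup>2" using cr(1) by (rule power_mono)
    then show ?thesis by (simp add: B_def)
  qed
  have Bpos: "B i x > 0" if "x \<in> ball (c i) (r i)" for i x
  proof -
    have "(norm (x - c i))\<^sup>2 < (r i)\<^sup>2"
      using that by (intro power_strict_mono) (auto simp: dist_norm norm_minus_commute)
    then show ?thesis by (simp add: B_def)
  qed
  have "K i \<subseteq> U" for i using cr(2)[of i] by (simp add: K_def)
  then have BU: "B i x = 0" if "x \<notin> U" for i x
    using that by (intro BK) blast
  define S where "S n x = (\<Sum>i<n. B i x)" for n x
  define DS where "DS n x = (\<Sum>i<n. DB i x)" for n x
  have S0: "S n x \<ge> 0" for n x unfolding S_def by (intro sum_nonneg B0)
  have pos: "1 + real n * S n x > 0" for n x using S0[of n x] by (simp add: add_pos_nonneg)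
  define \<psi> where "\<psi> n x = real n * S n x / (1 + real n * S n x)" for n x
  define D\<psi> where "D\<psi> n x = (real n / (1 + real n * S n x)\<^sup>2) *\<^sub>R DS n x" for n x
  show ?thesis
  proof (rule that)
    fix n
    show "scalar_test \<Omega> (\<psi> n) (D\<psi> n)"
    proof (rule scalar_testI)
      fix x
      have dS: "(S n has_derivative (\<lambda>h. DS n x \<bullet> h)) (at x)"
        unfolding S_def DS_def inner_sum_left by (intro has_derivative_sum dB)
      have "((\<lambda>t. real n * t / (1 + real n * t)) has_real_derivative real n / (1 + real n * S n x)\<^sup>2) (at (S n x))"
        using pos[of n x]
        by (auto intro!: derivative_eq_intros simp: field_simps power2_eq_square)
      from has_derivative_compose[OF dS this[unfolded has_field_derivative_def]]
      show "(\<psi> n has_derivative (\<lambda>h. D\<psi> n x \<bullet> h)) (at x)"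
        unfolding \<psi>_def D\<psi>_def by simp
    next
      have "1 + real n * S n x \<noteq> 0" for x using pos[of n x] by linarith
      moreover have "continuous_on UNIV (S n)" "continuous_on UNIV (DS n)"
        unfolding S_def DS_def by (intro continuous_on_sum cB)+
      ultimately show "continuous_on UNIV (D\<psi> n)"
        unfolding D\<psi>_def by (intro continuous_intros) auto
      show "compact (\<Union>i<n. K i)" using K by (intro compact_UN) auto
      show "(\<Union>i<n. K i) \<subseteq> \<Omega>" using K by auto
      show "\<psi> n x = 0" if "x \<notin> (\<Union>i<n. K i)" for x
      proof -
        have "S n x = 0" unfolding S_def using that BK by (intro sum.neutral) auto
        then show ?thesis by (simp add: \<psi>_def)
      qed
    qed
  next
    fix n x
    show "0 \<le> \<psi> n x" unfolding \<psi>_def using S0[of n x] by simp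
    show "\<psi> n x \<le> 1" unfolding \<psi>_def using pos[of n x] by simp
  next
    fix x
    show "(\<lambda>n. \<psi> n x) \<longlonglongrightarrow> indicator U x"
    proof (cases "x \<in> U")
      case False
      then have "S n x = 0" for n unfolding S_def by (simp add: BU)
      then show ?thesis using False by (simp add: \<psi>_def)
    next
      case True
      then obtain i where i: "x \<in> ball (c i) (r i)" using cr(3) by auto
      define b where "b = B i x"
      have b: "b > 0" unfolding b_def by (rule Bpos[OF i])
      \<comment> \<open>From n = i + 1 on, the sum contains the bump that is positive at x; this
        keeps \<open>S n x\<close> away from 0, and the factor n does the rest.\<close>
      have bS: "b \<le> S n x" if "n > i" for n
        unfolding S_def b_def using that by (intro member_le_sum B0) auto
      have "(\<lambda>n. 1 - \<psi> n x) \<longlonglongrightarrow> 0"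
      proof (rule Lim_null_comparison)
        show "(\<lambda>n. 1 / (real n * b)) \<longlonglongrightarrow> 0"
          using tendsto_mult_left_zero[OF lim_1_over_n[where 'a=real], of "1 / b"] by simp
        show "\<forall>\<^sub>F n in sequentially. norm (1 - \<psi> n x) \<le> 1 / (real n * b)"
        proof (rule eventually_sequentiallyI[of "Suc i"])
          fix n assume n: "Suc i \<le> n"
          have "norm (1 - \<psi> n x) = 1 / (1 + real n * S n x)"
            using pos[of n x] by (simp add: \<psi>_def field_simps)
          also have "\<dots> \<le> 1 / (real n * b)"
          proof (rule divide_left_mono)
            have "real n * b \<le> real n * S n x" using bS n by (intro mult_left_mono) auto
            then show "real n * b \<le> 1 + real n * S n x" by simp
            show "0 < (1 + real n * S n x) * (real n * b)" using pos[of n x] b n by simp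
          qed simp
          finally show "norm (1 - \<psi> n x) \<le> 1 / (real n * b)" .
        qed
      qed
      then have "(\<lambda>n. 1 - (1 - \<psi> n x)) \<longlonglongrightarrow> 1 - 0" by (intro tendsto_intros)
      then show ?thesis using True by simp
    qed
  qed
qed

text \<open>Dominated convergence along tests with values in [0, 1], with |g| as majorant.\<close>

lemma integral_open_eq_0_if_tests:
  fixes g :: "real^'d \<Rightarrow> real"
  assumes g: "integrable (lebesgue_on \<Omega>) g"
    and 0: "\<And>\<psi> D\<psi>. scalar_test \<Omega> \<psi> D\<psi> \<Longrightarrow> integral\<^sup>L (lebesgue_on \<Omega>) (\<lambda>x. g x * \<psi> x) = 0"
    and \<Omega>: "\<Omega> \<in> sets lebesgue" and U: "open U" "U \<subseteq> \<Omega>"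
  shows "integral\<^sup>L (lebesgue_on \<Omega>) (\<lambda>x. g x * indicator U x) = 0"
proof -
  obtain \<psi> D\<psi> where t: "\<And>n::nat. scalar_test \<Omega> (\<psi> n) (D\<psi> n)" and b: "\<And>n x. 0 \<le> \<psi> n x" "\<And>n x. \<psi> n x \<le> 1"
    and l: "\<And>x. (\<lambda>n. \<psi> n x) \<longlonglongrightarrow> indicator U x"
    using indicator_limit_of_tests[OF U] by metis
  have "(\<lambda>n. integral\<^sup>L (lebesgue_on \<Omega>) (\<lambda>x. g x * \<psi> n x))
      \<longlonglongrightarrow> integral\<^sup>L (lebesgue_on \<Omega>) (\<lambda>x. g x * indicator U x)"
  proof (rule integral_dominated_convergence)
    have m: "\<psi> n \<in> borel_measurable (lebesgue_on \<Omega>)" for n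
      using scalar_testD(3)[OF t] \<Omega>
      by (intro continuous_imp_measurable_on_sets_lebesgue) (auto intro: continuous_on_subset)
    show "(\<lambda>x. g x * \<psi> n x) \<in> borel_measurable (lebesgue_on \<Omega>)" for n
      using m g by measurable
    have "(indicator U :: _ \<Rightarrow> real) \<in> borel_measurable (lebesgue_on \<Omega>)"
      by (rule borel_measurable_LIMSEQ_real[OF l m])
    then show "(\<lambda>x. g x * indicator U x) \<in> borel_measurable (lebesgue_on \<Omega>)"
      using g by measurable
    show "integrable (lebesgue_on \<Omega>) (\<lambda>x. \<bar>g x\<bar>)" using g by simp
    show "AE x in lebesgue_on \<Omega>. (\<lambda>n. g x * \<psi> n x) \<longlonglongrightarrow> g x * indicator U x"
      by (intro AE_I2 tendsto_intros l)
    show "AE x in lebesgue_on \<Omega>. norm (g x * \<psi> n x) \<le> \<bar>g x\<bar>" for n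
      using b by (intro AE_I2) (auto simp: abs_mult intro!: mult_left_le)
  qed
  then have "(\<lambda>n::nat. 0) \<longlonglongrightarrow> integral\<^sup>L (lebesgue_on \<Omega>) (\<lambda>x. g x * indicator U x)"
    using 0[OF t] by simp
  then show ?thesis by (simp add: LIMSEQ_const_iff)
qed

text \<open>The set where g is positive is merely measurable, so tests do not reach it directly. A
  G-delta hull exceeds it by a null set and is, within \<Omega>, a decreasing limit of open sets
  over which the integral of g vanishes. Hence the integral over {g > 0} is zero, although g is
  positive there.\<close>

lemma AE_nonpos_if_tests:
  fixes g :: "real^'d \<Rightarrow> real"
  assumes g: "integrable (lebesgue_on \<Omega>) g"
    and 0: "\<And>\<psi> D\<psi>. scalar_test \<Omega> \<psi> D\<psi> \<Longrightarrow> integral\<^sup>L (lebesgue_on \<Omega>) (\<lambda>x. g x * \<psi> x) = 0"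
    and \<Omega>: "open \<Omega>"
  shows "AE x in lebesgue_on \<Omega>. g x \<le> 0"
proof -
  have \<Omega>s: "\<Omega> \<in> sets lebesgue" using \<Omega> by simp
  define A where "A = {x\<in>\<Omega>. g x > 0}"
  have "A \<in> sets (lebesgue_on \<Omega>)"
    using borel_measurable_less[OF borel_measurable_const borel_measurable_integrable[OF g], of 0]
    by (simp add: A_def)
  then have As: "A \<in> sets lebesgue" using \<Omega>s by (simp add: sets_restrict_space_iff)
  obtain C T where C: "gdelta C" "T \<in> null_sets lebesgue" "A \<union> T = C" "disjnt A T"
    using lebesgue_set_almost_gdelta[OF As] .
  from C(1) obtain F where F: "\<And>n::nat. open (F n)" "C = (\<Inter>(F ` UNIV))"
    by (auto elim: gdelta.cases)
  define G where "G n = \<Omega> \<inter> (\<Inter>i\<le>n. F i)" for n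
  have G: "open (G n)" "G n \<subseteq> \<Omega>" for n
    using \<Omega> F(1) by (auto simp: G_def)
  have lim: "(\<lambda>n. indicator (G n) x :: real) \<longlonglongrightarrow> indicator (C \<inter> \<Omega>) x" for x
  proof (cases "x \<in> C \<inter> \<Omega>")
    case True
    then have "x \<in> G n" for n by (auto simp: G_def F)
    then show ?thesis using True by simp
  next
    case False
    then obtain k where "\<And>n. n \<ge> k \<Longrightarrow> x \<notin> G n" by (auto simp: G_def F)
    then have "\<forall>\<^sub>F n in sequentially. indicator (G n) x = (0::real)"
      by (intro eventually_sequentiallyI[of k]) auto
    then show ?thesis using False by (simp add: tendsto_eventually)
  qed
  have "(\<lambda>n. integral\<^sup>L (lebesgue_on \<Omega>) (\<lambda>x. g x * indicator (G n) x))
      \<longlonglongrightarrow> integral\<^sup>L (lebesgue_on \<Omega>) (\<lambda>x. g x * indicator A x)"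
  proof (rule integral_dominated_convergence)
    have "G n \<inter> space (lebesgue_on \<Omega>) \<in> sets (lebesgue_on \<Omega>)" for n
      using G[of n] \<Omega>s by (auto simp: sets_restrict_space_iff)
    then show "(\<lambda>x. g x * indicator (G n) x) \<in> borel_measurable (lebesgue_on \<Omega>)" for n
      using g by (intro borel_measurable_times borel_measurable_indicator_iff[THEN iffD2]) auto
    show "(\<lambda>x. g x * indicator A x) \<in> borel_measurable (lebesgue_on \<Omega>)"
      using g \<open>A \<in> sets (lebesgue_on \<Omega>)\<close> by measurable
    show "integrable (lebesgue_on \<Omega>) (\<lambda>x. \<bar>g x\<bar>)" using g by simp
    have "AE x in lebesgue. x \<notin> T" using C(2) by (rule AE_not_in)
    then have T: "AE x in lebesgue_on \<Omega>. x \<notin> T"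
      using \<Omega>s by (subst AE_restrict_space_iff) auto
    show "AE x in lebesgue_on \<Omega>. (\<lambda>n. g x * indicator (G n) x) \<longlonglongrightarrow> g x * indicator A x"
      using T AE_space
    proof eventually_elim
      case (elim x)
      then have "indicator A x = (indicator (C \<inter> \<Omega>) x :: real)"
        using C(3) by (auto simp: indicator_def)
      then show ?case by (auto intro!: tendsto_intros lim)
    qed
    show "AE x in lebesgue_on \<Omega>. norm (g x * indicator (G n) x) \<le> \<bar>g x\<bar>" for n
      by (intro AE_I2) (auto simp: indicator_def)
  qed
  then have "(\<lambda>n::nat. 0) \<longlonglongrightarrow> integral\<^sup>L (lebesgue_on \<Omega>) (\<lambda>x. g x * indicator A x)"
    using integral_open_eq_0_if_tests[OF g 0 \<Omega>s G] by simp
  then have "integral\<^sup>L (lebesgue_on \<Omega>) (\<lambda>x. g x * indicator A x) = 0"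
    by (simp add: LIMSEQ_const_iff)
  moreover have "integrable (lebesgue_on \<Omega>) (\<lambda>x. g x * indicator A x)"
    using g \<open>A \<in> sets (lebesgue_on \<Omega>)\<close> by (rule integrable_real_mult_indicator[rotated])
  moreover have "AE x in lebesgue_on \<Omega>. 0 \<le> g x * indicator A x"
    by (intro AE_I2) (auto simp: A_def indicator_def)
  ultimately have "AE x in lebesgue_on \<Omega>. g x * indicator A x = 0"
    by (simp add: integral_nonneg_eq_0_iff_AE)
  then show ?thesis
    using AE_space by eventually_elim (auto simp: A_def indicator_def split: if_splits)
qed

lemma AE_eq_0_if_tests:
  fixes g :: "real^'d \<Rightarrow> real"
  assumes g: "integrable (lebesgue_on \<Omega>) g"
    and 0: "\<And>\<psi> D\<psi>. scalar_test \<Omega> \<psi> D\<psi> \<Longrightarrow> integral\<^sup>L (lebesgue_on \<Omega>) (\<lambda>x. g x * \<psi> x) = 0"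
    and \<Omega>: "open \<Omega>"
  shows "AE x in lebesgue_on \<Omega>. g x = 0"
proof -
  have "AE x in lebesgue_on \<Omega>. g x \<le> 0" by (rule AE_nonpos_if_tests[OF g 0 \<Omega>])
  moreover have "AE x in lebesgue_on \<Omega>. - g x \<le> 0"
    by (rule AE_nonpos_if_tests[OF _ _ \<Omega>]) (use g 0 in auto)
  ultimately show ?thesis by eventually_elim auto
qed

section \<open>Weak gradients\<close>

lemma weak_gradD:
  assumes "weak_grad \<Omega> u G" "scalar_test \<Omega> \<psi> D\<psi>"
  shows "integral\<^sup>L (lebesgue_on \<Omega>) (\<lambda>x. u x $ i * D\<psi> x $ j)
    = - integral\<^sup>L (lebesgue_on \<Omega>) (\<lambda>x. G x $ i $ j * \<psi> x)"
  using assms unfolding weak_grad_def by blast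

lemma integrable_component_mult:
  fixes u :: "'n::euclidean_space \<Rightarrow> real^'k" and v :: "'n \<Rightarrow> real^'l"
  assumes "L2fun \<Omega> u" "L2fun \<Omega> v"
  shows "integrable (lebesgue_on \<Omega>) (\<lambda>x. u x $ i * v x $ j)"
  using integrable_inner_L2[OF L2fun_nth[OF assms(1)] L2fun_nth[OF assms(2)]] by simp

lemma integrable_entry_mult:
  fixes G :: "'n::euclidean_space \<Rightarrow> real^'k^'l" and \<psi> :: "'n \<Rightarrow> real"
  assumes "L2fun \<Omega> G" "L2fun \<Omega> \<psi>"
  shows "integrable (lebesgue_on \<Omega>) (\<lambda>x. G x $ i $ j * \<psi> x)"
  using integrable_inner_L2[OF L2fun_nth[OF L2fun_nth[OF assms(1)]] assms(2)] by simp

text \<open>Entry by entry, the difference of two weak gradients is orthogonal to all tests. The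
  entries are integrable because a bounded domain has finite measure: they are multiplied by the
  square-integrable constant 1.\<close>

lemma weak_grad_unique:
  assumes \<Omega>: "open \<Omega>" "bounded \<Omega>"
    and G: "L2fun \<Omega> G" "weak_grad \<Omega> u G" and G': "L2fun \<Omega> G'" "weak_grad \<Omega> u G'"
  shows "AE x in lebesgue_on \<Omega>. G x = G' x"
proof -
  have fin: "\<Omega> \<in> lmeasurable" using \<Omega> by (simp add: lmeasurable_open)
  have one: "L2fun \<Omega> (\<lambda>x::real^'a. 1::real)"
    by (rule L2fun_continuous[OF fin, where C=1]) auto
  have "AE x in lebesgue_on \<Omega>. G x $ i $ j - G' x $ i $ j = 0" for i j
  proof (rule AE_eq_0_if_tests[OF _ _ \<Omega>(1)])
    show "integrable (lebesgue_on \<Omega>) (\<lambda>x. G x $ i $ j - G' x $ i $ j)"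
      using integrable_entry_mult[OF G(1) one, of i j] integrable_entry_mult[OF G'(1) one, of i j] by simp
    fix \<psi> D\<psi> assume t: "scalar_test \<Omega> \<psi> D\<psi>"
    note L = L2fun_scalar_test(1)[OF fin t]
    show "integral\<^sup>L (lebesgue_on \<Omega>) (\<lambda>x. (G x $ i $ j - G' x $ i $ j) * \<psi> x) = 0"
      using weak_gradD[OF G(2) t, of i j] weak_gradD[OF G'(2) t, of i j]
        integrable_entry_mult[OF G(1) L, of i j] integrable_entry_mult[OF G'(1) L, of i j]
      by (simp add: left_diff_distrib)
  qed
  then have "AE x in lebesgue_on \<Omega>. \<forall>p\<in>(UNIV :: ('a \<times> 'a) set). G x $ fst p $ snd p = G' x $ fst p $ snd p"
    by (intro AE_finite_allI) auto
  then show ?thesis by eventually_elim (auto simp: vec_eq_iff)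
qed

lemma weak_grad_lin:
  assumes fin: "\<Omega> \<in> lmeasurable"
    and u: "L2fun \<Omega> u" "L2fun \<Omega> G" "weak_grad \<Omega> u G"
    and v: "L2fun \<Omega> v" "L2fun \<Omega> H" "weak_grad \<Omega> v H"
  shows "weak_grad \<Omega> (\<lambda>x. a *\<^sub>R u x + b *\<^sub>R v x) (\<lambda>x. a *\<^sub>R G x + b *\<^sub>R H x)"
  unfolding weak_grad_def
proof (intro allI impI)
  fix \<psi> D\<psi> i j assume t: "scalar_test \<Omega> \<psi> D\<psi>"
  note L = L2fun_scalar_test[OF fin t]
  note I = integrable_component_mult[OF u(1) L(2), of i j] integrable_component_mult[OF v(1) L(2), of i j]
    integrable_entry_mult[OF u(2) L(1), of i j] integrable_entry_mult[OF v(2) L(1), of i j]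
  have "integral\<^sup>L (lebesgue_on \<Omega>) (\<lambda>x. (a *\<^sub>R u x + b *\<^sub>R v x) $ i * D\<psi> x $ j)
      = integral\<^sup>L (lebesgue_on \<Omega>) (\<lambda>x. a * (u x $ i * D\<psi> x $ j) + b * (v x $ i * D\<psi> x $ j))"
    by (simp add: algebra_simps)
  also have "\<dots> = a * - integral\<^sup>L (lebesgue_on \<Omega>) (\<lambda>x. G x $ i $ j * \<psi> x)
      + b * - integral\<^sup>L (lebesgue_on \<Omega>) (\<lambda>x. H x $ i $ j * \<psi> x)"
    using I by (simp add: weak_gradD[OF u(3) t] weak_gradD[OF v(3) t])
  also have "\<dots> = - integral\<^sup>L (lebesgue_on \<Omega>) (\<lambda>x. a * (G x $ i $ j * \<psi> x) + b * (H x $ i $ j * \<psi> x))"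
    using I by simp
  also have "\<dots> = - integral\<^sup>L (lebesgue_on \<Omega>) (\<lambda>x. (a *\<^sub>R G x + b *\<^sub>R H x) $ i $ j * \<psi> x)"
    by (simp add: algebra_simps)
  finally show "integral\<^sup>L (lebesgue_on \<Omega>) (\<lambda>x. (a *\<^sub>R u x + b *\<^sub>R v x) $ i * D\<psi> x $ j)
      = - integral\<^sup>L (lebesgue_on \<Omega>) (\<lambda>x. (a *\<^sub>R G x + b *\<^sub>R H x) $ i $ j * \<psi> x)" .
qed

section \<open>Integrals of derivatives of test functions and integration by parts\<close>

lemma integral_lborel_shift:
  fixes f :: "'a::euclidean_space \<Rightarrow> real"
  assumes "f \<in> borel_measurable borel"
  shows "integral\<^sup>L lborel (\<lambda>x. f (x + c)) = integral\<^sup>L lborel f"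
proof -
  have "integral\<^sup>L lborel f = integral\<^sup>L (distr lborel borel ((+) c)) f"
    by (simp add: lborel_distr_plus)
  also have "\<dots> = integral\<^sup>L lborel (\<lambda>x. f (c + x))"
    using assms by (intro integral_distr) auto
  finally show ?thesis by (simp add: add.commute)
qed

text \<open>By translation invariance all difference quotients of a test function integrate to zero.\<close>

lemma integral_deriv_scalar_test:
  fixes \<psi> :: "real^'d \<Rightarrow> real"
  assumes t: "scalar_test \<Omega> \<psi> D\<psi>" and \<Omega>: "\<Omega> \<in> sets lebesgue"
  shows "integral\<^sup>L (lebesgue_on \<Omega>) (\<lambda>x. D\<psi> x $ j) = 0"
proof -
  define e :: "real^'d" where "e = axis j 1"
  have ne: "norm e = 1" by (simp add: e_def)
  note d = scalar_testD[OF t] and out = scalar_test_deriv_outside[OF t]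
  have bm: "\<psi> \<in> borel_measurable borel" "D\<psi> \<in> borel_measurable borel"
    using d(2,3) by (auto intro: borel_measurable_continuous_onI)
  obtain C where C: "\<And>x. norm (D\<psi> x) \<le> C" "C \<ge> 0"
    using bounded_if_compact_support[OF d(2,4) out(1)] by auto
  obtain B where B: "\<And>x. norm (\<psi> x) \<le> B" "B \<ge> 0"
    using bounded_if_compact_support[OF d(3,4) out(2)] by auto
  obtain R where R: "closure {x. \<psi> x \<noteq> 0} \<subseteq> cball 0 R" "R \<ge> 0"
    using bounded_subset_ballD[OF compact_imp_bounded[OF d(4)], of 0] ball_subset_cball[of 0]
    by (meson less_imp_le order_trans)
  have out': "D\<psi> x = 0" "\<psi> x = 0" if "norm x > R" for x
    using that R by (auto intro!: out)
  have int\<psi>: "integrable lborel \<psi>"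
  proof (rule Bochner_Integration.integrable_bound)
    show "integrable lborel (\<lambda>x::real^'d. B * indicator (cball 0 R) x)"
      using emeasure_lborel_cball_finite[of "0::real^'d" R]
      by (intro integrable_mult_right integrable_real_indicator) simp_all
    show "AE x in lborel. norm (\<psi> x) \<le> norm (B * indicator (cball 0 R) x)"
      using B out'(2) by (intro AE_I2) (auto simp: indicator_def not_le)
  qed (use bm in simp)
  \<comment> \<open>Step sizes at most 1 keep all shifted supports inside the ball of radius
    \<open>R + 1\<close>, which yields one integrable majorant for all quotients.\<close>
  define h where "h n = inverse (real (Suc n))" for n
  have h: "h n > 0" "h n \<le> 1" for n by (auto simp: h_def field_simps)
  have h0: "h \<longlonglongrightarrow> 0" unfolding h_def by (rule LIMSEQ_inverse_real_of_nat)
  have quot: "(\<lambda>n. (\<psi> (x + h n *\<^sub>R e) - \<psi> x) / h n) \<longlonglongrightarrow> D\<psi> x \<bullet> e" for x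
  proof -
    have "((\<lambda>s. \<psi> (x + s *\<^sub>R e)) has_real_derivative D\<psi> x \<bullet> e) (at 0)"
    proof -
      have 1: "((\<lambda>s. x + s *\<^sub>R e) has_derivative (\<lambda>s. s *\<^sub>R e)) (at 0)"
        by (auto intro!: derivative_eq_intros)
      have "((\<lambda>s. \<psi> (x + s *\<^sub>R e)) has_derivative (\<lambda>s. D\<psi> x \<bullet> (s *\<^sub>R e))) (at 0)"
        using has_derivative_compose[OF 1, of \<psi> "\<lambda>h. D\<psi> x \<bullet> h"] d(1)[of x] by simp
      then show ?thesis
        unfolding has_field_derivative_def by (simp add: mult.commute[of _ "D\<psi> x \<bullet> e"] mult_commute_abs)
    qed
    then have "((\<lambda>s. (\<psi> (x + s *\<^sub>R e) - \<psi> x) / s) \<longlongrightarrow> D\<psi> x \<bullet> e) (at 0)"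
      by (simp add: has_field_derivative_iff)
    moreover have "filterlim h (at 0) sequentially"
      using h0 h(1) by (auto simp: filterlim_at intro!: always_eventually less_imp_neq[symmetric])
    ultimately show ?thesis by (rule filterlim_compose)
  qed
  have "(\<lambda>n. integral\<^sup>L lborel (\<lambda>x. (\<psi> (x + h n *\<^sub>R e) - \<psi> x) / h n)) \<longlonglongrightarrow> integral\<^sup>L lborel (\<lambda>x. D\<psi> x \<bullet> e)"
  proof (rule integral_dominated_convergence)
    show "(\<lambda>x. D\<psi> x \<bullet> e) \<in> borel_measurable lborel" using bm by measurable
    show "(\<lambda>x. (\<psi> (x + h n *\<^sub>R e) - \<psi> x) / h n) \<in> borel_measurable lborel" for n
      using bm by measurable
    show "integrable lborel (\<lambda>x::real^'d. C * indicator (cball 0 (R + 1)) x)"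
      using emeasure_lborel_cball_finite[of "0::real^'d" "R + 1"]
      by (intro integrable_mult_right integrable_real_indicator) simp_all
    show "AE x in lborel. (\<lambda>n. (\<psi> (x + h n *\<^sub>R e) - \<psi> x) / h n) \<longlonglongrightarrow> D\<psi> x \<bullet> e"
      using quot by simp
    have "norm ((\<psi> (x + h n *\<^sub>R e) - \<psi> x) / h n) \<le> C * indicator (cball 0 (R + 1)) x" for x n
    proof (cases "norm x \<le> R + 1")
      case True
      have "norm (\<psi> (x + h n *\<^sub>R e) - \<psi> x) \<le> C * norm (x + h n *\<^sub>R e - x)"
      proof (rule differentiable_bound[OF convex_UNIV])
        show "onorm ((\<bullet>) (D\<psi> y)) \<le> C" for y
          using C(1)[of y] by (intro onorm_le order_trans[OF Cauchy_Schwarz_ineq2[of "D\<psi> y", folded real_norm_def]])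
            (auto intro!: mult_right_mono)
      qed (use d(1) in auto)
      also have "\<dots> = C * h n" using h(1)[of n] ne by simp
      finally show ?thesis using True h(1)[of n] by (simp add: field_simps)
    next
      case False
      have "norm x - norm (h n *\<^sub>R e) \<le> norm (x + h n *\<^sub>R e)" by (metis norm_diff_ineq)
      then have "norm (x + h n *\<^sub>R e) > R" using False h[of n] ne by simp
      then show ?thesis using False out'(2) by simp
    qed
    then show "AE x in lborel. norm ((\<psi> (x + h n *\<^sub>R e) - \<psi> x) / h n) \<le> C * indicator (cball 0 (R + 1)) x" for n
      by simp
  qed
  moreover have "integral\<^sup>L lborel (\<lambda>x. (\<psi> (x + h n *\<^sub>R e) - \<psi> x) / h n) = 0" for n
  proof -
    have "integrable lborel (\<lambda>x. \<psi> (x + h n *\<^sub>R e))"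
    proof -
      have "integrable (distr lborel borel ((+) (h n *\<^sub>R e))) \<psi>" using int\<psi> by (simp add: lborel_distr_plus)
      then show ?thesis using bm by (subst (asm) integrable_distr_eq) (auto simp: add.commute)
    qed
    then show ?thesis using int\<psi> integral_lborel_shift[OF bm(1), of "h n *\<^sub>R e"] by simp
  qed
  ultimately have "(\<lambda>n::nat. 0) \<longlonglongrightarrow> integral\<^sup>L lborel (\<lambda>x. D\<psi> x \<bullet> e)"
    by (simp only:)
  then have "integral\<^sup>L lborel (\<lambda>x. D\<psi> x \<bullet> e) = 0"
    by (simp add: LIMSEQ_const_iff)
  moreover have "(\<lambda>x. D\<psi> x \<bullet> e) = (\<lambda>x. D\<psi> x $ j)"
    by (simp add: e_def inner_axis)
  ultimately have "integral\<^sup>L lborel (\<lambda>x. D\<psi> x $ j) = 0" by simp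
  moreover have "(\<lambda>x. D\<psi> x $ j) \<in> borel_measurable borel"
    by (intro borel_measurable_continuous_onI continuous_on_component d(2))
  ultimately have "integral\<^sup>L lebesgue (\<lambda>x. D\<psi> x $ j) = 0"
    by (simp add: integral_completion)
  moreover have "(\<lambda>x. if x \<in> \<Omega> then D\<psi> x $ j else 0) = (\<lambda>x. D\<psi> x $ j)"
  proof
    fix x
    have "D\<psi> x = 0" if "x \<notin> \<Omega>" using that d(5) by (intro out(1)) blast
    then show "(if x \<in> \<Omega> then D\<psi> x $ j else 0) = D\<psi> x $ j" by auto
  qed
  ultimately show ?thesis using Lebesgue_Measure.integral_restrict_UNIV[OF \<Omega>, of "\<lambda>x. D\<psi> x $ j"] by simp
qed

lemma scalar_test_component_mult:
  assumes "vector_test \<Omega> \<phi> D\<phi>" "scalar_test \<Omega> \<psi> D\<psi>"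
  shows "scalar_test \<Omega> (\<lambda>x. \<phi> x $ i * \<psi> x) (\<lambda>x. \<phi> x $ i *\<^sub>R D\<psi> x + \<psi> x *\<^sub>R D\<phi> x $ i)"
proof (rule scalar_testI[OF _ _ scalar_testD(4,5)[OF assms(2)]])
  note d1 = vector_testD[OF assms(1)] and d2 = scalar_testD[OF assms(2)]
  fix x
  have "((\<lambda>x. \<phi> x $ i) has_derivative (\<lambda>h. (D\<phi> x *v h) $ i)) (at x)"
    using d1(1) by (intro bounded_linear.has_derivative[OF bounded_linear_vec_nth])
  then have "((\<lambda>x. \<phi> x $ i * \<psi> x) has_derivative (\<lambda>h. \<phi> x $ i * (D\<psi> x \<bullet> h) + (D\<phi> x *v h) $ i * \<psi> x)) (at x)"
    by (rule has_derivative_mult) (rule d2(1))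
  then show "((\<lambda>x. \<phi> x $ i * \<psi> x) has_derivative (\<lambda>h. (\<phi> x $ i *\<^sub>R D\<psi> x + \<psi> x *\<^sub>R D\<phi> x $ i) \<bullet> h)) (at x)"
    by (rule has_derivative_eq_rhs) (simp add: fun_eq_iff inner_add_left matrix_vector_mul_component)
  show "continuous_on UNIV (\<lambda>x. \<phi> x $ i *\<^sub>R D\<psi> x + \<psi> x *\<^sub>R D\<phi> x $ i)"
    using d1(2,3) d2(2,3) by (intro continuous_intros)
  show "\<phi> x $ i * \<psi> x = 0" if "x \<notin> closure {x. \<psi> x \<noteq> 0}" for x
    using scalar_test_deriv_outside(2)[OF assms(2) that] by simp
qed

text \<open>\<open>\<psi> x v* D\<phi> x\<close> is the transposed Jacobian applied to
  \<open>\<psi> x\<close>, as the gradient of an inner product requires. This is the function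
  against which the weak gradient of the advecting field is tested.\<close>

lemma scalar_test_inner:
  assumes "vector_test \<Omega> \<phi> D\<phi>" "vector_test \<Omega> \<psi> D\<psi>"
  shows "scalar_test \<Omega> (\<lambda>x. \<phi> x \<bullet> \<psi> x) (\<lambda>x. \<psi> x v* D\<phi> x + \<phi> x v* D\<psi> x)"
proof (rule scalar_testI[OF _ _ vector_testD(4,5)[OF assms(2)]])
  note d1 = vector_testD[OF assms(1)] and d2 = vector_testD[OF assms(2)]
  fix x
  have "((\<lambda>x. \<phi> x \<bullet> \<psi> x) has_derivative (\<lambda>h. \<phi> x \<bullet> (D\<psi> x *v h) + (D\<phi> x *v h) \<bullet> \<psi> x)) (at x)"
    by (rule has_derivative_inner[OF d1(1) d2(1)])
  then show "((\<lambda>x. \<phi> x \<bullet> \<psi> x) has_derivative (\<lambda>h. (\<psi> x v* D\<phi> x + \<phi> x v* D\<psi> x) \<bullet> h)) (at x)"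
    by (rule has_derivative_eq_rhs)
      (simp add: fun_eq_iff inner_add_left dot_lmul_matrix inner_commute[of "_ *v _"])
  have "continuous_on UNIV (\<lambda>x. f x v* A x)" if f: "continuous_on UNIV f" and A: "continuous_on UNIV A"
    for f :: "real^'a \<Rightarrow> real^'a" and A :: "real^'a \<Rightarrow> real^'a^'a"
    unfolding vector_matrix_mult_def
    by (intro continuous_on_vec_lambda continuous_on_sum continuous_on_mult continuous_on_component f A)
  then show "continuous_on UNIV (\<lambda>x. \<psi> x v* D\<phi> x + \<phi> x v* D\<psi> x)"
    using d1(2,3) d2(2,3) by (intro continuous_on_add)
  show "\<phi> x \<bullet> \<psi> x = 0" if "x \<notin> closure {x. \<psi> x \<noteq> 0}" for x
    using vector_test_deriv_outside(2)[OF assms(2) that] by simp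
qed

text \<open>The product of a component of \<phi> with \<psi> is itself a test function, so its
  partial derivative integrates to zero; the product rule splits that integral into the two
  sides.\<close>

lemma weak_grad_vector_test:
  assumes fin: "\<Omega> \<in> lmeasurable" and t: "vector_test \<Omega> \<phi> D\<phi>"
  shows "weak_grad \<Omega> \<phi> D\<phi>"
  unfolding weak_grad_def
proof (intro allI impI)
  fix \<psi> D\<psi> i j assume s: "scalar_test \<Omega> \<psi> D\<psi>"
  note L = L2fun_scalar_test[OF fin s] L2fun_vector_test[OF fin t]
  have "integral\<^sup>L (lebesgue_on \<Omega>) (\<lambda>x. \<phi> x $ i * D\<psi> x $ j + D\<phi> x $ i $ j * \<psi> x) = 0"
    using integral_deriv_scalar_test[OF scalar_test_component_mult[OF t s, of i], of j] fin
    by (simp add: fmeasurableD mult.commute)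
  then show "integral\<^sup>L (lebesgue_on \<Omega>) (\<lambda>x. \<phi> x $ i * D\<psi> x $ j)
      = - integral\<^sup>L (lebesgue_on \<Omega>) (\<lambda>x. D\<phi> x $ i $ j * \<psi> x)"
    using integrable_component_mult[OF L(3,2), of i j] integrable_entry_mult[OF L(4,1), of i j] by simp
qed

section \<open>The space \<open>H\<^sup>1\<^sub>0\<close>\<close>

text \<open>Membership in \<open>H10\<close> supplies approximations of some weak gradient
  \<open>G\<close>, whereas \<open>grad\<close> is an arbitrary choice of one. Uniqueness almost
  everywhere carries the approximation over to \<open>grad\<close>.\<close>

lemma H10_grad:
  assumes \<Omega>: "open \<Omega>" "bounded \<Omega>" and u: "H10 \<Omega> u"
  obtains \<phi> D\<phi> where "\<And>n. vector_test \<Omega> (\<phi> n) (D\<phi> n)"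
    "(\<lambda>n. l2norm \<Omega> (\<lambda>x. u x - \<phi> n x)) \<longlonglongrightarrow> 0" "(\<lambda>n. l2norm \<Omega> (\<lambda>x. grad \<Omega> u x - D\<phi> n x)) \<longlonglongrightarrow> 0"
    "L2fun \<Omega> u" "L2fun \<Omega> (grad \<Omega> u)" "weak_grad \<Omega> u (grad \<Omega> u)"
proof -
  have fin: "\<Omega> \<in> lmeasurable" using \<Omega> by (simp add: lmeasurable_open)
  obtain G \<phi> D\<phi> where L: "L2fun \<Omega> u" and G: "L2fun \<Omega> G" "weak_grad \<Omega> u G"
    and \<phi>: "\<And>n. vector_test \<Omega> (\<phi> n) (D\<phi> n)"
      "(\<lambda>n. l2norm \<Omega> (\<lambda>x. u x - \<phi> n x)) \<longlonglongrightarrow> 0" "(\<lambda>n. l2norm \<Omega> (\<lambda>x. G x - D\<phi> n x)) \<longlonglongrightarrow> 0"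
    using u unfolding H10_def by blast
  have g: "L2fun \<Omega> (grad \<Omega> u) \<and> weak_grad \<Omega> u (grad \<Omega> u)"
    unfolding grad_def by (rule someI[of _ G]) (use G in auto)
  have "AE x in lebesgue_on \<Omega>. grad \<Omega> u x = G x"
    using weak_grad_unique[OF \<Omega>] g G by blast
  then have "l2norm \<Omega> (\<lambda>x. grad \<Omega> u x - D\<phi> n x) = l2norm \<Omega> (\<lambda>x. G x - D\<phi> n x)" for n
    using L2funD(1)[OF L2fun_vector_test(2)[OF fin \<phi>(1)]] g G(1)
    by (intro l2norm_cong_AE) (auto simp: L2fun_def)
  then show ?thesis using \<phi> L g by (intro that) auto
qed

lemma H10_L2:
  assumes "open \<Omega>" "bounded \<Omega>" "H10 \<Omega> u"
  shows "L2fun \<Omega> u" "L2fun \<Omega> (grad \<Omega> u)" "weak_grad \<Omega> u (grad \<Omega> u)"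
  using H10_grad[OF assms] by metis+

lemma grad_AE_eq:
  assumes "open \<Omega>" "bounded \<Omega>" "H10 \<Omega> u" "L2fun \<Omega> G" "weak_grad \<Omega> u G"
  shows "AE x in lebesgue_on \<Omega>. grad \<Omega> u x = G x"
  using weak_grad_unique[OF assms(1,2) H10_L2(2,3)[OF assms(1-3)] assms(4,5)] .

lemma H10_vector_test:
  assumes \<Omega>: "open \<Omega>" "bounded \<Omega>" and t: "vector_test \<Omega> \<phi> D\<phi>"
  shows "H10 \<Omega> \<phi>" "AE x in lebesgue_on \<Omega>. grad \<Omega> \<phi> x = D\<phi> x"
proof -
  have fin: "\<Omega> \<in> lmeasurable" using \<Omega> by (simp add: lmeasurable_open)
  note L = L2fun_vector_test[OF fin t] and w = weak_grad_vector_test[OF fin t]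
  show H: "H10 \<Omega> \<phi>"
    unfolding H10_def using L w t by (auto intro!: exI[of _ D\<phi>] exI[of _ "\<lambda>_. \<phi>"] exI[of _ "\<lambda>_. D\<phi>"] simp: l2norm_def)
  show "AE x in lebesgue_on \<Omega>. grad \<Omega> \<phi> x = D\<phi> x"
    by (rule grad_AE_eq[OF \<Omega> H L(2) w])
qed

lemma vector_test_lin:
  assumes "vector_test \<Omega> \<phi> D\<phi>" "vector_test \<Omega> \<psi> D\<psi>"
  shows "vector_test \<Omega> (\<lambda>x. a *\<^sub>R \<phi> x + b *\<^sub>R \<psi> x) (\<lambda>x. a *\<^sub>R D\<phi> x + b *\<^sub>R D\<psi> x)"
  unfolding vector_test_def
proof (intro conjI allI)
  note d1 = vector_testD[OF assms(1)] and d2 = vector_testD[OF assms(2)]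
  fix x
  show "((\<lambda>x. a *\<^sub>R \<phi> x + b *\<^sub>R \<psi> x) has_derivative (\<lambda>h. (a *\<^sub>R D\<phi> x + b *\<^sub>R D\<psi> x) *v h)) (at x)"
    unfolding matrix_vector_mult_add_rdistrib scaleR_matrix_vector_assoc[symmetric]
    by (intro has_derivative_add has_derivative_scaleR_right d1(1) d2(1))
  show "continuous_on UNIV (\<lambda>x. a *\<^sub>R D\<phi> x + b *\<^sub>R D\<psi> x)"
    using d1(2) d2(2) by (intro continuous_intros)
  let ?K = "closure {x. \<phi> x \<noteq> 0} \<union> closure {x. \<psi> x \<noteq> 0}"
  have K: "compact ?K" using d1(4) d2(4) by (rule compact_Un)
  have "{x. a *\<^sub>R \<phi> x + b *\<^sub>R \<psi> x \<noteq> 0} \<subseteq> ?K"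
  proof
    fix x assume "x \<in> {x. a *\<^sub>R \<phi> x + b *\<^sub>R \<psi> x \<noteq> 0}"
    then have "x \<in> {x. \<phi> x \<noteq> 0} \<union> {x. \<psi> x \<noteq> 0}" by auto
    then show "x \<in> ?K" using closure_subset[of "{x. \<phi> x \<noteq> 0}"] closure_subset[of "{x. \<psi> x \<noteq> 0}"] by blast
  qed
  then have c: "closure {x. a *\<^sub>R \<phi> x + b *\<^sub>R \<psi> x \<noteq> 0} \<subseteq> ?K"
    using K by (intro closure_minimal compact_imp_closed)
  then show "closure {x. a *\<^sub>R \<phi> x + b *\<^sub>R \<psi> x \<noteq> 0} \<subseteq> \<Omega>" using d1(5) d2(5) by blast
  show "compact (closure {x. a *\<^sub>R \<phi> x + b *\<^sub>R \<psi> x \<noteq> 0})"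
    unfolding compact_closure
    by (rule bounded_subset[OF compact_imp_bounded[OF K] order_trans[OF closure_subset c]])
qed

lemma H10_lin:
  assumes \<Omega>: "open \<Omega>" "bounded \<Omega>" and u: "H10 \<Omega> u" and v: "H10 \<Omega> v"
  shows "H10 \<Omega> (\<lambda>x. a *\<^sub>R u x + b *\<^sub>R v x)"
    and "AE x in lebesgue_on \<Omega>. grad \<Omega> (\<lambda>x. a *\<^sub>R u x + b *\<^sub>R v x) x = a *\<^sub>R grad \<Omega> u x + b *\<^sub>R grad \<Omega> v x"
proof -
  have fin: "\<Omega> \<in> lmeasurable" using \<Omega> by (simp add: lmeasurable_open)
  obtain \<phi> D\<phi> where \<phi>: "\<And>n. vector_test \<Omega> (\<phi> n) (D\<phi> n)"
    "(\<lambda>n. l2norm \<Omega> (\<lambda>x. u x - \<phi> n x)) \<longlonglongrightarrow> 0" "(\<lambda>n. l2norm \<Omega> (\<lambda>x. grad \<Omega> u x - D\<phi> n x)) \<longlonglongrightarrow> 0"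
    by (rule H10_grad[OF \<Omega> u]) blast
  obtain \<psi> D\<psi> where \<psi>: "\<And>n. vector_test \<Omega> (\<psi> n) (D\<psi> n)"
    "(\<lambda>n. l2norm \<Omega> (\<lambda>x. v x - \<psi> n x)) \<longlonglongrightarrow> 0" "(\<lambda>n. l2norm \<Omega> (\<lambda>x. grad \<Omega> v x - D\<psi> n x)) \<longlonglongrightarrow> 0"
    by (rule H10_grad[OF \<Omega> v]) blast
  note Lu = H10_L2[OF \<Omega> u] and Lv = H10_L2[OF \<Omega> v]
  note L\<phi> = L2fun_vector_test[OF fin \<phi>(1)] and L\<psi> = L2fun_vector_test[OF fin \<psi>(1)]
  have lim: "(\<lambda>n. \<bar>a\<bar> * p n + \<bar>b\<bar> * q n) \<longlonglongrightarrow> 0" if "p \<longlonglongrightarrow> 0" "q \<longlonglongrightarrow> 0" for p q :: "nat \<Rightarrow> real"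
    using tendsto_add[OF tendsto_mult_right_zero[OF that(1)] tendsto_mult_right_zero[OF that(2)]] by simp
  have 1: "(\<lambda>n. l2norm \<Omega> (\<lambda>x. (a *\<^sub>R u x + b *\<^sub>R v x) - (a *\<^sub>R \<phi> n x + b *\<^sub>R \<psi> n x))) \<longlonglongrightarrow> 0"
  proof (rule Lim_null_comparison[OF always_eventually lim[OF \<phi>(2) \<psi>(2)]], intro allI)
    show "norm (l2norm \<Omega> (\<lambda>x. (a *\<^sub>R u x + b *\<^sub>R v x) - (a *\<^sub>R \<phi> n x + b *\<^sub>R \<psi> n x)))
        \<le> \<bar>a\<bar> * l2norm \<Omega> (\<lambda>x. u x - \<phi> n x) + \<bar>b\<bar> * l2norm \<Omega> (\<lambda>x. v x - \<psi> n x)" for n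
      using l2norm_lin_le[OF L2fun_diff[OF Lu(1) L\<phi>(1)[of n]] L2fun_diff[OF Lv(1) L\<psi>(1)[of n]], of a b]
      by (simp add: algebra_simps)
  qed
  have 2: "(\<lambda>n. l2norm \<Omega> (\<lambda>x. (a *\<^sub>R grad \<Omega> u x + b *\<^sub>R grad \<Omega> v x) - (a *\<^sub>R D\<phi> n x + b *\<^sub>R D\<psi> n x))) \<longlonglongrightarrow> 0"
  proof (rule Lim_null_comparison[OF always_eventually lim[OF \<phi>(3) \<psi>(3)]], intro allI)
    show "norm (l2norm \<Omega> (\<lambda>x. (a *\<^sub>R grad \<Omega> u x + b *\<^sub>R grad \<Omega> v x) - (a *\<^sub>R D\<phi> n x + b *\<^sub>R D\<psi> n x)))
        \<le> \<bar>a\<bar> * l2norm \<Omega> (\<lambda>x. grad \<Omega> u x - D\<phi> n x) + \<bar>b\<bar> * l2norm \<Omega> (\<lambda>x. grad \<Omega> v x - D\<psi> n x)" for n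
      using l2norm_lin_le[OF L2fun_diff[OF Lu(2) L\<phi>(2)[of n]] L2fun_diff[OF Lv(2) L\<psi>(2)[of n]], of a b]
      by (simp add: algebra_simps)
  qed
  note w = weak_grad_lin[OF fin Lu Lv, of a b] and L = L2fun_lin[OF Lu(2) Lv(2), of a b]
  show H: "H10 \<Omega> (\<lambda>x. a *\<^sub>R u x + b *\<^sub>R v x)"
    unfolding H10_def using L2fun_lin[OF Lu(1) Lv(1)] L w 1 2 vector_test_lin[OF \<phi>(1) \<psi>(1), where a=a and b=b]
    by (intro conjI exI[of _ "\<lambda>x. a *\<^sub>R grad \<Omega> u x + b *\<^sub>R grad \<Omega> v x"] exI[of _ "\<lambda>n x. a *\<^sub>R \<phi> n x + b *\<^sub>R \<psi> n x"]
        exI[of _ "\<lambda>n x. a *\<^sub>R D\<phi> n x + b *\<^sub>R D\<psi> n x"] allI) blast+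
  show "AE x in lebesgue_on \<Omega>. grad \<Omega> (\<lambda>x. a *\<^sub>R u x + b *\<^sub>R v x) x = a *\<^sub>R grad \<Omega> u x + b *\<^sub>R grad \<Omega> v x"
    by (rule grad_AE_eq[OF \<Omega> H L w])
qed

section \<open>The convective form\<close>

lemma norm_matrix_vector_mult_le:
  fixes A :: "real^'n^'m"
  shows "norm (A *v x) \<le> norm A * norm x"
proof -
  have "norm (A *v x) \<le> L2_set (\<lambda>i. norm (A $ i) * norm x) UNIV"
    unfolding norm_vec_def[of "A *v x"]
    by (intro L2_set_mono) (auto simp: matrix_vector_mul_component Cauchy_Schwarz_ineq2)
  also have "\<dots> = norm A * norm x"
    by (simp add: norm_vec_def[of A] L2_set_left_distrib)
  finally show ?thesis .
qed

text \<open>The crude constant does no harm: it only serves to show that the divergence is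
  square-integrable.\<close>

lemma abs_trace_le:
  fixes A :: "real^'n^'n"
  shows "\<bar>\<Sum>i\<in>UNIV. A $ i $ i\<bar> \<le> CARD('n) * norm A"
proof -
  have "\<bar>A $ i $ i\<bar> \<le> norm A" for i
    using component_le_norm_cart[of "A $ i" i] Finite_Cartesian_Product.norm_nth_le[of A i] by linarith
  then have "(\<Sum>i\<in>UNIV. \<bar>A $ i $ i\<bar>) \<le> (\<Sum>i\<in>(UNIV::'n set). norm A)" by (intro sum_mono)
  then have "(\<Sum>i\<in>UNIV. \<bar>A $ i $ i\<bar>) \<le> CARD('n) * norm A" by simp
  then show ?thesis by (rule order_trans[OF sum_abs])
qed

lemma borel_measurable_vec_component:
  fixes f :: "'n \<Rightarrow> 'b::euclidean_space^'k"
  assumes "f \<in> borel_measurable M"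
  shows "(\<lambda>x. f x $ i) \<in> borel_measurable M"
proof -
  have "(\<lambda>y::'b^'k. y $ i) \<in> borel_measurable borel"
    by (intro borel_measurable_continuous_onI continuous_intros)
  then show ?thesis using assms by measurable
qed

lemma borel_measurable_conv:
  fixes G :: "'n \<Rightarrow> real^'k^'l"
  assumes "G \<in> borel_measurable M" "v \<in> borel_measurable M" "z \<in> borel_measurable M"
  shows "(\<lambda>x. inner (G x *v v x) (z x)) \<in> borel_measurable M"
proof -
  have "(\<lambda>x. G x $ i $ j) \<in> borel_measurable M" for i j
    by (intro borel_measurable_vec_component assms)
  moreover have "(\<lambda>x. v x $ i) \<in> borel_measurable M" for i by (intro borel_measurable_vec_component assms)
  moreover have "(\<lambda>x. z x $ i) \<in> borel_measurable M" for i by (intro borel_measurable_vec_component assms)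
  ultimately show ?thesis
    unfolding inner_vec_def matrix_vector_mult_def by simp
qed

lemma divg_L2:
  assumes "open \<Omega>" "bounded \<Omega>" "H10 \<Omega> u"
  shows "L2fun \<Omega> (divg \<Omega> u)"
proof (rule L2fun_mono(1)[OF H10_L2(2)[OF assms]])
  show "divg \<Omega> u \<in> borel_measurable (lebesgue_on \<Omega>)"
    unfolding divg_def
    by (intro borel_measurable_sum borel_measurable_vec_component L2funD(1) H10_L2 assms)
  show "norm (divg \<Omega> u x) \<le> real CARD('a) * norm (grad \<Omega> u x)" for x
    unfolding divg_def real_norm_def by (rule abs_trace_le)
qed

lemma divg_lin_AE:
  assumes "open \<Omega>" "bounded \<Omega>" "H10 \<Omega> u" "H10 \<Omega> v"
  shows "AE x in lebesgue_on \<Omega>. divg \<Omega> (\<lambda>x. a *\<^sub>R u x + b *\<^sub>R v x) x = a * divg \<Omega> u x + b * divg \<Omega> v x"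
  using H10_lin(2)[OF assms, of a b]
  by eventually_elim (simp add: divg_def sum.distrib sum_distrib_left)

lemma h1norm_nonneg [simp]: "0 \<le> h1norm \<Omega> u"
  by (simp add: h1norm_def)

lemma h1norm_lin_le:
  assumes "open \<Omega>" "bounded \<Omega>" "H10 \<Omega> u" "H10 \<Omega> v"
  shows "h1norm \<Omega> (\<lambda>x. a *\<^sub>R u x + b *\<^sub>R v x) \<le> \<bar>a\<bar> * h1norm \<Omega> u + \<bar>b\<bar> * h1norm \<Omega> v"
proof -
  note Lu = H10_L2[OF assms(1-3)] and Lv = H10_L2[OF assms(1,2,4)]
  have "h1norm \<Omega> (\<lambda>x. a *\<^sub>R u x + b *\<^sub>R v x) = l2norm \<Omega> (\<lambda>x. a *\<^sub>R grad \<Omega> u x + b *\<^sub>R grad \<Omega> v x)"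
    unfolding h1norm_def
    by (intro l2norm_cong_AE H10_lin(2)[OF assms] L2funD(1) L2fun_lin Lu Lv H10_L2 assms H10_lin(1))
  then show ?thesis using l2norm_lin_le[OF Lu(2) Lv(2)] by (simp add: h1norm_def)
qed

lemma l2inner_grad_lin:
  assumes \<Omega>: "open \<Omega>" "bounded \<Omega>" and H: "H10 \<Omega> u" "H10 \<Omega> v" "H10 \<Omega> w"
  shows "l2inner \<Omega> (grad \<Omega> (\<lambda>x. a *\<^sub>R u x + b *\<^sub>R v x)) (grad \<Omega> w)
    = a * l2inner \<Omega> (grad \<Omega> u) (grad \<Omega> w) + b * l2inner \<Omega> (grad \<Omega> v) (grad \<Omega> w)"
proof -
  note L = H10_L2(2)[OF \<Omega> H(1)] H10_L2(2)[OF \<Omega> H(2)] H10_L2(2)[OF \<Omega> H(3)]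
  have "l2inner \<Omega> (grad \<Omega> (\<lambda>x. a *\<^sub>R u x + b *\<^sub>R v x)) (grad \<Omega> w)
      = l2inner \<Omega> (\<lambda>x. a *\<^sub>R grad \<Omega> u x + b *\<^sub>R grad \<Omega> v x) (grad \<Omega> w)"
    by (intro l2inner_cong_AE H10_lin(2)[OF \<Omega> H(1,2)] AE_I2 refl L2funD(1) L2fun_lin L H10_L2(2) \<Omega> H10_lin(1) H)
  then show ?thesis by (simp add: l2inner_lin_left[OF L])
qed

section \<open>Trilinear forms on a domain with Sobolev and interpolation constants\<close>

locale sobolev_domain =
  fixes \<Omega> :: "(real^'d) set" and C3 C6 :: real
  assumes domain: "open \<Omega>" "bounded \<Omega>"
    and sobolev6: "\<forall>\<phi>. H10 \<Omega> \<phi> \<longrightarrow> integrable (lebesgue_on \<Omega>) (\<lambda>x. norm (\<phi> x) powr 6)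
                      \<and> Lpnorm \<Omega> 6 \<phi> \<le> C6 * h1norm \<Omega> \<phi>"
    and interp3: "\<forall>\<phi>. H10 \<Omega> \<phi> \<longrightarrow> integrable (lebesgue_on \<Omega>) (\<lambda>x. norm (\<phi> x) powr 3)
                      \<and> Lpnorm \<Omega> 3 \<phi> \<le> C3 * sqrt (l2norm \<Omega> \<phi>) * sqrt (h1norm \<Omega> \<phi>)"
begin

lemmas lin = H10_lin[OF domain] and L2 = H10_L2[OF domain]

lemma meas: "H10 \<Omega> u \<Longrightarrow> u \<in> borel_measurable (lebesgue_on \<Omega>)"
    "H10 \<Omega> u \<Longrightarrow> grad \<Omega> u \<in> borel_measurable (lebesgue_on \<Omega>)"
  using L2 L2funD(1) by blast+

definition conv :: "(real^'d \<Rightarrow> real^'d) \<Rightarrow> (real^'d \<Rightarrow> real^'d) \<Rightarrow> (real^'d \<Rightarrow> real^'d) \<Rightarrow> real" where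
  "conv v w z = integral\<^sup>L (lebesgue_on \<Omega>) (\<lambda>x. inner (grad \<Omega> w x *v v x) (z x))"

definition divt :: "(real^'d \<Rightarrow> real^'d) \<Rightarrow> (real^'d \<Rightarrow> real^'d) \<Rightarrow> (real^'d \<Rightarrow> real^'d) \<Rightarrow> real" where
  "divt v w z = integral\<^sup>L (lebesgue_on \<Omega>) (\<lambda>x. divg \<Omega> v x * inner (w x) (z x))"

lemma Holder_H10:
  fixes a :: "real^'d \<Rightarrow> 'b::real_normed_vector"
  assumes "L2fun \<Omega> a" "F \<in> borel_measurable (lebesgue_on \<Omega>)" "H10 \<Omega> v" "H10 \<Omega> z"
    and "\<And>x. \<bar>F x\<bar> \<le> norm (a x) * norm (v x) * norm (z x)"
  shows "integrable (lebesgue_on \<Omega>) F"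
    and "\<bar>integral\<^sup>L (lebesgue_on \<Omega>) F\<bar>
      \<le> l2norm \<Omega> a * (C3 * sqrt (l2norm \<Omega> v) * sqrt (h1norm \<Omega> v)) * (C6 * h1norm \<Omega> z)"
proof -
  have v: "integrable (lebesgue_on \<Omega>) (\<lambda>x. norm (v x) powr 3)"
    "Lpnorm \<Omega> 3 v \<le> C3 * sqrt (l2norm \<Omega> v) * sqrt (h1norm \<Omega> v)" using interp3 assms(3) by auto
  have z: "integrable (lebesgue_on \<Omega>) (\<lambda>x. norm (z x) powr 6)"
    "Lpnorm \<Omega> 6 z \<le> C6 * h1norm \<Omega> z" using sobolev6 assms(4) by auto
  note H = Holder_2_3_6[OF assms(1,2) v(1) z(1) assms(5)]
  show "integrable (lebesgue_on \<Omega>) F" by (rule H(1))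
  have n: "0 \<le> Lpnorm \<Omega> 3 v" "0 \<le> Lpnorm \<Omega> 6 z" by (simp_all add: Lpnorm_def)
  have "l2norm \<Omega> a * Lpnorm \<Omega> 3 v * Lpnorm \<Omega> 6 z
      \<le> l2norm \<Omega> a * (C3 * sqrt (l2norm \<Omega> v) * sqrt (h1norm \<Omega> v)) * (C6 * h1norm \<Omega> z)"
    by (intro mult_mono[OF mult_left_mono[OF v(2) l2norm_nonneg] z(2)]
        mult_nonneg_nonneg[OF l2norm_nonneg order_trans[OF n(1) v(2)]] n(2))
  then show "\<bar>integral\<^sup>L (lebesgue_on \<Omega>) F\<bar>
      \<le> l2norm \<Omega> a * (C3 * sqrt (l2norm \<Omega> v) * sqrt (h1norm \<Omega> v)) * (C6 * h1norm \<Omega> z)"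
    using H(2) by simp
qed

lemma conv_bound:
  assumes v: "H10 \<Omega> v" and w: "H10 \<Omega> w" and z: "H10 \<Omega> z"
  shows "integrable (lebesgue_on \<Omega>) (\<lambda>x. inner (grad \<Omega> w x *v v x) (z x))"
    and "\<bar>conv v w z\<bar> \<le> h1norm \<Omega> w * (C3 * sqrt (l2norm \<Omega> v) * sqrt (h1norm \<Omega> v)) * (C6 * h1norm \<Omega> z)"
proof -
  have m: "(\<lambda>x. inner (grad \<Omega> w x *v v x) (z x)) \<in> borel_measurable (lebesgue_on \<Omega>)"
    by (intro borel_measurable_conv meas v w z)
  have "\<bar>inner (grad \<Omega> w x *v v x) (z x)\<bar> \<le> norm (grad \<Omega> w x) * norm (v x) * norm (z x)" for x
    using mult_right_mono[OF norm_matrix_vector_mult_le norm_ge_zero]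
    by (rule order_trans[OF Cauchy_Schwarz_ineq2])
  note H = Holder_H10[OF L2(2)[OF w] m v z this]
  show "integrable (lebesgue_on \<Omega>) (\<lambda>x. inner (grad \<Omega> w x *v v x) (z x))" by (rule H(1))
  show "\<bar>conv v w z\<bar> \<le> h1norm \<Omega> w * (C3 * sqrt (l2norm \<Omega> v) * sqrt (h1norm \<Omega> v)) * (C6 * h1norm \<Omega> z)"
    using H(2) unfolding conv_def h1norm_def .
qed

text \<open>The exponent 6 goes to w so that the bound is linear in the gradient norm of w, as the
  density argument in that slot wants; exponent 3 would leave a square root of its
  \<open>l2norm\<close>.\<close>

lemma divt_bound:
  assumes v: "H10 \<Omega> v" and w: "H10 \<Omega> w" and z: "H10 \<Omega> z"
  shows "integrable (lebesgue_on \<Omega>) (\<lambda>x. divg \<Omega> v x * inner (w x) (z x))"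
    and "\<bar>divt v w z\<bar> \<le> l2norm \<Omega> (divg \<Omega> v) * (C3 * sqrt (l2norm \<Omega> z) * sqrt (h1norm \<Omega> z)) * (C6 * h1norm \<Omega> w)"
proof -
  have m: "(\<lambda>x. divg \<Omega> v x * inner (w x) (z x)) \<in> borel_measurable (lebesgue_on \<Omega>)"
    by (intro borel_measurable_times borel_measurable_inner meas v w z L2funD(1) divg_L2 domain)
  have "\<bar>divg \<Omega> v x * inner (w x) (z x)\<bar> \<le> norm (divg \<Omega> v x) * norm (z x) * norm (w x)" for x
    using mult_left_mono[OF Cauchy_Schwarz_ineq2[of "w x" "z x"] abs_ge_zero[of "divg \<Omega> v x"]]
    by (simp add: abs_mult mult_ac)
  note H = Holder_H10[OF divg_L2[OF domain v] m z w this]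
  show "integrable (lebesgue_on \<Omega>) (\<lambda>x. divg \<Omega> v x * inner (w x) (z x))" by (rule H(1))
  show "\<bar>divt v w z\<bar> \<le> l2norm \<Omega> (divg \<Omega> v) * (C3 * sqrt (l2norm \<Omega> z) * sqrt (h1norm \<Omega> z)) * (C6 * h1norm \<Omega> w)"
    using H(2) unfolding divt_def .
qed

lemma conv_lin1:
  assumes "H10 \<Omega> u" "H10 \<Omega> v" "H10 \<Omega> w" "H10 \<Omega> z"
  shows "conv (\<lambda>x. a *\<^sub>R u x + b *\<^sub>R v x) w z = a * conv u w z + b * conv v w z"
  unfolding conv_def using conv_bound(1)[OF assms(1,3,4)] conv_bound(1)[OF assms(2,3,4)]
  by (simp add: matrix_vector_right_distrib matrix_vector_mult_scaleR inner_add_left)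

lemma conv_lin2:
  assumes "H10 \<Omega> u" "H10 \<Omega> v" "H10 \<Omega> w" "H10 \<Omega> z"
  shows "conv w (\<lambda>x. a *\<^sub>R u x + b *\<^sub>R v x) z = a * conv w u z + b * conv w v z"
proof -
  have "conv w (\<lambda>x. a *\<^sub>R u x + b *\<^sub>R v x) z = integral\<^sup>L (lebesgue_on \<Omega>)
      (\<lambda>x. a * inner (grad \<Omega> u x *v w x) (z x) + b * inner (grad \<Omega> v x *v w x) (z x))"
    unfolding conv_def
  proof (rule integral_cong_AE)
    show "(\<lambda>x. inner (grad \<Omega> (\<lambda>x. a *\<^sub>R u x + b *\<^sub>R v x) x *v w x) (z x)) \<in> borel_measurable (lebesgue_on \<Omega>)"
      by (intro borel_measurable_conv meas assms lin(1))
    show "(\<lambda>x. a * inner (grad \<Omega> u x *v w x) (z x) + b * inner (grad \<Omega> v x *v w x) (z x))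
        \<in> borel_measurable (lebesgue_on \<Omega>)"
      by (intro borel_measurable_add borel_measurable_times borel_measurable_const borel_measurable_conv meas assms)
    show "AE x in lebesgue_on \<Omega>. inner (grad \<Omega> (\<lambda>x. a *\<^sub>R u x + b *\<^sub>R v x) x *v w x) (z x)
        = a * inner (grad \<Omega> u x *v w x) (z x) + b * inner (grad \<Omega> v x *v w x) (z x)"
      using lin(2)[OF assms(1,2), of a b]
      by eventually_elim (simp add: matrix_vector_mult_add_rdistrib scaleR_matrix_vector_assoc[symmetric] inner_add_left)
  qed
  then show ?thesis
    unfolding conv_def using conv_bound(1)[OF assms(3,1,4)] conv_bound(1)[OF assms(3,2,4)] by simp
qed

lemma conv_lin3:
  assumes "H10 \<Omega> u" "H10 \<Omega> v" "H10 \<Omega> w" "H10 \<Omega> z"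
  shows "conv w z (\<lambda>x. a *\<^sub>R u x + b *\<^sub>R v x) = a * conv w z u + b * conv w z v"
  unfolding conv_def using conv_bound(1)[OF assms(3,4,1)] conv_bound(1)[OF assms(3,4,2)]
  by (simp add: inner_add_right)

lemma divt_lin2:
  assumes "H10 \<Omega> u" "H10 \<Omega> v" "H10 \<Omega> w" "H10 \<Omega> z"
  shows "divt w (\<lambda>x. a *\<^sub>R u x + b *\<^sub>R v x) z = a * divt w u z + b * divt w v z"
proof -
  have "divt w (\<lambda>x. a *\<^sub>R u x + b *\<^sub>R v x) z = integral\<^sup>L (lebesgue_on \<Omega>)
      (\<lambda>x. a * (divg \<Omega> w x * inner (u x) (z x)) + b * (divg \<Omega> w x * inner (v x) (z x)))"
    unfolding divt_def by (simp add: inner_add_left algebra_simps)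
  then show ?thesis
    unfolding divt_def using divt_bound(1)[OF assms(3,1,4)] divt_bound(1)[OF assms(3,2,4)] by simp
qed

lemma divt_commute: "divt v w z = divt v z w"
  by (simp add: divt_def inner_commute)

text \<open>Formally the integral over \<Omega> of div ((w . z) v), with the product rule carried
  out. Being symmetric in w and z and linear in each, it can be shown to vanish one slot at a
  time.\<close>

definition ibp_defect :: "(real^'d \<Rightarrow> real^'d) \<Rightarrow> (real^'d \<Rightarrow> real^'d) \<Rightarrow> (real^'d \<Rightarrow> real^'d) \<Rightarrow> real" where
  "ibp_defect v w z = conv v w z + conv v z w + divt v w z"

lemma ibp_defect_commute: "ibp_defect v w z = ibp_defect v z w"
  by (simp add: ibp_defect_def divt_commute)

lemma ibp_defect_lin:
  assumes "H10 \<Omega> u" "H10 \<Omega> v" "H10 \<Omega> w" "H10 \<Omega> z"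
  shows "ibp_defect w (\<lambda>x. a *\<^sub>R u x + b *\<^sub>R v x) z = a * ibp_defect w u z + b * ibp_defect w v z"
  unfolding ibp_defect_def conv_lin2[OF assms] conv_lin3[OF assms] divt_lin2[OF assms]
  by (simp add: algebra_simps)

lemma ibp_defect_bound:
  assumes v: "H10 \<Omega> v" and z: "H10 \<Omega> z"
  obtains C where "\<And>w. H10 \<Omega> w \<Longrightarrow> \<bar>ibp_defect v w z\<bar> \<le> C * h1norm \<Omega> w"
proof
  fix w assume w: "H10 \<Omega> w"
  show "\<bar>ibp_defect v w z\<bar> \<le> ((C3 * sqrt (l2norm \<Omega> v) * sqrt (h1norm \<Omega> v)) * (C6 * h1norm \<Omega> z)
      + h1norm \<Omega> z * (C3 * sqrt (l2norm \<Omega> v) * sqrt (h1norm \<Omega> v)) * C6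
      + l2norm \<Omega> (divg \<Omega> v) * (C3 * sqrt (l2norm \<Omega> z) * sqrt (h1norm \<Omega> z)) * C6) * h1norm \<Omega> w"
    using conv_bound(2)[OF v w z] conv_bound(2)[OF v z w] divt_bound(2)[OF v w z]
    unfolding ibp_defect_def by (simp add: algebra_simps)
qed

text \<open>The two convective terms together pair v with the gradient of \<phi> . \<psi>. Summing
  the diagonal entries of the weak gradient identity for v turns this into minus the divergence
  term; v itself is not approximated.\<close>

lemma ibp_defect_tests:
  assumes v: "H10 \<Omega> v" and \<phi>: "vector_test \<Omega> \<phi> D\<phi>" and \<psi>: "vector_test \<Omega> \<psi> D\<psi>"
  shows "ibp_defect v \<phi> \<psi> = 0"
proof -
  have fin: "\<Omega> \<in> lmeasurable" using domain by (simp add: lmeasurable_open)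
  note H\<phi> = H10_vector_test[OF domain \<phi>] and H\<psi> = H10_vector_test[OF domain \<psi>]
  note t = scalar_test_inner[OF \<phi> \<psi>]
  define \<eta> where "\<eta> x = \<phi> x \<bullet> \<psi> x" for x
  define D\<eta> where "D\<eta> x = \<psi> x v* D\<phi> x + \<phi> x v* D\<psi> x" for x
  have t: "scalar_test \<Omega> \<eta> D\<eta>" unfolding \<eta>_def D\<eta>_def by (rule t)
  note L\<eta> = L2fun_scalar_test[OF fin t]
  have "conv v \<phi> \<psi> + conv v \<psi> \<phi>
      = integral\<^sup>L (lebesgue_on \<Omega>) (\<lambda>x. inner (grad \<Omega> \<phi> x *v v x) (\<psi> x) + inner (grad \<Omega> \<psi> x *v v x) (\<phi> x))"
    unfolding conv_def using conv_bound(1)[OF v H\<phi>(1) H\<psi>(1)] conv_bound(1)[OF v H\<psi>(1) H\<phi>(1)] by simp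
  also have "\<dots> = integral\<^sup>L (lebesgue_on \<Omega>) (\<lambda>x. \<Sum>i\<in>UNIV. v x $ i * D\<eta> x $ i)"
  proof (rule integral_cong_AE)
    show "(\<lambda>x. inner (grad \<Omega> \<phi> x *v v x) (\<psi> x) + inner (grad \<Omega> \<psi> x *v v x) (\<phi> x))
        \<in> borel_measurable (lebesgue_on \<Omega>)"
      by (intro borel_measurable_add borel_measurable_conv meas v H\<phi>(1) H\<psi>(1))
    show "(\<lambda>x. \<Sum>i\<in>UNIV. v x $ i * D\<eta> x $ i) \<in> borel_measurable (lebesgue_on \<Omega>)"
      by (intro borel_measurable_sum borel_measurable_times borel_measurable_vec_component meas v L2funD(1)[OF L\<eta>(2)])
    show "AE x in lebesgue_on \<Omega>. inner (grad \<Omega> \<phi> x *v v x) (\<psi> x) + inner (grad \<Omega> \<psi> x *v v x) (\<phi> x)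
        = (\<Sum>i\<in>UNIV. v x $ i * D\<eta> x $ i)"
      using H\<phi>(2) H\<psi>(2)
    proof eventually_elim
      case (elim x)
      have "(\<Sum>i\<in>UNIV. v x $ i * D\<eta> x $ i) = D\<eta> x \<bullet> v x" by (simp add: inner_vec_def mult.commute)
      also have "\<dots> = \<psi> x \<bullet> (D\<phi> x *v v x) + \<phi> x \<bullet> (D\<psi> x *v v x)"
        by (simp add: D\<eta>_def inner_add_left dot_lmul_matrix)
      finally show ?case using elim by (simp add: inner_commute)
    qed
  qed
  also have "\<dots> = (\<Sum>i\<in>UNIV. - integral\<^sup>L (lebesgue_on \<Omega>) (\<lambda>x. grad \<Omega> v x $ i $ i * \<eta> x))"
    using integrable_component_mult[OF L2(1)[OF v] L\<eta>(2)] weak_gradD[OF L2(3)[OF v] t] by simp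
  also have "\<dots> = - integral\<^sup>L (lebesgue_on \<Omega>) (\<lambda>x. \<Sum>i\<in>UNIV. grad \<Omega> v x $ i $ i * \<eta> x)"
    using integrable_entry_mult[OF L2(2)[OF v] L\<eta>(1)] by (simp add: sum_negf)
  also have "\<dots> = - divt v \<phi> \<psi>"
    unfolding divt_def divg_def \<eta>_def by (simp add: sum_distrib_right)
  finally show ?thesis by (simp add: ibp_defect_def)
qed

text \<open>For fixed v and z the defect is controlled by the gradient norm of w, so convergence of
  the gradients of the approximating tests suffices.\<close>

lemma ibp_defect_0_approx:
  assumes v: "H10 \<Omega> v" and w: "H10 \<Omega> w" and z: "H10 \<Omega> z"
    and 0: "\<And>\<phi> D\<phi>. vector_test \<Omega> \<phi> D\<phi> \<Longrightarrow> ibp_defect v \<phi> z = 0"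
  shows "ibp_defect v w z = 0"
proof -
  have fin: "\<Omega> \<in> lmeasurable" using domain by (simp add: lmeasurable_open)
  obtain \<phi> D\<phi> where \<phi>: "\<And>n. vector_test \<Omega> (\<phi> n) (D\<phi> n)"
    "(\<lambda>n. l2norm \<Omega> (\<lambda>x. grad \<Omega> w x - D\<phi> n x)) \<longlonglongrightarrow> 0"
    by (rule H10_grad[OF domain w]) blast
  note H = H10_vector_test[OF domain \<phi>(1)]
  obtain C where C: "\<And>w. H10 \<Omega> w \<Longrightarrow> \<bar>ibp_defect v w z\<bar> \<le> C * h1norm \<Omega> w"
    using ibp_defect_bound[OF v z] by blast
  have "\<bar>ibp_defect v w z\<bar> \<le> C * l2norm \<Omega> (\<lambda>x. grad \<Omega> w x - D\<phi> n x)" for n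
  proof -
    have "ibp_defect v (\<lambda>x. 1 *\<^sub>R w x + (-1) *\<^sub>R \<phi> n x) z = ibp_defect v w z"
      by (simp only: ibp_defect_lin[OF w H(1) v z] 0[OF \<phi>(1)])
    then have "\<bar>ibp_defect v w z\<bar> \<le> C * h1norm \<Omega> (\<lambda>x. 1 *\<^sub>R w x + (-1) *\<^sub>R \<phi> n x)"
      using C[OF lin(1)[OF w H(1)[of n], of 1 "-1"]] by simp
    also have "h1norm \<Omega> (\<lambda>x. 1 *\<^sub>R w x + (-1) *\<^sub>R \<phi> n x) = l2norm \<Omega> (\<lambda>x. grad \<Omega> w x - D\<phi> n x)"
      unfolding h1norm_def
    proof (rule l2norm_cong_AE)
      show "AE x in lebesgue_on \<Omega>. grad \<Omega> (\<lambda>x. 1 *\<^sub>R w x + (-1) *\<^sub>R \<phi> n x) x = grad \<Omega> w x - D\<phi> n x"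
        using lin(2)[OF w H(1)[of n], of 1 "-1"] H(2)[of n] by eventually_elim simp
      show "grad \<Omega> (\<lambda>x. 1 *\<^sub>R w x + (-1) *\<^sub>R \<phi> n x) \<in> borel_measurable (lebesgue_on \<Omega>)"
        by (intro meas lin w H(1))
      show "(\<lambda>x. grad \<Omega> w x - D\<phi> n x) \<in> borel_measurable (lebesgue_on \<Omega>)"
        by (intro L2funD(1) L2fun_diff L2(2) w L2fun_vector_test(2)[OF fin \<phi>(1)])
    qed
    finally show ?thesis .
  qed
  moreover have "(\<lambda>n. C * l2norm \<Omega> (\<lambda>x. grad \<Omega> w x - D\<phi> n x)) \<longlonglongrightarrow> 0"
    by (rule tendsto_mult_right_zero[OF \<phi>(2)])
  ultimately have "\<bar>ibp_defect v w z\<bar> \<le> 0"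
    by (intro LIMSEQ_le_const[OF \<open>(\<lambda>n. C * _ n) \<longlonglongrightarrow> 0\<close>]) auto
  then show ?thesis by simp
qed

text \<open>Density is applied twice: once with a test function in the other slot, then, after
  exchanging the slots by symmetry, for a general function there.\<close>

lemma ibp_defect_eq_0:
  assumes "H10 \<Omega> v" "H10 \<Omega> w" "H10 \<Omega> z"
  shows "ibp_defect v w z = 0"
proof (rule ibp_defect_0_approx[OF assms])
  fix \<phi> D\<phi> assume \<phi>: "vector_test \<Omega> \<phi> D\<phi>"
  have "ibp_defect v z \<phi> = 0"
    by (rule ibp_defect_0_approx[OF assms(1,3) H10_vector_test(1)[OF domain \<phi>] ibp_defect_tests[OF assms(1) _ \<phi>]])
  then show "ibp_defect v \<phi> z = 0" by (simp add: ibp_defect_commute)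
qed

text \<open>A vanishing defect writes the divergence term as minus the two convective ones. Half of
  it makes \<open>bstar\<close> the antisymmetric part of the convective form.\<close>

lemma bstar_skew:
  assumes "H10 \<Omega> v" "H10 \<Omega> w" "H10 \<Omega> z"
  shows "bstar \<Omega> v w z = (conv v w z - conv v z w) / 2"
  using ibp_defect_eq_0[OF assms]
  unfolding bstar_def l2inner_def conv_def[symmetric] divt_def[symmetric] ibp_defect_def by simp

lemma bstar_self: "H10 \<Omega> v \<Longrightarrow> H10 \<Omega> w \<Longrightarrow> bstar \<Omega> v w w = 0"
  by (simp add: bstar_skew)

text \<open>In the antisymmetric form v always takes exponent 3, while w and z share exponents 2
  (gradient) and 6. Both halves have the same bound, so the constant is C3 C6, free of any dimension
  factor from the divergence.\<close>

lemma bstar_bound: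
  assumes "H10 \<Omega> v" "H10 \<Omega> w" "H10 \<Omega> z"
  shows "\<bar>bstar \<Omega> v w z\<bar> \<le> C3 * C6 * sqrt (l2norm \<Omega> v) * sqrt (h1norm \<Omega> v) * h1norm \<Omega> w * h1norm \<Omega> z"
  using conv_bound(2)[OF assms] conv_bound(2)[OF assms(1,3,2)]
  unfolding bstar_skew[OF assms] by (simp add: algebra_simps)

lemma bstar_lin1:
  assumes "H10 \<Omega> u" "H10 \<Omega> v" "H10 \<Omega> w" "H10 \<Omega> z"
  shows "bstar \<Omega> (\<lambda>x. a *\<^sub>R u x + b *\<^sub>R v x) w z = a * bstar \<Omega> u w z + b * bstar \<Omega> v w z"
  by (simp add: bstar_skew assms lin(1) conv_lin1 field_simps)

lemma bstar_lin2:
  assumes "H10 \<Omega> u" "H10 \<Omega> v" "H10 \<Omega> w" "H10 \<Omega> z"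
  shows "bstar \<Omega> w (\<lambda>x. a *\<^sub>R u x + b *\<^sub>R v x) z = a * bstar \<Omega> w u z + b * bstar \<Omega> w v z"
  by (simp add: bstar_skew assms lin(1) conv_lin2 conv_lin3 field_simps)

end

section \<open>Skew-symmetric Picard iterations\<close>

text \<open>To be read with \<open>N\<close> the gradient norm, \<open>L\<close> the L2 norm,
  \<open>ip\<close> the Dirichlet form and \<open>c\<close> the product C3 C6. The third slot of
  \<open>b\<close> always holds one fixed test vector, so linearity is recorded for the other two.
  \<open>b_bound\<close> keeps \<open>L v\<close> and \<open>N v\<close> apart because the gain term
  contains both.\<close>

locale skew_form =
  fixes V :: "'v::real_vector set" and N L :: "'v \<Rightarrow> real" and ip :: "'v \<Rightarrow> 'v \<Rightarrow> real"
    and b :: "'v \<Rightarrow> 'v \<Rightarrow> 'v \<Rightarrow> real" and c CP :: real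
  assumes V: "subspace V"
    and N_nonneg: "0 \<le> N v"
    and N_lin_le: "u \<in> V \<Longrightarrow> v \<in> V \<Longrightarrow> N (p *\<^sub>R u + q *\<^sub>R v) \<le> \<bar>p\<bar> * N u + \<bar>q\<bar> * N v"
    and ip_lin: "u \<in> V \<Longrightarrow> v \<in> V \<Longrightarrow> z \<in> V \<Longrightarrow> ip (p *\<^sub>R u + q *\<^sub>R v) z = p * ip u z + q * ip v z"
    and ip_self: "v \<in> V \<Longrightarrow> ip v v = (N v)\<^sup>2"
    and b_lin1: "u \<in> V \<Longrightarrow> v \<in> V \<Longrightarrow> w \<in> V \<Longrightarrow> z \<in> V \<Longrightarrow>
      b (p *\<^sub>R u + q *\<^sub>R v) w z = p * b u w z + q * b v w z"
    and b_lin2: "u \<in> V \<Longrightarrow> v \<in> V \<Longrightarrow> w \<in> V \<Longrightarrow> z \<in> V \<Longrightarrow>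
      b w (p *\<^sub>R u + q *\<^sub>R v) z = p * b w u z + q * b w v z"
    and b_self: "v \<in> V \<Longrightarrow> w \<in> V \<Longrightarrow> b v w w = 0"
    and b_bound: "v \<in> V \<Longrightarrow> w \<in> V \<Longrightarrow> z \<in> V \<Longrightarrow>
      \<bar>b v w z\<bar> \<le> c * sqrt (L v) * sqrt (N v) * N w * N z"
    and c: "0 \<le> c" and CP: "0 \<le> CP"
    and L_le: "v \<in> V \<Longrightarrow> L v \<le> CP * N v"
begin

definition M :: real where "M = sqrt CP * c"

lemma M_nonneg: "0 \<le> M"
  using c CP by (simp add: M_def)

lemmas V_diff = subspace_diff[OF V]
  and V_scale = subspace_scale[OF V] and V_sum = subspace_sum[OF V] and V_0 = subspace_0[OF V]

lemma N_add: "u \<in> V \<Longrightarrow> v \<in> V \<Longrightarrow> N (u + v) \<le> N u + N v"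
  using N_lin_le[of u v 1 1] by simp

lemma N_scale: "v \<in> V \<Longrightarrow> N (p *\<^sub>R v) \<le> \<bar>p\<bar> * N v"
  using N_lin_le[of v v p 0] by simp

lemma N_0: "N 0 = 0"
  using N_scale[OF V_0, of 0] N_nonneg[of 0] by simp

lemma N_scale_eq:
  assumes "v \<in> V"
  shows "N (p *\<^sub>R v) = \<bar>p\<bar> * N v"
proof (cases "p = 0")
  case False
  have "N v \<le> \<bar>inverse p\<bar> * N (p *\<^sub>R v)"
    using N_scale[OF V_scale[OF assms, of p], of "inverse p"] False by simp
  then show ?thesis
    using N_scale[OF assms, of p] False by (simp add: field_simps)
qed (simp add: N_0)

lemma N_diff: "u \<in> V \<Longrightarrow> v \<in> V \<Longrightarrow> N (u - v) \<le> N u + N v"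
  using N_lin_le[of u v 1 "-1"] by simp

lemma N_sum:
  assumes "\<And>j. j \<in> J \<Longrightarrow> F j \<in> V"
  shows "N (\<Sum>j\<in>J. a j *\<^sub>R F j) \<le> (\<Sum>j\<in>J. \<bar>a j\<bar> * N (F j))"
  using assms
proof (induction J rule: infinite_finite_induct)
  case (insert x J)
  then have "N (a x *\<^sub>R F x + (\<Sum>j\<in>J. a j *\<^sub>R F j)) \<le> \<bar>a x\<bar> * N (F x) + (\<Sum>j\<in>J. \<bar>a j\<bar> * N (F j))"
    by (intro order_trans[OF N_add] add_mono N_scale V_scale V_sum) auto
  then show ?case using insert by simp
qed (auto simp: N_0)

lemma b_diff1: "u \<in> V \<Longrightarrow> v \<in> V \<Longrightarrow> w \<in> V \<Longrightarrow> z \<in> V \<Longrightarrow> b (u - v) w z = b u w z - b v w z"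
  using b_lin1[of u v w z 1 "-1"] by simp

lemma b_diff2: "u \<in> V \<Longrightarrow> v \<in> V \<Longrightarrow> w \<in> V \<Longrightarrow> z \<in> V \<Longrightarrow> b w (u - v) z = b w u z - b w v z"
  using b_lin2[of u v w z 1 "-1"] by simp

lemma ip_diff: "u \<in> V \<Longrightarrow> v \<in> V \<Longrightarrow> z \<in> V \<Longrightarrow> ip (u - v) z = ip u z - ip v z"
  using ip_lin[of u v z 1 "-1"] by simp

lemma b_sum1:
  assumes "\<And>j. j \<in> J \<Longrightarrow> F j \<in> V" "w \<in> V" "z \<in> V"
  shows "b (\<Sum>j\<in>J. a j *\<^sub>R F j) w z = (\<Sum>j\<in>J. a j * b (F j) w z)"
  using assms
proof (induction J rule: infinite_finite_induct)
  case (insert x J)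
  then have "(\<Sum>j\<in>J. a j *\<^sub>R F j) \<in> V" by (intro V_sum V_scale) auto
  then show ?case
    using insert b_lin1[of "F x" "\<Sum>j\<in>J. a j *\<^sub>R F j" w z "a x" 1] by simp
qed (use b_lin1[OF V_0 V_0, of w z 0 0] in auto)

lemma b_sum2:
  assumes "\<And>j. j \<in> J \<Longrightarrow> F j \<in> V" "w \<in> V" "z \<in> V"
  shows "b w (\<Sum>j\<in>J. a j *\<^sub>R F j) z = (\<Sum>j\<in>J. a j * b w (F j) z)"
  using assms
proof (induction J rule: infinite_finite_induct)
  case (insert x J)
  then have "(\<Sum>j\<in>J. a j *\<^sub>R F j) \<in> V" by (intro V_sum V_scale) auto
  then show ?case
    using insert b_lin2[of "F x" "\<Sum>j\<in>J. a j *\<^sub>R F j" w z "a x" 1] by simp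
qed (use b_lin2[OF V_0 V_0, of w z 0 0] in auto)

lemma ip_sum:
  assumes "\<And>j. j \<in> J \<Longrightarrow> F j \<in> V" "z \<in> V"
  shows "ip (\<Sum>j\<in>J. a j *\<^sub>R F j) z = (\<Sum>j\<in>J. a j * ip (F j) z)"
  using assms
proof (induction J rule: infinite_finite_induct)
  case (insert x J)
  then have "(\<Sum>j\<in>J. a j *\<^sub>R F j) \<in> V" by (intro V_sum V_scale) auto
  then show ?case
    using insert ip_lin[of "F x" "\<Sum>j\<in>J. a j *\<^sub>R F j" z "a x" 1] by simp
qed (use ip_lin[OF V_0 V_0, of z 0 0] in auto)

text \<open>The Poincare inequality absorbs \<open>L v\<close>. This coarser form serves where only
  gradient norms may remain, that is, for increments in the first slot.\<close>

lemma b_bound_M: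
  assumes "v \<in> V" "w \<in> V" "z \<in> V"
  shows "\<bar>b v w z\<bar> \<le> M * N v * N w * N z"
proof -
  have "sqrt (L v) * sqrt (N v) \<le> sqrt (CP * N v) * sqrt (N v)"
    using L_le[OF assms(1)] N_nonneg by (intro mult_right_mono) auto
  also have "\<dots> = sqrt CP * N v"
    using N_nonneg[of v] by (simp add: real_sqrt_mult)
  finally have "c * (sqrt (L v) * sqrt (N v)) * (N w * N z) \<le> c * (sqrt CP * N v) * (N w * N z)"
    using c N_nonneg by (intro mult_right_mono mult_left_mono) auto
  then show ?thesis using b_bound[OF assms] by (simp add: M_def mult_ac)
qed

end

text \<open>Summation by parts. \<open>min l q\<close> records that the weights stop at l while the
  differences run on to k. With l = k and increments it expands the averaged residual; with
  differences of consecutive Picard images it expands the second argument of the error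
  terms.\<close>

lemma sum_weighted_tails:
  fixes d :: "nat \<Rightarrow> 'v::real_vector"
  assumes "l \<le> k"
  shows "(\<Sum>j=p..l. a j *\<^sub>R (\<Sum>q=j..k. d q)) = (\<Sum>q=p..k. (\<Sum>j=p..min l q. a j) *\<^sub>R d q)"
proof -
  have "(\<Sum>j=p..l. a j *\<^sub>R (\<Sum>q=j..k. d q)) = (\<Sum>j=p..l. \<Sum>q | q \<in> {p..k} \<and> j \<le> q. a j *\<^sub>R d q)"
    by (auto simp: scaleR_sum_right intro!: sum.cong)
  also have "\<dots> = (\<Sum>q=p..k. \<Sum>j | j \<in> {p..l} \<and> j \<le> q. a j *\<^sub>R d q)"
    by (rule sum.swap_restrict) auto
  also have "\<dots> = (\<Sum>q=p..k. (\<Sum>j=p..min l q. a j) *\<^sub>R d q)"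
    by (auto simp: scaleR_sum_left intro!: sum.cong)
  finally show ?thesis .
qed

text \<open>Folds ordered pairs into pairs i < j, the shape of the double sum in the claim.\<close>

lemma sum_offdiag:
  fixes h :: "nat \<Rightarrow> nat \<Rightarrow> real"
  shows "(\<Sum>l\<in>{p..<k}. \<Sum>q\<in>{p..<k}-{l}. h l q) = (\<Sum>j\<in>{p..<k}. \<Sum>i\<in>{p..<j}. h i j + h j i)"
proof -
  have "(\<Sum>q\<in>{p..<k}-{l}. h l q) = (\<Sum>q\<in>{p..<l}. h l q) + (\<Sum>q | q \<in> {p..<k} \<and> l < q. h l q)"
    if "l \<in> {p..<k}" for l
  proof -
    have "{p..<k}-{l} = {p..<l} \<union> {q \<in> {p..<k}. l < q}" using that by auto
    then show ?thesis by (simp add: sum.union_disjoint[symmetric] disjoint_iff)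
  qed
  then have "(\<Sum>l\<in>{p..<k}. \<Sum>q\<in>{p..<k}-{l}. h l q)
      = (\<Sum>l\<in>{p..<k}. \<Sum>q\<in>{p..<l}. h l q) + (\<Sum>l\<in>{p..<k}. \<Sum>q | q \<in> {p..<k} \<and> l < q. h l q)"
    by (simp add: sum.distrib)
  also have "(\<Sum>l\<in>{p..<k}. \<Sum>q | q \<in> {p..<k} \<and> l < q. h l q) = (\<Sum>q\<in>{p..<k}. \<Sum>l | l \<in> {p..<k} \<and> l < q. h l q)"
    by (rule sum.swap_restrict) auto
  also have "\<dots> = (\<Sum>q\<in>{p..<k}. \<Sum>l\<in>{p..<q}. h l q)"
    by (intro sum.cong) auto
  finally show ?thesis by (simp add: sum.distrib)
qed

text \<open>The diagonal terms \<open>|g\<^sub>l| x\<^sub>l\<^sup>2\<close> on the left have no counterpart on the right; they are traded for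
  off-diagonal ones by hypothesis \<open>gx\<close>. The coefficient of \<open>y\<^sub>i y\<^sub>j\<close> is then at most \<open>4 m - 3\<close> times \<open>A\<close>, and
  \<open>m (m + 3) / 2 - (4 m - 3) = (m - 2) (m - 3) / 2\<close> is nonnegative for integers.\<close>

lemma pair_sum_bound:
  fixes x y g :: "nat \<Rightarrow> real" and A t :: real
  defines "C \<equiv> \<lambda>m::nat. real (m * (m + 3)) * A / 2"
  assumes k: "p + 2 \<le> k" and x: "\<And>l. l \<in> {p..k} \<Longrightarrow> 0 \<le> x l" "\<And>l. l \<in> {p..k} \<Longrightarrow> x l \<le> y l"
    and t: "t \<le> y k" and gk: "g k = 1" and A: "1 \<le> A"
    and g: "\<And>l. l \<in> {p..<k} \<Longrightarrow> \<bar>g l\<bar> \<le> real (l - p + 1) * A"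
    and gx: "\<And>l. l \<in> {p..<k} \<Longrightarrow> \<bar>g l\<bar> * x l \<le> t + (\<Sum>q\<in>{p..k}-{l}. \<bar>g q\<bar> * x q)"
  shows "(\<Sum>l=p..<k. x l * (\<Sum>q=p..k. \<bar>g (min l q)\<bar> * x q))
    \<le> C (k - p) * (\<Sum>j=p..k. \<Sum>i=p..<j. y j * y i)"
proof -
  define m where "m = k - p"
  have m: "2 \<le> m" using k by (simp add: m_def)
  have y0: "0 \<le> y l" if "l \<in> {p..k}" for l using x[OF that] by linarith
  define h where "h l q = (\<bar>g q\<bar> + \<bar>g (min l q)\<bar>) * (y l * y q)" for l q
  \<comment> \<open>The 2 in front of \<open>y k * y l\<close> collects \<open>t\<close> and
    \<open>x k\<close>, both produced by trading the diagonal term; \<open>\<bar>g l\<bar>\<close>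
    was there before, since \<open>min l k = l\<close>.\<close>
  have row: "x l * (\<Sum>q=p..k. \<bar>g (min l q)\<bar> * x q) \<le> (2 + \<bar>g l\<bar>) * (y k * y l) + (\<Sum>q\<in>{p..<k}-{l}. h l q)"
    if l: "l \<in> {p..<k}" for l
  proof -
    have lk: "l \<in> {p..k}" "k \<in> {p..k}" using l by auto
    have s1: "{p..k}-{l} = insert k ({p..<k}-{l})" and s2: "{p..k} = insert l (insert k ({p..<k}-{l}))"
      using l by auto
    have "(\<Sum>q=p..k. \<bar>g (min l q)\<bar> * x q)
        = \<bar>g l\<bar> * x l + (\<bar>g l\<bar> * x k + (\<Sum>q\<in>{p..<k}-{l}. \<bar>g (min l q)\<bar> * x q))"
      unfolding s2 using l by simp
    also have "\<bar>g l\<bar> * x l \<le> t + (x k + (\<Sum>q\<in>{p..<k}-{l}. \<bar>g q\<bar> * x q))"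
      using gx[OF l] unfolding s1 by (simp add: gk)
    finally have "(\<Sum>q=p..k. \<bar>g (min l q)\<bar> * x q)
        \<le> t + x k + \<bar>g l\<bar> * x k + (\<Sum>q\<in>{p..<k}-{l}. (\<bar>g q\<bar> + \<bar>g (min l q)\<bar>) * x q)"
      by (simp add: distrib_right sum.distrib)
    also have "\<dots> \<le> y k + y k + \<bar>g l\<bar> * y k + (\<Sum>q\<in>{p..<k}-{l}. (\<bar>g q\<bar> + \<bar>g (min l q)\<bar>) * y q)"
      using t x(2) lk by (intro add_mono mult_left_mono sum_mono) auto
    finally have le: "(\<Sum>q=p..k. \<bar>g (min l q)\<bar> * x q)
        \<le> (2 + \<bar>g l\<bar>) * y k + (\<Sum>q\<in>{p..<k}-{l}. (\<bar>g q\<bar> + \<bar>g (min l q)\<bar>) * y q)"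
      by (simp add: algebra_simps)
    have "x l * (\<Sum>q=p..k. \<bar>g (min l q)\<bar> * x q)
        \<le> y l * ((2 + \<bar>g l\<bar>) * y k + (\<Sum>q\<in>{p..<k}-{l}. (\<bar>g q\<bar> + \<bar>g (min l q)\<bar>) * y q))"
      using x(1) y0 lk by (intro mult_mono[OF x(2) le] sum_nonneg) auto
    also have "\<dots> = (2 + \<bar>g l\<bar>) * (y k * y l) + (\<Sum>q\<in>{p..<k}-{l}. h l q)"
      unfolding h_def by (simp add: algebra_simps sum_distrib_left)
    finally show ?thesis .
  qed
  have m1: "(real m + 2) * A \<le> C m"
  proof -
    have "0 \<le> (real m - 2) * (real m + 3)" using m by simp
    then have "2 * (real m + 2) \<le> real (m * (m + 3))" by (simp add: algebra_simps)
    then have "2 * (real m + 2) * A \<le> real (m * (m + 3)) * A" using A by (intro mult_right_mono) auto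
    then show ?thesis by (simp add: C_def algebra_simps)
  qed
  have m2: "(4 * real m - 3) * A \<le> C m"
  proof -
    have "0 \<le> (real m - 2) * (real m - 3)"
      using m by (cases "m = 2") (auto intro!: mult_nonneg_nonneg)
    then have "2 * (4 * real m - 3) \<le> real (m * (m + 3))" by (simp add: algebra_simps)
    then have "2 * (4 * real m - 3) * A \<le> real (m * (m + 3)) * A" using A by (intro mult_right_mono) auto
    then show ?thesis by (simp add: C_def algebra_simps)
  qed
  have "(\<Sum>l=p..<k. x l * (\<Sum>q=p..k. \<bar>g (min l q)\<bar> * x q))
      \<le> (\<Sum>l=p..<k. (2 + \<bar>g l\<bar>) * (y k * y l)) + (\<Sum>l=p..<k. \<Sum>q\<in>{p..<k}-{l}. h l q)"
    unfolding sum.distrib[symmetric] by (intro sum_mono row)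
  also have "(\<Sum>l=p..<k. \<Sum>q\<in>{p..<k}-{l}. h l q) = (\<Sum>j=p..<k. \<Sum>i=p..<j. h i j + h j i)"
    by (rule sum_offdiag)
  also have "\<dots> \<le> (\<Sum>j=p..<k. \<Sum>i=p..<j. C m * (y j * y i))"
  proof (intro sum_mono)
    fix j i assume j: "j \<in> {p..<k}" and i: "i \<in> {p..<j}"
    \<comment> \<open>As i < j < k, the partial sums have at most m - 1 and m terms. The combination
      |g j| + 3 |g i| then costs m + 3 (m - 1) = 4 m - 3.\<close>
    have "real (i - p + 1) \<le> real m - 1" "real (j - p + 1) \<le> real m" using i j by (auto simp: m_def)
    then have "real (i - p + 1) * A \<le> (real m - 1) * A" "real (j - p + 1) * A \<le> real m * A"
      using A by (auto intro!: mult_right_mono)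
    then have "\<bar>g j\<bar> + 3 * \<bar>g i\<bar> \<le> (4 * real m - 3) * A"
      using g[OF j] g[of i] i j by (simp add: algebra_simps)
    then have "\<bar>g j\<bar> + 3 * \<bar>g i\<bar> \<le> C m" using m2 by linarith
    moreover have "0 \<le> y j * y i" using y0[of i] y0[of j] i j by simp
    moreover have "h i j + h j i = (\<bar>g j\<bar> + 3 * \<bar>g i\<bar>) * (y j * y i)"
      using i by (simp add: h_def min_def algebra_simps)
    ultimately show "h i j + h j i \<le> C m * (y j * y i)" by (simp add: mult_right_mono)
  qed
  also have "(\<Sum>l=p..<k. (2 + \<bar>g l\<bar>) * (y k * y l)) \<le> (\<Sum>l=p..<k. C m * (y k * y l))"
  proof (intro sum_mono mult_right_mono)
    fix l assume l: "l \<in> {p..<k}"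
    have "real (l - p + 1) * A \<le> real m * A" using l A by (intro mult_right_mono) (auto simp: m_def)
    then have "2 + \<bar>g l\<bar> \<le> (real m + 2) * A" using g[OF l] A by (simp add: algebra_simps)
    then show "2 + \<bar>g l\<bar> \<le> C m" using m1 by linarith
    show "0 \<le> y k * y l" using y0[of k] y0[of l] l by simp
  qed
  finally have "(\<Sum>l=p..<k. x l * (\<Sum>q=p..k. \<bar>g (min l q)\<bar> * x q))
      \<le> (\<Sum>l=p..<k. C m * (y k * y l)) + (\<Sum>j=p..<k. \<Sum>i=p..<j. C m * (y j * y i))" by simp
  also have "\<dots> = C m * (\<Sum>j=p..k. \<Sum>i=p..<j. y j * y i)"
  proof -
    have "{p..k} = insert k {p..<k}" using k by auto
    then show ?thesis by (simp add: sum_distrib_left distrib_left)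
  qed
  finally show ?thesis by (simp add: m_def)
qed

text \<open>For \<open>m = 1\<close> the trade above loses too much. Here \<open>s\<close> stands for the norm of
  \<open>e\<^sub>k + e\<^sub>p = w\<^sup>\<alpha> + (1 - a) e\<^sub>p\<close>, and the better of its two estimates depends on \<open>a\<close>.\<close>

lemma single_pair_bound:
  fixes a A :: real
  assumes x: "0 \<le> xp" "xp \<le> yp" "0 \<le> xk" "xk \<le> yk" and t: "0 \<le> t" "t \<le> yk"
    and s: "s \<le> xk + xp" "s \<le> t + \<bar>1 - a\<bar> * xp" and ax: "\<bar>a\<bar> * xp \<le> t + xk"
    and A: "1 \<le> A" "\<bar>a\<bar> \<le> A" "\<bar>1 - a\<bar> \<le> A"
  shows "\<bar>a\<bar> * xp * s \<le> 2 * A * (yk * yp)"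
proof -
  have y: "0 \<le> yk" "0 \<le> yp" using x t by auto
  have xy: "xp * xk \<le> yk * yp" "xp * t \<le> yk * yp"
    using mult_mono[OF x(2) x(4)] mult_mono[OF x(2) t(2)] x t y by (auto simp: mult.commute)
  have ax': "\<bar>a\<bar> * xp * xp \<le> 2 * (yk * yp)"
  proof -
    have "\<bar>a\<bar> * xp * xp \<le> (t + xk) * xp" using ax x(1) by (rule mult_right_mono)
    then show ?thesis using xy by (simp add: algebra_simps)
  qed
  show ?thesis
  proof (cases "a < 0 \<or> 2 \<le> A")
    case True
    have "\<bar>a\<bar> * xp * s \<le> \<bar>a\<bar> * xp * (xk + xp)"
      using x s(1) by (intro mult_left_mono) auto
    also have "\<dots> = \<bar>a\<bar> * (xp * xk) + \<bar>a\<bar> * xp * xp" by (simp add: algebra_simps)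
    also have "\<dots> \<le> \<bar>a\<bar> * (yk * yp) + 2 * (yk * yp)"
      using ax' xy(1) by (intro add_mono mult_left_mono) auto
    also have "\<dots> = (\<bar>a\<bar> + 2) * (yk * yp)" by (simp add: algebra_simps)
    also have "\<dots> \<le> 2 * A * (yk * yp)"
      \<comment> \<open>For a < 0 one has 1 + |a| = |1 - a| <= A, so |a| + 2 <= A + 1 <= 2 A. For A
        >= 2 the bound follows from |a| <= A.\<close>
      using True A y by (intro mult_right_mono mult_nonneg_nonneg) auto
    finally show ?thesis .
  next
    case False
    have "\<bar>a\<bar> * xp * s \<le> \<bar>a\<bar> * xp * (t + \<bar>1 - a\<bar> * xp)"
      using x s(2) by (intro mult_left_mono) auto
    also have "\<dots> = \<bar>a\<bar> * (xp * t) + \<bar>1 - a\<bar> * (\<bar>a\<bar> * xp * xp)" by (simp add: algebra_simps)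
    also have "\<dots> \<le> \<bar>a\<bar> * (yk * yp) + \<bar>1 - a\<bar> * (2 * (yk * yp))"
      using ax' xy(2) by (intro add_mono mult_left_mono) auto
    also have "\<dots> = (\<bar>a\<bar> + 2 * \<bar>1 - a\<bar>) * (yk * yp)" by (simp add: algebra_simps)
    \<comment> \<open>For 0 <= a <= 1 the factor is 2 - a <= 2 A. For 1 < a <= A < 2 it is 3 a - 2,
      which is below 2 a.\<close>
    also have "\<dots> \<le> 2 * A * (yk * yp)"
      using False A y by (intro mult_right_mono mult_nonneg_nonneg) (auto simp: abs_if split: if_splits)
    finally show ?thesis .
  qed
qed

section \<open>Picard images and the residual estimate for one accelerated step\<close>

locale picard_sequence = skew_form V N L ip b c CP
  for V :: "'a::real_vector set" and N L ip b c CP +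
  fixes \<nu> F :: real and f :: "'a \<Rightarrow> real" and u ut :: "nat \<Rightarrow> 'a"
  assumes \<nu>: "0 < \<nu>" and F: "0 \<le> F" and f_bound: "v \<in> V \<Longrightarrow> \<bar>f v\<bar> \<le> F * N v"
    and u_V: "u n \<in> V" and ut_V: "1 \<le> n \<Longrightarrow> ut n \<in> V"
    and picard: "1 \<le> n \<Longrightarrow> v \<in> V \<Longrightarrow> \<nu> * ip (ut n) v + b (u (n - 1)) (ut n) v = f v"
begin

definition \<kappa> :: real where "\<kappa> = M / \<nu>\<^sup>2 * F"

abbreviation e :: "nat \<Rightarrow> 'a" where "e n \<equiv> u n - u (n - 1)"
abbreviation w :: "nat \<Rightarrow> 'a" where "w n \<equiv> ut n - u (n - 1)"

lemma e_V: "e n \<in> V" by (intro V_diff u_V)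
lemma w_V: "1 \<le> n \<Longrightarrow> w n \<in> V" by (intro V_diff u_V ut_V)

lemma le_if_mult_le: "\<nu> * (x * x) \<le> y * x \<Longrightarrow> 0 \<le> x \<Longrightarrow> 0 \<le> y \<Longrightarrow> x \<le> y / \<nu>"
  using \<nu> by (cases "x = 0") (auto simp: field_simps)

text \<open>The energy estimate: testing the Picard equation with its own solution removes the
  convective term.\<close>

lemma N_ut:
  assumes "1 \<le> n"
  shows "N (ut n) \<le> F / \<nu>"
proof (rule le_if_mult_le)
  have "\<nu> * (N (ut n))\<^sup>2 = f (ut n)"
    using picard[OF assms ut_V[OF assms]] b_self[OF u_V ut_V[OF assms]] ip_self[OF ut_V[OF assms]] by simp
  also have "\<dots> \<le> F * N (ut n)" using f_bound[OF ut_V[OF assms]] by simp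
  finally show "\<nu> * (N (ut n) * N (ut n)) \<le> F * N (ut n)" by (simp add: power2_eq_square)
qed (use N_nonneg F in auto)

lemma kappa_nonneg: "0 \<le> \<kappa>"
  using M_nonneg F \<nu> by (simp add: \<kappa>_def)

text \<open>Subtract two Picard equations and test with the difference of their solutions.
  Skew-symmetry removes the part advected by \<open>u (i - 1)\<close>; what remains is linear in the
  difference of the inputs. No contraction is involved: \<kappa> may exceed 1.\<close>

lemma N_ut_diff:
  assumes i: "1 \<le> i" and j: "1 \<le> j"
  shows "N (ut i - ut j) \<le> \<kappa> * N (u (i - 1) - u (j - 1))"
proof -
  let ?d = "ut i - ut j" and ?D = "u (i - 1) - u (j - 1)"
  have d: "?d \<in> V" and D: "?D \<in> V" using ut_V[OF i] ut_V[OF j] u_V by (auto intro: V_diff)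
  have 0: "b (u (i - 1)) (ut i) ?d = b (u (i - 1)) (ut j) ?d"
    using b_diff2[OF ut_V[OF i] ut_V[OF j] u_V d] b_self[OF u_V d] by simp
  have "\<nu> * (N ?d)\<^sup>2 = \<nu> * ip (ut i) ?d - \<nu> * ip (ut j) ?d"
    using ip_diff[OF ut_V[OF i] ut_V[OF j] d] ip_self[OF d] by (simp add: right_diff_distrib)
  also have "\<dots> = - b ?D (ut j) ?d"
    using picard[OF i d] picard[OF j d] 0 b_diff1[OF u_V u_V ut_V[OF j] d] by simp
  also have "\<dots> \<le> M * N ?D * N (ut j) * N ?d"
    using b_bound_M[OF D ut_V[OF j] d] by simp
  also have "\<dots> \<le> M * N ?D * (F / \<nu>) * N ?d"
    using M_nonneg N_nonneg N_ut[OF j] by (intro mult_right_mono mult_left_mono mult_nonneg_nonneg) auto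
  finally have "N ?d \<le> M * N ?D * (F / \<nu>) / \<nu>"
    using M_nonneg N_nonneg F \<nu> by (intro le_if_mult_le) (auto simp: power2_eq_square)
  then show ?thesis by (simp add: \<kappa>_def power2_eq_square mult_ac)
qed

lemma u_telescope: "j \<le> k \<Longrightarrow> 1 \<le> j \<Longrightarrow> u k - u (j - 1) = (\<Sum>l=j..k. e l)"
  by (induction k rule: dec_induct) (auto simp: algebra_simps)

text \<open>If the first Picard image has distance zero from \<open>u 0\<close>, the Lipschitz bound
  keeps every later image there, and affine combinations stay there as well. Read backwards, a
  nonzero residual at step k forces a nonzero first residual, which gives the lower bound for
  \<open>K\<close>.\<close>

lemma residuals_vanish:
  assumes w1: "N (w 1) = 0" and W: "\<And>n. 1 \<le> n \<Longrightarrow> W n \<subseteq> {1..n}"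
    and \<alpha>: "\<And>n. 1 \<le> n \<Longrightarrow> sum (\<alpha> n) (W n) = 1" "\<And>n. 1 \<le> n \<Longrightarrow> u n = (\<Sum>j\<in>W n. \<alpha> n j *\<^sub>R ut j)"
    and n: "1 \<le> n"
  shows "N (w n) = 0"
proof -
  have utV: "ut j - u 0 \<in> V" if "1 \<le> j" for j using that by (intro V_diff ut_V u_V)
  have ut0: "N (ut j - u 0) = 0" if "1 \<le> j" "N (u (j - 1) - u 0) = 0" for j
  proof -
    have "N (ut j - ut 1) \<le> 0" using N_ut_diff[OF that(1), of 1] that(2) by simp
    moreover have "N (ut j - u 0) \<le> N (ut j - ut 1) + N (w 1)"
      using N_add[OF V_diff[OF ut_V[OF that(1)] ut_V[of 1]] w_V[of 1]] by simp
    ultimately show ?thesis using w1 N_nonneg[of "ut j - u 0"] by linarith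
  qed
  have u0: "N (u n - u 0) = 0" for n
  proof (induction n rule: less_induct)
    case (less n)
    show ?case
    proof (cases "n = 0")
      case False
      have "u n - u 0 = (\<Sum>j\<in>W n. \<alpha> n j *\<^sub>R (ut j - u 0))"
        using \<alpha>[of n] False by (simp add: algebra_simps sum_subtractf flip: scaleR_sum_left)
      moreover have j: "1 \<le> j" "j \<le> n" if "j \<in> W n" for j using W[of n] False that by auto
      ultimately have "N (u n - u 0) \<le> (\<Sum>j\<in>W n. \<bar>\<alpha> n j\<bar> * N (ut j - u 0))"
        using utV by (simp add: N_sum)
      also have "\<dots> = 0"
      proof (intro sum.neutral ballI)
        fix i assume "i \<in> W n"
        then have "N (ut i - u 0) = 0" using j[of i] by (intro ut0 less) auto
        then show "\<bar>\<alpha> n i\<bar> * N (ut i - u 0) = 0" by simp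
      qed
      finally show ?thesis using N_nonneg[of "u n - u 0"] by linarith
    qed (simp add: N_0)
  qed
  have "N (w n) \<le> N (ut n - u 0) + N (u (n - 1) - u 0)"
    using N_diff[OF utV[OF n] V_diff[OF u_V u_V], of "n - 1" 0] by simp
  then show ?thesis using ut0[OF n u0] u0[of "n - 1"] N_nonneg[of "w n"] by linarith
qed

text \<open>One step in isolation, with arbitrary affine weights on the window p..k. Optimality of
  the weights is represented later by the bound on \<open>N wa\<close>.\<close>

context
  fixes a :: "nat \<Rightarrow> real" and p k :: nat
  assumes p: "1 \<le> p" "p \<le> k" and a: "(\<Sum>j=p..k. a j) = 1" and u_k: "u k = (\<Sum>j=p..k. a j *\<^sub>R ut j)"
begin

definition wa :: 'a where "wa = (\<Sum>j=p..k. a j *\<^sub>R w j)"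

definition \<gamma> :: "nat \<Rightarrow> real" where "\<gamma> l = (\<Sum>j=p..l. a j)"

definition S :: "nat \<Rightarrow> 'a" where "S l = (\<Sum>j=p..l. a j *\<^sub>R (ut (k + 1) - ut j))"

lemma wa_V: "wa \<in> V"
  unfolding wa_def using p by (intro V_sum V_scale w_V) auto

lemma S_V: "l \<le> k \<Longrightarrow> S l \<in> V"
  unfolding S_def using p by (intro V_sum V_scale V_diff ut_V) auto

lemma wa_eq: "wa = (\<Sum>l=p..k. \<gamma> l *\<^sub>R e l)"
proof -
  have "wa = u k - (\<Sum>j=p..k. a j *\<^sub>R u (j - 1))"
    unfolding wa_def u_k by (simp add: algebra_simps sum_subtractf)
  also have "\<dots> = (\<Sum>j=p..k. a j *\<^sub>R (u k - u (j - 1)))"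
    using a by (simp add: algebra_simps sum_subtractf flip: scaleR_sum_left)
  also have "\<dots> = (\<Sum>j=p..k. a j *\<^sub>R (\<Sum>l=j..k. e l))"
  proof (intro sum.cong refl)
    fix j assume "j \<in> {p..k}"
    then have "u k - u (j - 1) = (\<Sum>l=j..k. e l)" using p by (intro u_telescope) auto
    then show "a j *\<^sub>R (u k - u (j - 1)) = a j *\<^sub>R (\<Sum>l=j..k. e l)" by (simp only:)
  qed
  also have "\<dots> = (\<Sum>q=p..k. \<gamma> q *\<^sub>R e q)"
    unfolding sum_weighted_tails[OF order_refl] \<gamma>_def by (intro sum.cong) (auto simp: min_def)
  finally show ?thesis .
qed

lemma residual_identity:
  defines "v \<equiv> w (k + 1)"
  shows "\<nu> * (N v)\<^sup>2 = - b wa (ut (k + 1)) v + (\<Sum>l=p..<k. b (e l) (S l) v)"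
proof -
  have k1: "1 \<le> k + 1" by simp
  have v: "v \<in> V" unfolding v_def by (rule w_V) simp
  have v_eq: "v = ut (k + 1) - u k" by (simp add: v_def)
  have utk: "ut (k + 1) \<in> V" by (rule ut_V) simp
  have utj: "ut j \<in> V" if "j \<in> {p..k}" for j using that p by (intro ut_V) auto
  let ?A = "\<Sum>j=p..k. a j * b (u (j - 1)) (ut j) v"
  \<comment> \<open>The right-hand side survives as a single \<open>f v\<close> because the weights
    sum to one; it cancels against the equation for \<open>ut (k + 1)\<close>.\<close>
  have ip_uk: "\<nu> * ip (u k) v = f v - ?A"
  proof -
    have "\<nu> * ip (u k) v = (\<Sum>j=p..k. a j * (\<nu> * ip (ut j) v))"
      unfolding u_k using ip_sum[of "{p..k}" ut v a] utj v by (simp add: sum_distrib_left mult_ac)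
    also have "\<dots> = (\<Sum>j=p..k. a j * (f v - b (u (j - 1)) (ut j) v))"
    proof (intro sum.cong refl)
      fix j assume "j \<in> {p..k}"
      then have "\<nu> * ip (ut j) v = f v - b (u (j - 1)) (ut j) v"
        using picard[of j v] p v by simp
      then show "a j * (\<nu> * ip (ut j) v) = a j * (f v - b (u (j - 1)) (ut j) v)" by simp
    qed
    also have "\<dots> = (\<Sum>j=p..k. a j) * f v - ?A"
      by (simp add: right_diff_distrib sum_subtractf sum_distrib_right)
    finally show ?thesis using a by simp
  qed
  have "\<nu> * (N v)\<^sup>2 = \<nu> * ip (ut (k + 1)) v - \<nu> * ip (u k) v"
    using ip_diff[OF utk u_V v, of k] ip_self[OF v] unfolding v_eq[symmetric]
    by (simp only: right_diff_distrib[symmetric])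
  also have "\<dots> = ?A - b (u k) (ut (k + 1)) v"
    using picard[OF k1 v] ip_uk by simp
  \<comment> \<open>Freezing the second argument at \<open>ut (k + 1)\<close> lets the advecting
    velocities be averaged; their average is \<open>u k - wa\<close>.\<close>
  also have "?A = (\<Sum>j=p..k. a j * b (u (j - 1)) (ut (k + 1)) v)
      - (\<Sum>j=p..k. a j * b (u (j - 1)) (ut (k + 1) - ut j) v)"
    unfolding sum_subtractf[symmetric] right_diff_distrib[symmetric]
  proof (intro sum.cong refl arg_cong2[where f="(*)"])
    fix j assume "j \<in> {p..k}"
    from b_diff2[OF utk utj[OF this] u_V v, of "j - 1"]
    show "b (u (j - 1)) (ut j) v = b (u (j - 1)) (ut (k + 1)) v - b (u (j - 1)) (ut (k + 1) - ut j) v"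
      by linarith
  qed
  also have "(\<Sum>j=p..k. a j * b (u (j - 1)) (ut (k + 1)) v) = b (u k - wa) (ut (k + 1)) v"
  proof -
    have "u k - wa = (\<Sum>j=p..k. a j *\<^sub>R u (j - 1))"
      unfolding wa_def u_k by (simp add: algebra_simps sum_subtractf)
    then show ?thesis using b_sum1[of "{p..k}" "\<lambda>j. u (j - 1)" "ut (k + 1)" v a] u_V utk v by simp
  qed
  also have "\<dots> = b (u k) (ut (k + 1)) v - b wa (ut (k + 1)) v"
    by (rule b_diff1[OF u_V wa_V utk v])
  also have "(\<Sum>j=p..k. a j * b (u (j - 1)) (ut (k + 1) - ut j) v) = - (\<Sum>l=p..<k. b (e l) (S l) v)"
  proof -
    \<comment> \<open>The vanishing base-point term that permits measuring each
      \<open>u (j - 1)\<close> from \<open>u (k - 1)\<close>.\<close>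
    have "(\<Sum>j=p..k. a j * b (u (k - 1)) (ut (k + 1) - ut j) v) = b (u (k - 1)) v v"
    proof -
      have "(\<Sum>j=p..k. a j *\<^sub>R (ut (k + 1) - ut j)) = v"
        using a unfolding v_eq u_k by (simp add: algebra_simps sum_subtractf flip: scaleR_sum_left)
      then show ?thesis
        using b_sum2[of "{p..k}" "\<lambda>j. ut (k + 1) - ut j" "u (k - 1)" v a] u_V v utj utk by (simp add: V_diff)
    qed
    also have "\<dots> = 0" by (rule b_self[OF u_V v])
    finally have 0: "(\<Sum>j=p..k. a j * b (u (k - 1)) (ut (k + 1) - ut j) v) = 0" .
    have "(\<Sum>l=p..<k. b (e l) (S l) v) = (\<Sum>l=p..<k. \<Sum>j=p..l. a j * b (e l) (ut (k + 1) - ut j) v)"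
      unfolding S_def by (intro sum.cong refl b_sum2 e_V v V_diff utk utj) auto
    also have "\<dots> = (\<Sum>l=p..<k. \<Sum>j | j \<in> {p..k} \<and> j \<le> l. a j * b (e l) (ut (k + 1) - ut j) v)"
      by (intro sum.cong) auto
    also have "\<dots> = (\<Sum>j=p..k. \<Sum>l | l \<in> {p..<k} \<and> j \<le> l. a j * b (e l) (ut (k + 1) - ut j) v)"
      by (rule sum.swap_restrict) auto
    also have "\<dots> = (\<Sum>j=p..k. a j * b (u (k - 1) - u (j - 1)) (ut (k + 1) - ut j) v)"
    proof (intro sum.cong refl)
      fix j assume j: "j \<in> {p..k}"
      have "{l. l \<in> {p..<k} \<and> j \<le> l} = {j..<k}" using j by auto
      moreover have "u (k - 1) - u (j - 1) = (\<Sum>l=j..<k. e l)"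
      proof (cases "j = k")
        case False
        then have "{j..<k} = {j..k - 1}" using j by auto
        moreover have "j \<le> k - 1" "1 \<le> j" using False j p by auto
        ultimately show ?thesis using u_telescope[of j "k - 1"] by simp
      qed simp
      ultimately show "(\<Sum>l | l \<in> {p..<k} \<and> j \<le> l. a j * b (e l) (ut (k + 1) - ut j) v)
          = a j * b (u (k - 1) - u (j - 1)) (ut (k + 1) - ut j) v"
        using b_sum1[of "{j..<k}" e "ut (k + 1) - ut j" v "\<lambda>_. 1"] e_V V_diff[OF utk utj[OF j]] v
        by (simp add: sum_distrib_left)
    qed
    also have "\<dots> = (\<Sum>j=p..k. a j * b (u (k - 1)) (ut (k + 1) - ut j) v
        - a j * b (u (j - 1)) (ut (k + 1) - ut j) v)"
      unfolding right_diff_distrib[symmetric]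
    proof (intro sum.cong refl arg_cong2[where f="(*)"])
      fix j assume "j \<in> {p..k}"
      from b_diff1[OF u_V u_V V_diff[OF utk utj[OF this]] v]
      show "b (u (k - 1) - u (j - 1)) (ut (k + 1) - ut j) v
          = b (u (k - 1)) (ut (k + 1) - ut j) v - b (u (j - 1)) (ut (k + 1) - ut j) v" .
    qed
    also have "\<dots> = - (\<Sum>j=p..k. a j * b (u (j - 1)) (ut (k + 1) - ut j) v)"
      by (simp only: sum_subtractf 0 diff_0)
    finally show ?thesis by simp
  qed
  finally show ?thesis by simp
qed

text \<open>Only the term with \<open>wa\<close> takes the interpolated bound; the increments take
  the one with \<open>M\<close>. A factor 1/\<nu> comes from the energy bound on
  \<open>ut (k + 1)\<close>, another from dividing the identity by \<nu>.\<close>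

lemma residual_bound:
  assumes "0 \<le> L wa"
  shows "N (w (k + 1)) \<le> c * sqrt (L wa) * sqrt (N wa) * F / \<nu>\<^sup>2 + M / \<nu> * (\<Sum>l=p..<k. N (e l) * N (S l))"
proof -
  let ?v = "w (k + 1)"
  have v: "?v \<in> V" by (rule w_V) simp
  have utk: "ut (k + 1) \<in> V" by (rule ut_V) simp
  have "\<nu> * (N ?v)\<^sup>2 \<le> c * sqrt (L wa) * sqrt (N wa) * N (ut (k + 1)) * N ?v
      + (\<Sum>l=p..<k. M * N (e l) * N (S l) * N ?v)"
    unfolding residual_identity
  proof (rule add_mono)
    show "- b wa (ut (k + 1)) ?v \<le> c * sqrt (L wa) * sqrt (N wa) * N (ut (k + 1)) * N ?v"
      using b_bound[OF wa_V utk v] by linarith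
    show "(\<Sum>l=p..<k. b (e l) (S l) ?v) \<le> (\<Sum>l=p..<k. M * N (e l) * N (S l) * N ?v)"
    proof (rule sum_mono)
      fix l assume "l \<in> {p..<k}"
      then have "S l \<in> V" by (intro S_V) auto
      from b_bound_M[OF e_V this v] show "b (e l) (S l) ?v \<le> M * N (e l) * N (S l) * N ?v"
        by (rule order_trans[OF abs_ge_self])
    qed
  qed
  also have "\<dots> \<le> c * sqrt (L wa) * sqrt (N wa) * (F / \<nu>) * N ?v
      + (\<Sum>l=p..<k. M * N (e l) * N (S l) * N ?v)"
    using N_ut[of "k + 1"] c assms N_nonneg by (intro add_right_mono mult_right_mono mult_left_mono) auto
  also have "\<dots> = (c * sqrt (L wa) * sqrt (N wa) * (F / \<nu>) + M * (\<Sum>l=p..<k. N (e l) * N (S l))) * N ?v"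
    by (simp add: sum_distrib_left sum_distrib_right algebra_simps)
  finally have le: "\<nu> * (N ?v)\<^sup>2 \<le> (c * sqrt (L wa) * sqrt (N wa) * (F / \<nu>) + M * (\<Sum>l=p..<k. N (e l) * N (S l))) * N ?v" .
  have "0 \<le> c * sqrt (L wa) * sqrt (N wa) * (F / \<nu>) + M * (\<Sum>l=p..<k. N (e l) * N (S l))"
    by (intro add_nonneg_nonneg mult_nonneg_nonneg sum_nonneg real_sqrt_ge_zero divide_nonneg_pos c F \<nu> M_nonneg N_nonneg assms)
  then have "N ?v \<le> (c * sqrt (L wa) * sqrt (N wa) * (F / \<nu>) + M * (\<Sum>l=p..<k. N (e l) * N (S l))) / \<nu>"
    using le N_nonneg[of ?v] by (intro le_if_mult_le) (simp_all add: power2_eq_square)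
  then show ?thesis by (simp add: power2_eq_square add_divide_distrib)
qed

text \<open>The Picard differences are telescoped into consecutive ones. As
  \<open>ut (q + 1)\<close> is the image of \<open>u q\<close>, each of these is at most \<kappa>
  times the norm of \<open>e q\<close>.\<close>

lemma S_bound:
  assumes "l \<le> k"
  shows "N (S l) \<le> \<kappa> * (\<Sum>q=p..k. \<bar>\<gamma> (min l q)\<bar> * N (e q))"
proof -
  have d: "ut (k + 1) - ut j = (\<Sum>q=j..k. ut (q + 1) - ut q)" if "j \<le> k" for j
    using that by (induction k rule: dec_induct) (auto simp: algebra_simps)
  have "S l = (\<Sum>j=p..l. a j *\<^sub>R (\<Sum>q=j..k. ut (q + 1) - ut q))"
    unfolding S_def
  proof (intro sum.cong refl)
    fix j assume "j \<in> {p..l}"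
    then have "ut (k + 1) - ut j = (\<Sum>q=j..k. ut (q + 1) - ut q)" using assms by (intro d) auto
    then show "a j *\<^sub>R (ut (k + 1) - ut j) = a j *\<^sub>R (\<Sum>q=j..k. ut (q + 1) - ut q)" by (simp only:)
  qed
  also have "\<dots> = (\<Sum>q=p..k. \<gamma> (min l q) *\<^sub>R (ut (q + 1) - ut q))"
    unfolding sum_weighted_tails[OF assms] \<gamma>_def ..
  finally have "N (S l) \<le> (\<Sum>q=p..k. \<bar>\<gamma> (min l q)\<bar> * N (ut (q + 1) - ut q))"
    using N_sum[of "{p..k}" "\<lambda>q. ut (q + 1) - ut q" "\<lambda>q. \<gamma> (min l q)"] p by (simp add: V_diff ut_V)
  also have "\<dots> \<le> (\<Sum>q=p..k. \<bar>\<gamma> (min l q)\<bar> * (\<kappa> * N (e q)))"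
    using p N_ut_diff[of "_ + 1" "_"] by (intro sum_mono mult_left_mono) auto
  finally show ?thesis by (simp add: sum_distrib_left mult_ac)
qed

text \<open>The expansion of \<open>wa\<close> is solved for its l-th term: this is the trade of a
  square for mixed products.\<close>

lemma gamma_e_bound:
  assumes "l \<in> {p..k}"
  shows "\<bar>\<gamma> l\<bar> * N (e l) \<le> N wa + (\<Sum>q\<in>{p..k}-{l}. \<bar>\<gamma> q\<bar> * N (e q))"
proof -
  have "\<gamma> l *\<^sub>R e l = wa - (\<Sum>q\<in>{p..k}-{l}. \<gamma> q *\<^sub>R e q)"
    unfolding wa_eq using assms by (simp add: sum.remove)
  moreover have "(\<Sum>q\<in>{p..k}-{l}. \<gamma> q *\<^sub>R e q) \<in> V" by (intro V_sum V_scale e_V)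
  ultimately have "N (\<gamma> l *\<^sub>R e l) \<le> N wa + N (\<Sum>q\<in>{p..k}-{l}. \<gamma> q *\<^sub>R e q)"
    using N_diff[OF wa_V] by simp
  also have "\<dots> \<le> N wa + (\<Sum>q\<in>{p..k}-{l}. \<bar>\<gamma> q\<bar> * N (e q))"
    by (intro add_left_mono N_sum e_V)
  finally show ?thesis using N_scale_eq[OF e_V] by simp
qed

lemma gamma_k: "\<gamma> k = 1"
  using a by (simp add: \<gamma>_def)

lemma abs_gamma_le:
  assumes "\<And>j. j \<in> {p..k} \<Longrightarrow> \<bar>a j\<bar> \<le> A" "p \<le> l" "l \<le> k"
  shows "\<bar>\<gamma> l\<bar> \<le> real (l - p + 1) * A"
proof -
  have "\<bar>\<gamma> l\<bar> \<le> (\<Sum>j=p..l. \<bar>a j\<bar>)" unfolding \<gamma>_def by (rule sum_abs)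
  also have "\<dots> \<le> (\<Sum>j=p..l. A)" using assms by (intro sum_mono) auto
  finally show ?thesis using assms(2) by (simp add: Suc_diff_le)
qed

text \<open>\<open>y\<close> will be \<open>K\<close> times the residual norms. It must dominate the
  increments, and at k the averaged residual as well.\<close>

lemma quadratic_bound:
  assumes y: "\<And>l. l \<in> {p..k} \<Longrightarrow> N (e l) \<le> y l" and t: "N wa \<le> y k" and A: "1 \<le> A"
    and aA: "\<And>j. j \<in> {p..k} \<Longrightarrow> \<bar>a j\<bar> \<le> A"
  shows "(\<Sum>l=p..<k. N (e l) * N (S l))
    \<le> \<kappa> * (real ((k - p) * (k - p + 3)) * A / 2) * (\<Sum>j=p..k. \<Sum>i=p..<j. y j * y i)"
proof -
  consider "k = p" | "k = p + 1" | "p + 2 \<le> k" using p by linarith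
  then show ?thesis
  proof cases
    case 1
    then show ?thesis by simp
  next
    case 2
    have pk: "{p..k} = {p, k}" "{p..<k} = {p}" "k - p = 1" using 2 by auto
    have ak: "a k = 1 - a p" using a 2 unfolding pk by simp
    have gp: "\<gamma> p = a p" by (simp add: \<gamma>_def)
    have wa2: "wa = e k + a p *\<^sub>R e p" unfolding wa_eq pk using 2 gp gamma_k by simp
    have utV: "ut (k + 1) \<in> V" "ut p \<in> V" using p by (auto intro: ut_V)
    have ee: "u k - u (p - 1) = e k + e p" using 2 by simp
    \<comment> \<open>For two indices the Picard difference is not telescoped: keeping
      \<open>e k + e p\<close> under one norm leaves room to estimate it through \<open>wa\<close>
      instead.\<close>
    have "S p = a p *\<^sub>R (ut (k + 1) - ut p)" by (simp add: S_def)
    then have NS: "N (S p) \<le> \<bar>a p\<bar> * (\<kappa> * N (e k + e p))"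
      using N_scale[OF V_diff[OF utV]] mult_left_mono[OF N_ut_diff[of "k + 1" p] abs_ge_zero[of "a p"]] p
      unfolding ee[symmetric] by (simp only: add_diff_cancel_right') (use order_trans in fastforce)
    have "\<bar>a p\<bar> * N (e p) * N (e k + e p) \<le> 2 * A * (y k * y p)"
    proof (rule single_pair_bound)
      show "N (e k + e p) \<le> N (e k) + N (e p)" by (rule N_add[OF e_V e_V])
      have "e k + e p = wa + (1 - a p) *\<^sub>R e p" unfolding wa2 by (simp add: algebra_simps)
      then show "N (e k + e p) \<le> N wa + \<bar>1 - a p\<bar> * N (e p)"
        using N_add[OF wa_V V_scale[OF e_V]] N_scale_eq[OF e_V] by metis
      have "a p *\<^sub>R e p = wa - e k" unfolding wa2 by simp
      then show "\<bar>a p\<bar> * N (e p) \<le> N wa + N (e k)"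
        using N_diff[OF wa_V e_V] N_scale_eq[OF e_V] by metis
      show "\<bar>1 - a p\<bar> \<le> A" using aA[of k] p by (simp add: ak)
    qed (use y t A aA p N_nonneg in auto)
    then have "\<kappa> * (\<bar>a p\<bar> * N (e p) * N (e k + e p)) \<le> \<kappa> * (2 * A * (y k * y p))"
      by (rule mult_left_mono[OF _ kappa_nonneg])
    moreover have "N (e p) * N (S p) \<le> N (e p) * (\<bar>a p\<bar> * (\<kappa> * N (e k + e p)))"
      by (rule mult_left_mono[OF NS N_nonneg])
    ultimately have "N (e p) * N (S p) \<le> \<kappa> * (2 * A * (y k * y p))" by (simp add: mult_ac)
    then show ?thesis using 2 unfolding pk by (simp add: mult_ac)
  next
    case 3
    have "(\<Sum>l=p..<k. N (e l) * N (S l))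
        \<le> (\<Sum>l=p..<k. N (e l) * (\<kappa> * (\<Sum>q=p..k. \<bar>\<gamma> (min l q)\<bar> * N (e q))))"
      by (intro sum_mono mult_left_mono S_bound N_nonneg) auto
    also have "\<dots> = \<kappa> * (\<Sum>l=p..<k. N (e l) * (\<Sum>q=p..k. \<bar>\<gamma> (min l q)\<bar> * N (e q)))"
      by (simp add: sum_distrib_left mult_ac)
    also have "\<dots> \<le> \<kappa> * (real ((k - p) * (k - p + 3)) * A / 2 * (\<Sum>j=p..k. \<Sum>i=p..<j. y j * y i))"
    proof (rule mult_left_mono[OF pair_sum_bound[where x="\<lambda>l. N (e l)" and g=\<gamma>, OF 3 _ y t gamma_k A] kappa_nonneg])
      show "\<bar>\<gamma> l\<bar> \<le> real (l - p + 1) * A" if "l \<in> {p..<k}" for l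
        using that by (intro abs_gamma_le aA) auto
      show "\<bar>\<gamma> l\<bar> * N (e l) \<le> N wa + (\<Sum>q\<in>{p..k}-{l}. \<bar>\<gamma> q\<bar> * N (e q))" if "l \<in> {p..<k}" for l
        using that by (intro gamma_e_bound) auto
    qed (use N_nonneg in auto)
    finally show ?thesis by (simp add: mult.assoc)
  qed
qed

end

end

section \<open>Application to the Navier--Stokes problem\<close>

text \<open>Pointwise scaling makes the functions in \<open>Vh\<close> vectors themselves, so the
  abstract estimates apply to them without a quotient.\<close>

instantiation "fun" :: (type, real_vector) real_vector
begin

definition scaleR_fun_def: "r *\<^sub>R f = (\<lambda>x. r *\<^sub>R f x)"

instance
  by standard (auto simp: scaleR_fun_def fun_eq_iff scaleR_add_right scaleR_add_left)

end

lemma sum_fun_eq: "(\<Sum>j\<in>J. F j) = (\<lambda>x. \<Sum>j\<in>J. F j x)" for F :: "_ \<Rightarrow> _ \<Rightarrow> 'b::real_vector"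
  by (induction J rule: infinite_finite_induct) (auto simp: fun_eq_iff)

lemma comb_eq: "comb c W F = (\<Sum>j\<in>W. c j *\<^sub>R F j)"
  by (simp add: comb_def sum_fun_eq scaleR_fun_def)

lemma finite_span_lin:
  assumes "finite_span S" "u \<in> S" "v \<in> S"
  shows "(\<lambda>x. a *\<^sub>R u x + b *\<^sub>R v x) \<in> S"
proof -
  obtain B where S: "S = {(\<lambda>x. \<Sum>i<length B. c i *\<^sub>R (B ! i) x) | c. True}"
    using assms(1) unfolding finite_span_def by blast
  obtain c d where "u = (\<lambda>x. \<Sum>i<length B. c i *\<^sub>R (B ! i) x)" "v = (\<lambda>x. \<Sum>i<length B. d i *\<^sub>R (B ! i) x)"
    using assms(2,3) unfolding S by blast
  then have "(\<lambda>x. a *\<^sub>R u x + b *\<^sub>R v x) = (\<lambda>x. \<Sum>i<length B. (a * c i + b * d i) *\<^sub>R (B ! i) x)"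
    by (simp add: scaleR_sum_right scaleR_add_left sum.distrib)
  then show ?thesis
    unfolding S mem_Collect_eq by (intro exI[of _ "\<lambda>i. a * c i + b * d i"] conjI TrueI)
qed

lemma Vh_lin:
  assumes \<Omega>: "open \<Omega>" "bounded \<Omega>" and Xh: "finite_span Xh" "\<forall>v\<in>Xh. H10 \<Omega> v"
    and Qh: "\<forall>q\<in>Qh. meanzero \<Omega> q" and u: "u \<in> Vh \<Omega> Xh Qh" and v: "v \<in> Vh \<Omega> Xh Qh"
  shows "(\<lambda>x. a *\<^sub>R u x + b *\<^sub>R v x) \<in> Vh \<Omega> Xh Qh"
proof -
  have X: "u \<in> Xh" "v \<in> Xh" and H: "H10 \<Omega> u" "H10 \<Omega> v" using u v Xh(2) by (auto simp: Vh_def)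
  have "l2inner \<Omega> (divg \<Omega> (\<lambda>x. a *\<^sub>R u x + b *\<^sub>R v x)) q = 0" if q: "q \<in> Qh" for q
  proof -
    have Lq: "L2fun \<Omega> q" using Qh q by (simp add: meanzero_def)
    note L = divg_L2[OF \<Omega> H(1)] divg_L2[OF \<Omega> H(2)]
    have "AE x in lebesgue_on \<Omega>. divg \<Omega> (\<lambda>x. a *\<^sub>R u x + b *\<^sub>R v x) x = a *\<^sub>R divg \<Omega> u x + b *\<^sub>R divg \<Omega> v x"
      using divg_lin_AE[OF \<Omega> H, of a b] by simp
    then have "l2inner \<Omega> (divg \<Omega> (\<lambda>x. a *\<^sub>R u x + b *\<^sub>R v x)) q
        = l2inner \<Omega> (\<lambda>x. a *\<^sub>R divg \<Omega> u x + b *\<^sub>R divg \<Omega> v x) q"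
      by (rule l2inner_cong_AE) (intro AE_I2 refl L2funD(1) L2fun_lin L Lq divg_L2 \<Omega> H10_lin(1) H)+
    also have "\<dots> = 0" using u v q unfolding l2inner_lin_left[OF L Lq] by (simp add: Vh_def)
    finally show ?thesis .
  qed
  then show ?thesis using finite_span_lin[OF Xh(1) X] by (simp add: Vh_def)
qed

lemma subspace_Vh:
  assumes "open \<Omega>" "bounded \<Omega>" "finite_span Xh" "\<forall>v\<in>Xh. H10 \<Omega> v" "\<forall>q\<in>Qh. meanzero \<Omega> q"
    and "Vh \<Omega> Xh Qh \<noteq> {}"
  shows "subspace (Vh \<Omega> Xh Qh)"
proof -
  have lin: "a *\<^sub>R u + b *\<^sub>R v \<in> Vh \<Omega> Xh Qh" if "u \<in> Vh \<Omega> Xh Qh" "v \<in> Vh \<Omega> Xh Qh" for a b u v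
    using Vh_lin[OF assms(1-5) that, of a b] by (simp add: scaleR_fun_def plus_fun_def)
  obtain v0 where v0: "v0 \<in> Vh \<Omega> Xh Qh" using assms(6) by auto
  show ?thesis
  proof (rule subspaceI)
    show "0 \<in> Vh \<Omega> Xh Qh" using lin[OF v0 v0, of 0 0] by simp
    show "x + y \<in> Vh \<Omega> Xh Qh" if "x \<in> Vh \<Omega> Xh Qh" "y \<in> Vh \<Omega> Xh Qh" for x y
      using lin[OF that, of 1 1] by simp
    show "r *\<^sub>R x \<in> Vh \<Omega> Xh Qh" if "x \<in> Vh \<Omega> Xh Qh" for r x
      using lin[OF that that, of r 0] by simp
  qed
qed

text \<open>Boundedness of f makes the supremum finite; where the gradient norm is zero, it forces f
  to vanish.\<close>

lemma dual_norm_bound: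
  assumes "Hminus1 \<Omega> f" "H10 \<Omega> v"
  shows "\<bar>f v\<bar> \<le> dual_norm \<Omega> f * h1norm \<Omega> v"
proof -
  obtain C where C: "\<And>\<phi>. H10 \<Omega> \<phi> \<Longrightarrow> \<bar>f \<phi>\<bar> \<le> C * h1norm \<Omega> \<phi>"
    using assms(1) unfolding Hminus1_def by blast
  show ?thesis
  proof (cases "h1norm \<Omega> v = 0")
    case True
    then show ?thesis using C[OF assms(2)] by simp
  next
    case False
    then have pos: "h1norm \<Omega> v > 0" using h1norm_nonneg[of \<Omega> v] by linarith
    have "\<bar>f v\<bar> / h1norm \<Omega> v \<le> dual_norm \<Omega> f"
      unfolding dual_norm_def
    proof (rule cSup_upper)
      show "bdd_above {\<bar>f \<phi>\<bar> / h1norm \<Omega> \<phi> | \<phi>. H10 \<Omega> \<phi> \<and> h1norm \<Omega> \<phi> \<noteq> 0}"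
      proof (rule bdd_aboveI)
        fix r assume "r \<in> {\<bar>f \<phi>\<bar> / h1norm \<Omega> \<phi> | \<phi>. H10 \<Omega> \<phi> \<and> h1norm \<Omega> \<phi> \<noteq> 0}"
        then obtain \<phi> where \<phi>: "r = \<bar>f \<phi>\<bar> / h1norm \<Omega> \<phi>" "H10 \<Omega> \<phi>" "h1norm \<Omega> \<phi> \<noteq> 0" by blast
        then have "h1norm \<Omega> \<phi> > 0" using h1norm_nonneg[of \<Omega> \<phi>] by linarith
        then show "r \<le> C" using C[OF \<phi>(2)] by (simp add: \<phi>(1) divide_le_eq)
      qed
    qed (use assms(2) False in blast)
    then show ?thesis using pos by (simp add: divide_le_eq)
  qed
qed

text \<open>\<open>Lh\<close>, \<open>Lk\<close> and \<open>Nk\<close> cancel among the three roots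
  and the outer factor, and \<open>sqrt CP\<close> cancels against the one in M. What remains is the
  Hoelder bound for the averaged residual.\<close>

lemma gain_factor_eq:
  fixes c CP \<nu> F Na Nk La Lh Lk :: real
  assumes "0 < CP" "0 < Nk" "0 < Lk" "0 < Lh" "0 \<le> Na" "0 \<le> La"
  shows "sqrt CP * c / \<nu>\<^sup>2 * F * sqrt (Na / Nk) * sqrt (Lh / Lk) * sqrt (La / Lh * (Lk / (CP * Nk))) * Nk
    = c * sqrt La * sqrt Na * F / \<nu>\<^sup>2"
proof -
  have "sqrt (Na / Nk) * sqrt (Lh / Lk) * sqrt (La / Lh * (Lk / (CP * Nk))) = sqrt Na * sqrt La / (sqrt CP * Nk)"
    using assms by (simp add: real_sqrt_mult real_sqrt_divide field_simps)
  then have "sqrt CP * c / \<nu>\<^sup>2 * F * (sqrt (Na / Nk) * sqrt (Lh / Lk) * sqrt (La / Lh * (Lk / (CP * Nk)))) * Nk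
      = sqrt CP * c / \<nu>\<^sup>2 * F * (sqrt Na * sqrt La / (sqrt CP * Nk)) * Nk" by simp
  also have "\<dots> = c * sqrt La * sqrt Na * F / \<nu>\<^sup>2" using assms by simp
  finally show ?thesis by (simp add: mult.assoc)
qed

theorem theorem3p3:
  fixes \<Omega> :: "(real^'d) set"
    and \<nu> CP C3 C6 \<beta> \<sigma> K abar :: real
    and f :: "(real^'d \<Rightarrow> real^'d) \<Rightarrow> real"
    and Xh :: "(real^'d \<Rightarrow> real^'d) set"
    and Qh :: "(real^'d \<Rightarrow> real) set"
    and m k :: nat
    and u ut :: "nat \<Rightarrow> real^'d \<Rightarrow> real^'d"
    and \<alpha> :: "nat \<Rightarrow> nat \<Rightarrow> real"
    and \<alpha>hat :: "nat \<Rightarrow> real"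
  assumes dim: "CARD('d) = 2 \<or> CARD('d) = 3"
    and dom: "bounded \<Omega>" "open \<Omega>" "connected \<Omega>" "\<Omega> \<noteq> {}"
    and poincare: "\<forall>\<phi>. H10 \<Omega> \<phi> \<longrightarrow> l2norm \<Omega> \<phi> \<le> CP * h1norm \<Omega> \<phi>"
    and sobolev6: "\<forall>\<phi>. H10 \<Omega> \<phi> \<longrightarrow> integrable (lebesgue_on \<Omega>) (\<lambda>x. norm (\<phi> x) powr 6)
                      \<and> Lpnorm \<Omega> 6 \<phi> \<le> C6 * h1norm \<Omega> \<phi>"
    and interp3: "\<forall>\<phi>. H10 \<Omega> \<phi> \<longrightarrow> integrable (lebesgue_on \<Omega>) (\<lambda>x. norm (\<phi> x) powr 3)
                      \<and> Lpnorm \<Omega> 3 \<phi> \<le> C3 * sqrt (l2norm \<Omega> \<phi>) * sqrt (h1norm \<Omega> \<phi>)"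
    and Xh: "finite_span Xh" "\<forall>v\<in>Xh. H10 \<Omega> v"
    and Qh: "finite_span Qh" "\<forall>q\<in>Qh. meanzero \<Omega> q"
    and infsup: "\<beta> > 0" "inf_sup \<Omega> Xh Qh \<beta>"
    and nu: "\<nu> > 0"
    and f: "Hminus1 \<Omega> f"
    and AA: "AA_picard \<Omega> \<nu> f (Vh \<Omega> Xh Qh) m u ut \<alpha>"
    and sigma: "\<sigma> > 0"
      "\<forall>j\<ge>1. \<sigma> * h1norm \<Omega> (incr u j)
               \<le> h1norm \<Omega> (\<lambda>x. resid u ut (j + 1) x - resid u ut j x)"
    and alpha_bound: "\<forall>n\<ge>1. \<forall>j\<in>win m n. 0 < \<bar>\<alpha> n j\<bar> \<and> \<bar>\<alpha> n j\<bar> < abar"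
    and indep: "h1_indep \<Omega> (\<lambda>j x. resid u ut j x - resid u ut (j - 1) x) {2..k}"
    and Kbound: "\<forall>j\<ge>1. h1norm \<Omega> (incr u j) \<le> K * h1norm \<Omega> (resid u ut j)"
    and step: "m < k"
    and alphahat: "sum \<alpha>hat {k - m..k} = 1"
      "\<forall>\<gamma>. sum \<gamma> {k - m..k} = 1 \<longrightarrow>
          l2norm \<Omega> (comb \<alpha>hat {k - m..k} (resid u ut)) \<le> l2norm \<Omega> (comb \<gamma> {k - m..k} (resid u ut))"
    and nondeg: "h1norm \<Omega> (resid u ut k) \<noteq> 0" "l2norm \<Omega> (resid u ut k) \<noteq> 0"
      "l2norm \<Omega> (comb \<alpha>hat {k - m..k} (resid u ut)) \<noteq> 0"
  shows
    "let M = sqrt CP * C3 * C6;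
         \<kappa> = M / \<nu>\<^sup>2 * dual_norm \<Omega> f;
         w = resid u ut;
         W = {k - m..k};
         \<theta>H = h1norm \<Omega> (comb (\<alpha> k) W w) / h1norm \<Omega> (w k);
         \<theta>L = l2norm \<Omega> (comb \<alpha>hat W w) / l2norm \<Omega> (w k)
     in h1norm \<Omega> (w (k + 1))
        \<le> \<kappa> * sqrt \<theta>H * sqrt \<theta>L
             * sqrt (l2norm \<Omega> (comb (\<alpha> k) W w) / l2norm \<Omega> (comb \<alpha>hat W w)
                     * (l2norm \<Omega> (w k) / (CP * h1norm \<Omega> (w k))))
             * h1norm \<Omega> (w k)
          + K\<^sup>2 * M / \<nu> * \<kappa> * (real (m * (m + 3)) * abar / 2)
             * (\<Sum>j = k - m + 1..k. \<Sum>i = k - m..j - 1. h1norm \<Omega> (w j) * h1norm \<Omega> (w i))"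
proof -
  note \<Omega> = dom(2,1)
  interpret S: sobolev_domain \<Omega> C3 C6
    by unfold_locales (use \<Omega> sobolev6 interp3 in auto)
  define V where "V = Vh \<Omega> Xh Qh"
  define F where "F = dual_norm \<Omega> f"
  have VH: "H10 \<Omega> v" if "v \<in> V" for v using that Xh(2) by (simp add: V_def Vh_def)
  have u0: "u 0 \<in> V" and pic: "\<And>n. 1 \<le> n \<Longrightarrow> picard \<Omega> \<nu> f V (u (n - 1)) (ut n)"
    and \<alpha>sum: "\<And>n. 1 \<le> n \<Longrightarrow> sum (\<alpha> n) (win m n) = 1"
    and \<alpha>min: "\<And>n \<gamma>. 1 \<le> n \<Longrightarrow> sum \<gamma> (win m n) = 1 \<Longrightarrow>
        h1norm \<Omega> (comb (\<alpha> n) (win m n) (resid u ut)) \<le> h1norm \<Omega> (comb \<gamma> (win m n) (resid u ut))"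
    and u_eq: "\<And>n. 1 \<le> n \<Longrightarrow> u n = (\<Sum>j\<in>win m n. \<alpha> n j *\<^sub>R ut j)"
    using AA unfolding AA_picard_def V_def comb_eq[symmetric] by blast+
  have subV: "subspace V"
    using subspace_Vh[OF \<Omega> Xh Qh(2)] u0 by (auto simp: V_def)
  have win: "win m n \<subseteq> {1..n}" if "1 \<le> n" for n using that by (auto simp: win_def)
  have ut_V: "ut n \<in> V" if "1 \<le> n" for n using pic[OF that] by (simp add: picard_def)
  have u_V: "u n \<in> V" for n
  proof (cases "n = 0")
    case False
    then have "(\<Sum>j\<in>win m n. \<alpha> n j *\<^sub>R ut j) \<in> V"
      using win[of n] by (intro subspace_sum[OF subV] subspace_scale[OF subV] ut_V) auto
    then show ?thesis using u_eq[of n] False by simp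
  qed (simp add: u0)
  have resid: "resid u ut j = ut j - u (j - 1)" and incr: "incr u j = u j - u (j - 1)" for j
    by (simp_all add: resid_def incr_def fun_diff_def)
  have k: "1 \<le> k" "1 \<le> k - m" "k - m \<le> k" using step by auto
  have wk: "resid u ut k \<in> V" unfolding resid by (intro subspace_diff[OF subV] ut_V u_V k)
  have N_pos: "0 < h1norm \<Omega> (resid u ut k)" and L_pos: "0 < l2norm \<Omega> (resid u ut k)"
    and Lh_pos: "0 < l2norm \<Omega> (comb \<alpha>hat {k - m..k} (resid u ut))"
    using nondeg h1norm_nonneg l2norm_nonneg by (auto simp: less_le)
  \<comment> \<open>The signs of the constants are read off from their inequalities at the k-th
    residual, whose norms are nonzero.\<close>
  have C6: "0 \<le> C6"
  proof -
    have "0 \<le> C6 * h1norm \<Omega> (resid u ut k)"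
      using sobolev6 VH[OF wk] by (metis Lpnorm_def powr_ge_zero order_trans)
    then show ?thesis using N_pos by (simp add: zero_le_mult_iff)
  qed
  have C3: "0 \<le> C3"
  proof -
    have "0 \<le> C3 * (sqrt (l2norm \<Omega> (resid u ut k)) * sqrt (h1norm \<Omega> (resid u ut k)))"
      using interp3 VH[OF wk] by (metis Lpnorm_def powr_ge_zero order_trans mult.assoc)
    moreover have "0 < sqrt (l2norm \<Omega> (resid u ut k)) * sqrt (h1norm \<Omega> (resid u ut k))"
      using N_pos L_pos by simp
    ultimately show ?thesis by (simp add: zero_le_mult_iff)
  qed
  have CP: "0 < CP"
  proof -
    have "0 < CP * h1norm \<Omega> (resid u ut k)" using poincare VH[OF wk] L_pos by (metis order_less_le_trans)
    then show ?thesis using N_pos by (simp add: zero_less_mult_iff)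
  qed
  have F: "0 \<le> F"
  proof -
    have "0 \<le> F * h1norm \<Omega> (resid u ut k)"
      unfolding F_def using dual_norm_bound[OF f VH[OF wk]] by linarith
    then show ?thesis using N_pos by (simp add: zero_le_mult_iff)
  qed
  have lc: "p *\<^sub>R v + q *\<^sub>R z = (\<lambda>x. p *\<^sub>R v x + q *\<^sub>R z x)" for p q and v z :: "real^'d \<Rightarrow> real^'d"
    by (simp add: scaleR_fun_def plus_fun_def)
  interpret P: picard_sequence V "h1norm \<Omega>" "l2norm \<Omega>" "\<lambda>v z. l2inner \<Omega> (grad \<Omega> v) (grad \<Omega> z)" "bstar \<Omega>"
    "C3 * C6" CP \<nu> F f u ut
  proof unfold_locales
    show "h1norm \<Omega> (p *\<^sub>R v + q *\<^sub>R z) \<le> \<bar>p\<bar> * h1norm \<Omega> v + \<bar>q\<bar> * h1norm \<Omega> z" if "v \<in> V" "z \<in> V" for v z p q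
      unfolding lc by (intro h1norm_lin_le \<Omega> VH that)
    show "l2inner \<Omega> (grad \<Omega> v) (grad \<Omega> v) = (h1norm \<Omega> v)\<^sup>2" for v
      by (simp add: h1norm_def l2norm_sq_inner)
    show "\<bar>bstar \<Omega> v w z\<bar> \<le> C3 * C6 * sqrt (l2norm \<Omega> v) * sqrt (h1norm \<Omega> v) * h1norm \<Omega> w * h1norm \<Omega> z"
      if "v \<in> V" "w \<in> V" "z \<in> V" for v w z
      by (intro S.bstar_bound VH that)
    show "\<nu> * l2inner \<Omega> (grad \<Omega> (ut n)) (grad \<Omega> v) + bstar \<Omega> (u (n - 1)) (ut n) v = f v"
      if "1 \<le> n" "v \<in> V" for n v
      using pic[OF that(1)] that(2) by (simp add: picard_def)
    show "\<bar>f v\<bar> \<le> F * h1norm \<Omega> v" if "v \<in> V" for v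
      unfolding F_def by (rule dual_norm_bound[OF f VH[OF that]])
    show "l2norm \<Omega> v \<le> CP * h1norm \<Omega> v" if "v \<in> V" for v using poincare VH[OF that] by blast
  qed (use subV ut_V u_V C3 C6 CP F nu in
      \<open>simp_all add: lc VH l2inner_grad_lin[OF \<Omega>] S.bstar_lin1 S.bstar_lin2 S.bstar_self\<close>)

  define \<omega> where "\<omega> j = h1norm \<Omega> (resid u ut j)" for j
  have wink: "win m k = {k - m..k}" using step by (simp add: win_def min_def)
  have abar: "1 \<le> abar"
  proof -
    have "win m 1 = {1}" by (auto simp: win_def)
    then show ?thesis using \<alpha>sum[of 1] alpha_bound[rule_format, of 1 1] by simp
  qed
  have \<omega>1: "0 < \<omega> 1"
  proof (rule ccontr)
    assume "\<not> 0 < \<omega> 1"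
    then have "h1norm \<Omega> (ut 1 - u (1 - 1)) = 0"
      using h1norm_nonneg[of \<Omega> "resid u ut 1"] unfolding \<omega>_def resid by linarith
    then have "h1norm \<Omega> (ut k - u (k - 1)) = 0"
      by (rule P.residuals_vanish[OF _ win \<alpha>sum u_eq k(1)])
    then show False using N_pos unfolding resid by simp
  qed
  have K: "1 \<le> K"
  proof -
    have "win m 1 = {1}" by (auto simp: win_def)
    then have "u 1 = ut 1" using u_eq[of 1] \<alpha>sum[of 1] by simp
    then have "\<omega> 1 \<le> K * \<omega> 1" using Kbound[rule_format, of 1] unfolding \<omega>_def resid incr by simp
    then show ?thesis using \<omega>1 by simp
  qed
  define wa where "wa = comb (\<alpha> k) {k - m..k} (resid u ut)"
  note step_facts = k(2,3) \<alpha>sum[OF k(1), unfolded wink] u_eq[OF k(1), unfolded wink]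
  have wa_P: "P.wa (\<alpha> k) (k - m) k = wa"
    unfolding P.wa_def[OF step_facts] wa_def comb_eq resid ..
  have wa_le: "h1norm \<Omega> wa \<le> \<omega> k"
  proof -
    \<comment> \<open>All weight on the last residual is an admissible competitor.\<close>
    have "comb (\<lambda>j. if j = k then 1 else 0) {k - m..k} (resid u ut) = resid u ut k"
      using k by (simp add: comb_def if_distrib[of "\<lambda>c. c *\<^sub>R _"] cong: if_cong)
    then show ?thesis
      using \<alpha>min[OF k(1), of "\<lambda>j. if j = k then 1 else 0"] k unfolding wink wa_def \<omega>_def by simp
  qed
  let ?\<kappa> = "sqrt CP * (C3 * C6) / \<nu>\<^sup>2 * F"
  have \<kappa>: "P.\<kappa> = ?\<kappa>" "P.M = sqrt CP * (C3 * C6)" by (simp_all add: P.\<kappa>_def P.M_def)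
  let ?\<Sigma> = "\<Sum>j = k - m + 1..k. \<Sum>i = k - m..j - 1. \<omega> j * \<omega> i"
  have sums: "(\<Sum>j=k - m..k. \<Sum>i=k - m..<j. (K * \<omega> j) * (K * \<omega> i)) = K\<^sup>2 * ?\<Sigma>"
  proof -
    \<comment> \<open>The row \<open>j = k - m\<close> is empty, which accounts for the lower limit
      \<open>k - m + 1\<close> in the claim.\<close>
    have "{k - m..k} = insert (k - m) {k - m + 1..k}" using k by auto
    then have "(\<Sum>j=k - m..k. \<Sum>i=k - m..<j. (K * \<omega> j) * (K * \<omega> i))
        = (\<Sum>j=k - m + 1..k. \<Sum>i=k - m..<j. (K * \<omega> j) * (K * \<omega> i))" by simp
    also have "\<dots> = (\<Sum>j=k - m + 1..k. \<Sum>i=k - m..j - 1. (K * \<omega> j) * (K * \<omega> i))"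
      by (intro sum.cong) auto
    also have "\<dots> = K\<^sup>2 * ?\<Sigma>" by (simp add: sum_distrib_left power2_eq_square mult_ac)
    finally show ?thesis .
  qed
  have quad: "(\<Sum>l=k - m..<k. h1norm \<Omega> (u l - u (l - 1)) * h1norm \<Omega> (P.S (\<alpha> k) (k - m) k l))
      \<le> ?\<kappa> * (real (m * (m + 3)) * abar / 2) * (K\<^sup>2 * ?\<Sigma>)"
  proof -
    have mk: "k - (k - m) = m" using step by simp
    show ?thesis
      unfolding sums[symmetric] \<kappa>(1)[symmetric]
    proof (rule P.quadratic_bound[OF step_facts, unfolded mk])
      show "h1norm \<Omega> (u l - u (l - 1)) \<le> K * \<omega> l" if "l \<in> {k - m..k}" for l
        using Kbound[rule_format, of l] that k unfolding incr \<omega>_def by simp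
      \<comment> \<open>The averaged residual is bounded by \<open>\<omega> k\<close> without a
        factor; \<open>1 \<le> K\<close> inserts it.\<close>
      show "h1norm \<Omega> (P.wa (\<alpha> k) (k - m) k) \<le> K * \<omega> k"
        unfolding wa_P using wa_le mult_right_mono[OF K, of "\<omega> k"] N_pos unfolding \<omega>_def by linarith
      show "\<bar>\<alpha> k j\<bar> \<le> abar" if "j \<in> {k - m..k}" for j
        using alpha_bound[rule_format, OF k(1), of j] that by (simp add: wink less_imp_le)
    qed (rule abar)
  qed
  have "\<omega> (k + 1) \<le> C3 * C6 * sqrt (l2norm \<Omega> wa) * sqrt (h1norm \<Omega> wa) * F / \<nu>\<^sup>2
      + sqrt CP * (C3 * C6) / \<nu> * (\<Sum>l=k - m..<k. h1norm \<Omega> (u l - u (l - 1)) * h1norm \<Omega> (P.S (\<alpha> k) (k - m) k l))"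
    using P.residual_bound[OF step_facts] unfolding wa_P \<kappa>(2) \<omega>_def resid by simp
  also have "\<dots> \<le> C3 * C6 * sqrt (l2norm \<Omega> wa) * sqrt (h1norm \<Omega> wa) * F / \<nu>\<^sup>2
      + sqrt CP * (C3 * C6) / \<nu> * (?\<kappa> * (real (m * (m + 3)) * abar / 2) * (K\<^sup>2 * ?\<Sigma>))"
    using P.M_nonneg nu unfolding \<kappa>(2) by (intro add_left_mono mult_left_mono quad) simp
  finally have main: "\<omega> (k + 1) \<le> C3 * C6 * sqrt (l2norm \<Omega> wa) * sqrt (h1norm \<Omega> wa) * F / \<nu>\<^sup>2
      + K\<^sup>2 * (sqrt CP * (C3 * C6)) / \<nu> * ?\<kappa> * (real (m * (m + 3)) * abar / 2) * ?\<Sigma>"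
    by (simp add: mult_ac)
  show ?thesis
    using main
    unfolding Let_def mult.assoc[of "sqrt CP" C3 C6]
      gain_factor_eq[OF CP N_pos L_pos Lh_pos h1norm_nonneg l2norm_nonneg]
    unfolding \<omega>_def wa_def F_def .
qed

end
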